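(* Let $k$ be an algebraically closed field, let $d>n\ge 2$ be integers with the characteristic of $k$ not dividing $n$, and let $f(x)\in k[x]$ be a separable polynomial of degree $d$ with (distinct) roots $\alpha_1,\dots,\alpha_d$. Let $\mathcal{X}$ be the smooth projective curve with affine equation $y^n=f(x)$, and assume that its genus $g$ satisfies $g\ge 2$. Then for every $i\in\{1,\dots,d\}$ the affine branch point $\mathfrak{b}_i=(\alpha_i,0)$ is a $q$-Weierstrass point of $\mathcal{X}$ for all integers $q\ge 1$.
   Context: The points $\mathfrak{b}_i=(\alpha_i,0)$ are the affine branch points of the cover $\phi:\mathcal{X}\to\mathbb{P}^1(k)$, $(x,y)\mapsto x$. For $q\ge1$ let $H^0(\mathcal{X},(\Omega^1)^{q})$ be the $k$-vector space of holomorphic $q$-fold differentials on $\mathcal{X}$ and $d_q$ its dimension ($d_1=g$, and $d_q=(g-1)(2q-1)$ for $q>1$). For a point $P\in\mathcal{X}$ choose a basis $\psi_1,\dots,\psi_{d_q}$ with $\operatorname{ord}_P(\psi_1)<\operatorname{ord}_P(\psi_2)<\dots<\operatorname{ord}_P(\psi_{d_q})$, and put $n_i=\operatorname{ord}_P(\psi_i)+1$. The $q$-gap sequence at $P$ is $\{n_1,\dots,n_{d_q}\}$. The point $P$ is a $q$-Weierstrass point if its $q$-gap sequence is different from $\{1,2,\dots,d_q\}$. *)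

theory Defs
  imports
    "HOL-Computational_Algebra.Computational_Algebra"
    "HOL-Algebra.Algebraic_Closure_Type"
    "HOL-Library.Function_Algebras"
begin

(* All function fields are realised as subfields of the algebraic closure of k(x). *)
type_synonym 'k alg_fun = "'k poly fract alg_closure"

definition of_poly :: "'k::field poly \<Rightarrow> 'k alg_fun"
  where "of_poly p = to_ac (to_fract p)"

definition const_fun :: "'k::field \<Rightarrow> 'k alg_fun"
  where "const_fun c = of_poly [:c:]"

definition coord_x :: "'k::field alg_fun"
  where "coord_x = of_poly [:0, 1:]"

definition is_subfield :: "'a::field set \<Rightarrow> bool"
  where "is_subfield F \<longleftrightarrow> 0 \<in> F \<and> 1 \<in> F \<and>
    (\<forall>a\<in>F. \<forall>b\<in>F. a + b \<in> F \<and> a * b \<in> F) \<and> (\<forall>a\<in>F. - a \<in> F \<and> inverse a \<in> F)"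

(* The field k(x, y). If y ^ n = f(x) with y ^ n - f(x) irreducible over k(x), it is the function
   field of the plane curve y ^ n = f(x). *)
definition function_field :: "'k::field alg_fun \<Rightarrow> 'k alg_fun set"
  where "function_field y = \<Inter>{F. is_subfield F \<and> range const_fun \<subseteq> F \<and> coord_x \<in> F \<and> y \<in> F}"

(* Over an algebraically closed field k, the points of the smooth projective curve with function
   field K are the discrete valuation rings of K/k. A point is represented by its
   normalised valuation, that is, by the order function ord_P on nonzero rational functions.
   The value is set to 0 at the zero function and outside K, so that distinct functions are
   distinct points. *)
definition points :: "'k::field alg_fun set \<Rightarrow> ('k alg_fun \<Rightarrow> int) set"
  where "points K = {P.
    (\<forall>a\<in>K - {0}. \<forall>b\<in>K - {0}. P (a * b) = P a + P b \<and> (a + b \<noteq> 0 \<longrightarrow> min (P a) (P b) \<le> P (a + b))) \<and>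
    (\<forall>c. c \<noteq> 0 \<longrightarrow> P (const_fun c) = 0) \<and>
    P ` (K - {0}) = UNIV \<and>
    (\<forall>a. a \<notin> K - {0} \<longrightarrow> P a = 0)}"

(* The function a takes the value c at the point P. *)
definition has_value :: "('k::field alg_fun \<Rightarrow> int) \<Rightarrow> 'k alg_fun \<Rightarrow> 'k \<Rightarrow> bool"
  where "has_value P a c \<longleftrightarrow> a = const_fun c \<or> 0 < P (a - const_fun c)"

(* Meaningful when (a, b) is a nonsingular point of the affine plane curve: then there is exactly
   one point of the smooth projective model above it. *)
definition affine_point :: "'k::field alg_fun \<Rightarrow> 'k \<Rightarrow> 'k \<Rightarrow> 'k alg_fun \<Rightarrow> int"
  where "affine_point y a b =
    (THE P. P \<in> points (function_field y) \<and> has_value P coord_x a \<and> has_value P y b)"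

definition derivations :: "'k::field alg_fun set \<Rightarrow> ('k alg_fun \<Rightarrow> 'k alg_fun) set"
  where "derivations K = {D.
    (\<forall>a\<in>K. D a \<in> K) \<and>
    (\<forall>a\<in>K. \<forall>b\<in>K. D (a + b) = D a + D b \<and> D (a * b) = a * D b + b * D a) \<and>
    (\<forall>c. D (const_fun c) = 0) \<and>
    (\<forall>a. a \<notin> K \<longrightarrow> D a = 0)}"

(* The q-fold differential h (dt)^q. The module of differentials of K/k is the K-dual of the
   space of k-derivations of K, where dt is the functional D \<mapsto> D t. As both spaces are
   one-dimensional over K, every element of the q-th tensor power has the form h (dt)^q, and it is
   determined by its values h * (D t)^q on the derivations D. *)
type_synonym 'k differential = "('k alg_fun \<Rightarrow> 'k alg_fun) \<Rightarrow> 'k alg_fun"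

definition diff_form :: "'k::field alg_fun set \<Rightarrow> nat \<Rightarrow> 'k alg_fun \<Rightarrow> 'k alg_fun \<Rightarrow> 'k differential"
  where "diff_form K q h t = (\<lambda>D. if D \<in> derivations K then h * D t ^ q else 0)"

definition differentials :: "'k::field alg_fun set \<Rightarrow> nat \<Rightarrow> 'k differential set"
  where "differentials K q = {diff_form K q h t | h t. h \<in> K \<and> t \<in> K}"

(* ord_P(h (dt)^q) = ord_P(h) for a local parameter t at P. Only used for nonzero differentials. *)
definition diff_ord :: "'k::field alg_fun set \<Rightarrow> nat \<Rightarrow> ('k alg_fun \<Rightarrow> int) \<Rightarrow> 'k differential \<Rightarrow> int"
  where "diff_ord K q P \<omega> =
    (THE m. \<exists>h\<in>K - {0}. \<exists>t\<in>K. P t = 1 \<and> \<omega> = diff_form K q h t \<and> m = P h)"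

definition holomorphic_differentials :: "'k::field alg_fun set \<Rightarrow> nat \<Rightarrow> 'k differential set"
  where "holomorphic_differentials K q =
    {\<omega> \<in> differentials K q. \<omega> \<noteq> 0 \<longrightarrow> (\<forall>P\<in>points K. 0 \<le> diff_ord K q P \<omega>)}"

definition diff_scale :: "'k::field \<Rightarrow> 'k differential \<Rightarrow> 'k differential"
  where "diff_scale c \<omega> = (\<lambda>D. const_fun c * \<omega> D)"

lemma const_fun_add: "const_fun (a + b) = const_fun a + const_fun b"
proof -
  have "[:a + b:] = [:a:] + [:b:]" by simp
  then show ?thesis by (simp only: const_fun_def of_poly_def to_fract_add to_ac_add)
qed

lemma const_fun_mult: "const_fun (a * b) = const_fun a * const_fun b"
proof -
  have "[:a * b:] = [:a:] * [:b:]" by simp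
  then show ?thesis by (simp only: const_fun_def of_poly_def to_fract_mult to_ac_mult)
qed

lemma const_fun_1: "const_fun 1 = 1"
  by (simp add: const_fun_def of_poly_def flip: one_pCons)

global_interpretation diff: vector_space "diff_scale :: 'k::field \<Rightarrow> 'k differential \<Rightarrow> _"
  by unfold_locales
    (auto simp: diff_scale_def fun_eq_iff const_fun_add const_fun_mult const_fun_1 algebra_simps)

definition genus :: "'k::field alg_fun set \<Rightarrow> nat"
  where "genus K = diff.dim (holomorphic_differentials K 1)"

definition is_gap_sequence ::
    "'k::field alg_fun set \<Rightarrow> nat \<Rightarrow> ('k alg_fun \<Rightarrow> int) \<Rightarrow> int set \<Rightarrow> bool"
  where "is_gap_sequence K q P G \<longleftrightarrow>
    (let H = holomorphic_differentials K q; dq = diff.dim H in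
      \<exists>\<psi> :: nat \<Rightarrow> 'k differential.
        inj_on \<psi> {1..dq} \<and> diff.independent (\<psi> ` {1..dq}) \<and> diff.span (\<psi> ` {1..dq}) = H \<and>
        strict_mono_on {1..dq} (\<lambda>i. diff_ord K q P (\<psi> i)) \<and>
        G = (\<lambda>i. diff_ord K q P (\<psi> i) + 1) ` {1..dq})"

(* The gap sequence is uniquely determined by K, q and P. *)
definition is_q_Weierstrass :: "'k::field alg_fun set \<Rightarrow> nat \<Rightarrow> ('k alg_fun \<Rightarrow> int) \<Rightarrow> bool"
  where "is_q_Weierstrass K q P \<longleftrightarrow> P \<in> points K \<and>
    (\<exists>G. is_gap_sequence K q P G \<and> G \<noteq> {1..int (diff.dim (holomorphic_differentials K q))})"

end

theory Submission
  imports Defs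
begin

text \<open>
  The holomorphic \<open>q\<close>-differentials have the basis \<open>x\<^sup>i y\<^sup>j (dx / y\<^sup>n\<^sup>-\<^sup>1)\<^sup>q\<close> with \<open>j < n\<close> and
  \<open>i n + j d \<le> q (2 g - 2)\<close>. Replacing \<open>x\<close> by \<open>x - \<alpha>\<close>, such an element has order \<open>i n + j\<close> at
  the branch point above \<open>\<alpha>\<close>, because \<open>x - \<alpha>\<close> has order \<open>n\<close> and \<open>y\<close> has order \<open>1\<close> there. For
  \<open>i\<close> maximal with \<open>i n \<le> q (2 g - 2)\<close> the order \<open>i n\<close> occurs, but \<open>i n - 1\<close> does not: it would
  need the factor \<open>y\<^sup>n\<^sup>-\<^sup>1\<close>, whose pole at infinity is too large.

  Every point is the order function of an embedding of the function field into \<open>k((s))\<close>. All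
  orders of differentials are computed in these Laurent series, where \<open>dx\<close> becomes the formal
  derivative of the image of \<open>x\<close>.
\<close>

text \<open>The form \<open>dx / y^(n-1)\<close> has neither zeros nor poles on the affine curve, so
  its whole divisor, of degree \<open>2 g - 2\<close>, lies at the \<open>G = gcd n d\<close> points
  at infinity, in equal shares. There \<open>x\<close> and \<open>y\<close> have poles of order
  \<open>n / G\<close> and \<open>d / G\<close>. This is the origin of the weights in
  \<open>i n + j d\<close> and of the bound \<open>q (2 g - 2)\<close>.

  That the listed differentials are holomorphic has to be checked at every abstract valuation, hence
  the expansion at an arbitrary point. That they span needs only points written down explicitly. The
  obstacle there is cancellation: for \<open>G > 1\<close> different monomials can have the same
  pole order at a point at infinity, so orders at a single point do not bound the terms, and all
  conjugates \<open>\<zeta> y\<close> of \<open>y\<close> have to be used together.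

  The dimension \<open>d_q\<close> is obtained by counting the basis. As the basis elements have
  distinct orders at the branch point, these orders plus 1 are the gaps, and the question is whether
  the set of orders is an initial segment of the naturals. The assumption on the genus is read off
  from the same count for \<open>q = 1\<close>.\<close>

lemma of_poly_0 [simp]: "of_poly 0 = 0"
  and of_poly_1 [simp]: "of_poly 1 = 1"
  and of_poly_add [simp]: "of_poly (p + q) = of_poly p + of_poly q"
  and of_poly_diff [simp]: "of_poly (p - q) = of_poly p - of_poly q"
  and of_poly_mult [simp]: "of_poly (p * q) = of_poly p * of_poly q"
  by (simp_all add: of_poly_def)

lemma of_poly_eq_iff [simp]: "of_poly p = of_poly q \<longleftrightarrow> p = q"
  by (simp add: of_poly_def)

lemma of_poly_eq_0_iff [simp]: "of_poly p = 0 \<longleftrightarrow> p = 0"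
  by (simp add: of_poly_def)

lemma of_poly_const [simp]: "of_poly [:c:] = const_fun c"
  by (simp add: const_fun_def)

lemma of_poly_pCons: "of_poly (pCons c p) = const_fun c + coord_x * of_poly p"
proof -
  have "pCons c p = [:c:] + [:0, 1:] * p" by simp
  then show ?thesis by (simp only: of_poly_add of_poly_mult const_fun_def coord_x_def)
qed

lemma const_fun_0 [simp]: "const_fun 0 = 0"
  using of_poly_const[of 0] by simp

lemma const_fun_diff: "const_fun (a - b) = const_fun a - const_fun b"
proof -
  have "[:a - b:] = [:a:] - [:b:]" by simp
  then show ?thesis by (simp only: const_fun_def of_poly_diff)
qed

lemma const_fun_minus: "const_fun (- a) = - const_fun a"
  using const_fun_diff[of 0 a] by simp

lemma const_fun_eq_iff [simp]: "const_fun a = const_fun b \<longleftrightarrow> a = b"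
  by (simp add: const_fun_def del: of_poly_const)

lemma const_fun_eq_0_iff [simp]: "const_fun a = 0 \<longleftrightarrow> a = 0"
  using const_fun_eq_iff[of a 0] by (simp del: const_fun_eq_iff)

lemma const_fun_inverse: "const_fun (inverse a) = inverse (const_fun a)"
proof (cases "a = 0")
  case False
  then have "const_fun (inverse a) * const_fun a = 1"
    by (simp flip: const_fun_mult add: const_fun_1)
  then show ?thesis by (metis inverse_unique mult.commute)
qed simp

lemma const_fun_of_nat: "const_fun (of_nat m) = of_nat m"
  by (induction m) (simp_all add: const_fun_1 const_fun_add)

lemma coord_x_neq_const: "coord_x \<noteq> const_fun a"
  by (simp add: coord_x_def const_fun_def del: of_poly_const)

text \<open>Clearing denominators in a relation over \<open>k(x)\<close> leaves coefficients in
  \<open>k[x]\<close>, whose orders at a point can be computed.\<close>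

lemma alg_fun_algebraic:
  fixes h :: "'k::field alg_fun"
  obtains p :: "'k poly poly" where "p \<noteq> 0" "poly (map_poly of_poly p) h = 0"
proof -
  obtain r :: "'k poly fract poly" where r: "r \<noteq> 0" "poly (map_poly to_ac r) h = 0"
    by (rule alg_closure_algebraic)
  have "\<exists>d p. d \<noteq> 0 \<and> smult (to_fract d) r = map_poly to_fract p" for r :: "'k poly fract poly"
  proof (induction r)
    case 0
    then show ?case by (intro exI[of _ 1] exI[of _ 0]) simp
  next
    case (pCons a r)
    then obtain d p where dp: "d \<noteq> 0" "smult (to_fract d) r = map_poly to_fract p" by blast
    obtain u v where uv: "a = Fract u v" "v \<noteq> 0" by (cases a) auto
    then have a: "a = to_fract u / to_fract v" by (simp add: Fract_conv_to_fract)
    have "smult (to_fract v) (smult (to_fract d) r) = map_poly to_fract (smult v p)"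
      by (simp add: dp(2))
    then have "smult (to_fract (v * d)) (pCons a r) = map_poly to_fract (pCons (d * u) (smult v p))"
      using uv(2) by (simp add: a map_poly_pCons)
    then show ?case using dp(1) uv(2) by (intro exI[of _ "v * d"] exI) auto
  qed
  then obtain d p where dp: "d \<noteq> 0" "smult (to_fract d) r = map_poly to_fract p" by blast
  have "map_poly (of_poly :: 'k poly \<Rightarrow> _) p = map_poly to_ac (map_poly to_fract p)"
    by (intro poly_eqI) (simp add: coeff_map_poly of_poly_def)
  also have "\<dots> = smult (to_ac (to_fract d)) (map_poly to_ac r)"
    by (simp add: dp(2)[symmetric] map_poly_smult)
  finally have "poly (map_poly of_poly p) h = 0" using r(2) by simp
  moreover have "p \<noteq> 0" using dp r(1) by auto
  ultimately show ?thesis by (rule that[rotated])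
qed

subsection \<open>Points as discrete valuations\<close>

locale function_subfield =
  fixes K :: "'k::field alg_fun set"
  assumes subfield: "is_subfield K" and const_mem [simp]: "const_fun c \<in> K"
begin

lemma zero_mem [simp]: "0 \<in> K" and one_mem [simp]: "1 \<in> K"
  and add_mem [intro]: "a \<in> K \<Longrightarrow> b \<in> K \<Longrightarrow> a + b \<in> K"
  and mult_mem [intro]: "a \<in> K \<Longrightarrow> b \<in> K \<Longrightarrow> a * b \<in> K"
  and minus_mem [intro]: "a \<in> K \<Longrightarrow> - a \<in> K"
  and inverse_mem [intro]: "a \<in> K \<Longrightarrow> inverse a \<in> K"
  using subfield by (auto simp: is_subfield_def)

lemma diff_mem [intro]: "a \<in> K \<Longrightarrow> b \<in> K \<Longrightarrow> a - b \<in> K"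
  using add_mem[of a "- b"] minus_mem[of b] by simp

lemma divide_mem [intro]: "a \<in> K \<Longrightarrow> b \<in> K \<Longrightarrow> a / b \<in> K"
  unfolding divide_inverse by auto

lemma power_mem [intro]: "a \<in> K \<Longrightarrow> a ^ m \<in> K"
  by (induction m) auto

lemma powi_mem [intro]: "a \<in> K \<Longrightarrow> a powi m \<in> K"
  by (auto simp: power_int_def)

lemma sum_mem [intro]: "(\<And>i. i \<in> I \<Longrightarrow> u i \<in> K) \<Longrightarrow> sum u I \<in> K"
  by (induction I rule: infinite_finite_induct) auto

end

locale curve_point = function_subfield K for K :: "'k::field alg_fun set" +
  fixes P :: "'k alg_fun \<Rightarrow> int"
  assumes point: "P \<in> points K"
begin

lemma ord_mult: "a \<in> K \<Longrightarrow> a \<noteq> 0 \<Longrightarrow> b \<in> K \<Longrightarrow> b \<noteq> 0 \<Longrightarrow> P (a * b) = P a + P b"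
  using point by (auto simp: points_def)

lemma ord_add:
  "a \<in> K \<Longrightarrow> a \<noteq> 0 \<Longrightarrow> b \<in> K \<Longrightarrow> b \<noteq> 0 \<Longrightarrow> a + b \<noteq> 0 \<Longrightarrow> min (P a) (P b) \<le> P (a + b)"
  using point by (auto simp: points_def)

lemma ord_const [simp]: "P (const_fun c) = 0"
  using point by (cases "c = 0") (auto simp: points_def)

lemma ord_0 [simp]: "P 0 = 0" using ord_const[of 0] by (simp del: ord_const)

lemma ord_1 [simp]: "P 1 = 0" using ord_const[of 1] by (simp del: ord_const add: const_fun_1)

lemma ord_outside: "a \<notin> K \<Longrightarrow> P a = 0"
  using point by (auto simp: points_def)

lemma uniformizer: obtains t where "t \<in> K" "t \<noteq> 0" "P t = 1"
proof -
  have "1 \<in> P ` (K - {0})" using point by (auto simp: points_def)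
  then obtain t where "1 = P t" "t \<in> K - {0}" by (rule imageE)
  then show ?thesis using that[of t] by simp
qed

lemma ord_minus: assumes "a \<in> K" shows "P (- a) = P a"
proof (cases "a = 0")
  case False
  have "P (const_fun (- 1) * a) = P a"
    using assms False by (subst ord_mult) auto
  then show ?thesis by (simp add: const_fun_minus const_fun_1)
qed simp

lemma ord_inverse: assumes "a \<in> K" shows "P (inverse a) = - P a"
proof (cases "a = 0")
  case False
  then have "P (a * inverse a) = P a + P (inverse a)" using assms by (intro ord_mult) auto
  then show ?thesis using False by simp
qed simp

lemma ord_divide:
  "a \<in> K \<Longrightarrow> a \<noteq> 0 \<Longrightarrow> b \<in> K \<Longrightarrow> b \<noteq> 0 \<Longrightarrow> P (a / b) = P a - P b"
  by (simp add: divide_inverse ord_mult ord_inverse inverse_mem)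

lemma ord_power: assumes "a \<in> K" "a \<noteq> 0" shows "P (a ^ m) = int m * P a"
proof (induction m)
  case (Suc m)
  have "P (a * a ^ m) = P a + P (a ^ m)" using assms by (intro ord_mult) auto
  then show ?case using Suc by (simp add: algebra_simps)
qed simp

lemma ord_powi: assumes "a \<in> K" "a \<noteq> 0" shows "P (a powi m) = m * P a"
  using assms by (auto simp: power_int_def ord_power ord_inverse inverse_mem)

lemma ord_add_eq:
  assumes "a \<in> K" "a \<noteq> 0" "b \<in> K" "b = 0 \<or> P a < P b"
  shows "a + b \<noteq> 0" "P (a + b) = P a"
proof -
  show nz: "a + b \<noteq> 0"
  proof
    assume "a + b = 0"
    then have "b = - a" by (simp add: eq_neg_iff_add_eq_0 add.commute)
    then show False using assms ord_minus by auto
  qed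
  show "P (a + b) = P a"
  proof (cases "b = 0")
    case False
    then have "min (P a) (P b) \<le> P (a + b)" using assms nz by (intro ord_add) auto
    moreover have "min (P (a + b)) (P (- b)) \<le> P (a + b + - b)"
      using assms nz False by (intro ord_add) auto
    ultimately show ?thesis using assms False ord_minus[of b] by auto
  qed simp
qed

definition ge :: "int \<Rightarrow> 'k alg_fun \<Rightarrow> bool"
  where "ge m h \<longleftrightarrow> h \<in> K \<and> (h = 0 \<or> m \<le> P h)"

lemma ge_mono: "ge m h \<Longrightarrow> m' \<le> m \<Longrightarrow> ge m' h" by (auto simp: ge_def)

lemma ge_0 [simp]: "ge m 0" by (simp add: ge_def)

lemma ge_const [simp]: "ge 0 (const_fun c)" by (simp add: ge_def)

lemma ge_add: "ge m a \<Longrightarrow> ge m b \<Longrightarrow> ge m (a + b)"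
  using ord_add[of a b] by (cases "a + b = 0"; cases "a = 0"; cases "b = 0") (auto simp: ge_def)

lemma ge_minus: "ge m a \<Longrightarrow> ge m (- a)"
  using ord_minus[of a] by (auto simp: ge_def)

lemma ge_diff: "ge m a \<Longrightarrow> ge m b \<Longrightarrow> ge m (a - b)"
  using ge_add[of m a "- b"] ge_minus[of m b] by simp

lemma ge_mult: "ge m a \<Longrightarrow> ge m' b \<Longrightarrow> ge (m + m') (a * b)"
  using ord_mult[of a b] by (cases "a = 0"; cases "b = 0") (auto simp: ge_def)

lemma ge_sum: "(\<And>i. i \<in> I \<Longrightarrow> ge m (u i)) \<Longrightarrow> ge m (sum u I)"
  by (induction I rule: infinite_finite_induct) (auto intro: ge_add)

text \<open>Exactly one term attains the minimum, and by the strict triangle inequality it dominates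
  the sum of the others.\<close>

lemma ord_sum_distinct:
  assumes "finite I" "I \<noteq> {}" "\<And>i. i \<in> I \<Longrightarrow> u i \<in> K \<and> u i \<noteq> 0" "inj_on (\<lambda>i. P (u i)) I"
  shows "sum u I \<noteq> 0 \<and> P (sum u I) = Min ((\<lambda>i. P (u i)) ` I)"
proof -
  let ?v = "\<lambda>i. P (u i)"
  have "Min (?v ` I) \<in> ?v ` I" using assms by (intro Min_in) auto
  then obtain i where i: "i \<in> I" "Min (?v ` I) = ?v i" by auto
  have less: "?v i < ?v j" if "j \<in> I - {i}" for j
  proof -
    have "?v i \<le> ?v j" using i that assms(1) by (metis Diff_iff Min_le finite_imageI image_eqI)
    moreover have "?v i \<noteq> ?v j" using assms(4) i that by (auto dest: inj_onD)
    ultimately show ?thesis by simp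
  qed
  have "ge (?v i + 1) (sum u (I - {i}))"
    using less assms(3) by (intro ge_sum) (fastforce simp: ge_def)
  then have "sum u (I - {i}) \<in> K" "sum u (I - {i}) = 0 \<or> ?v i < P (sum u (I - {i}))"
    by (auto simp: ge_def)
  then have "u i + sum u (I - {i}) \<noteq> 0 \<and> P (u i + sum u (I - {i})) = ?v i"
    using ord_add_eq assms(3) i by blast
  then show ?thesis using i assms(1) by (simp add: sum.remove)
qed

end

subsection \<open>Laurent expansions at a point\<close>

definition laurent_embedding :: "'k::field alg_fun set \<Rightarrow> ('k alg_fun \<Rightarrow> 'k fls) \<Rightarrow> bool"
  where "laurent_embedding K \<Phi> \<longleftrightarrow>
    (\<forall>a\<in>K. \<forall>b\<in>K. \<Phi> (a + b) = \<Phi> a + \<Phi> b \<and> \<Phi> (a * b) = \<Phi> a * \<Phi> b) \<and>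
    (\<forall>c. \<Phi> (const_fun c) = fls_const c)"

text \<open>The value 0 outside \<open>K\<close> is the one required by \<open>points\<close>, so
  that this can equal a point as a function.\<close>

definition embedding_ord :: "'k::field alg_fun set \<Rightarrow> ('k alg_fun \<Rightarrow> 'k fls) \<Rightarrow> 'k alg_fun \<Rightarrow> int"
  where "embedding_ord K \<Phi> = (\<lambda>h. if h \<in> K then fls_subdegree (\<Phi> h) else 0)"

text \<open>The assumption \<open>residue\<close> says that the residue field of \<open>P\<close> is
  \<open>k\<close>; it is established for every point by \<open>residue_field\<close>.\<close>

locale local_coordinate = curve_point +
  fixes t
  assumes residue: "\<And>h. h \<in> K \<Longrightarrow> h \<noteq> 0 \<Longrightarrow> P h = 0 \<Longrightarrow> \<exists>c. h = const_fun c \<or> 0 < P (h - const_fun c)"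
    and t_mem [simp]: "t \<in> K" and t_nz [simp]: "t \<noteq> 0" and ord_t [simp]: "P t = 1"
begin

lemma residue_unique:
  assumes "ge 1 (h - const_fun c)" "ge 1 (h - const_fun c')" shows "c = c'"
proof (rule ccontr)
  assume "c \<noteq> c'"
  have "ge 1 (h - const_fun c - (h - const_fun c'))" using assms by (rule ge_diff)
  then have "ge 1 (const_fun (c' - c))" by (simp add: const_fun_diff)
  then show False using \<open>c \<noteq> c'\<close> by (auto simp: ge_def const_fun_eq_0_iff)
qed

lemma residue_exists:
  assumes "ge 0 h" shows "\<exists>c. ge 1 (h - const_fun c)"
proof (cases "h = 0 \<or> P h > 0")
  case True
  then show ?thesis using assms by (intro exI[of _ 0]) (auto simp: ge_def)
next
  case False
  then have "h \<in> K" "h \<noteq> 0" "P h = 0" using assms by (auto simp: ge_def)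
  then obtain c where c: "h = const_fun c \<or> 0 < P (h - const_fun c)" using residue by blast
  have "h - const_fun c \<in> K" using \<open>h \<in> K\<close> by auto
  with c show ?thesis by (intro exI[of _ c]) (auto simp: ge_def)
qed

definition leading :: "'a alg_fun \<Rightarrow> 'a"
  where "leading h = (THE c. ge 1 (h - const_fun c))"

lemma leading: "ge 0 h \<Longrightarrow> ge 1 (h - const_fun (leading h))"
  unfolding leading_def using residue_exists residue_unique by (metis (mono_tags, lifting) theI')

lemma leading_eqI: "ge 1 (h - const_fun c) \<Longrightarrow> leading h = c"
  unfolding leading_def using residue_unique by blast

text \<open>Subtracting the residue and dividing by \<open>t\<close> shifts the expansion by one
  place; iteration yields the Taylor coefficients of \<open>h\<close> in \<open>t\<close>.\<close>

definition tail :: "'a alg_fun \<Rightarrow> 'a alg_fun"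
  where "tail h = (h - const_fun (leading h)) / t"

lemma ge_divide_t: "ge (m + 1) h \<Longrightarrow> ge m (h / t)"
  using ord_divide[of h t] by (cases "h = 0") (auto simp: ge_def)

lemma tail_ge: "ge 0 h \<Longrightarrow> ge 0 (tail h)"
  unfolding tail_def using leading[of h] ge_divide_t[of 0] by simp

lemma leading_const [simp]: "leading (const_fun c) = c"
  by (rule leading_eqI) simp

lemma leading_add: assumes "ge 0 a" "ge 0 b" shows "leading (a + b) = leading a + leading b"
  by (rule leading_eqI)
    (use ge_add[OF leading[OF assms(1)] leading[OF assms(2)]] in \<open>simp add: const_fun_add algebra_simps\<close>)

lemma leading_mult: assumes "ge 0 a" "ge 0 b" shows "leading (a * b) = leading a * leading b"
proof (rule leading_eqI)
  have "ge (1 + 0) ((a - const_fun (leading a)) * b)"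
    by (intro ge_mult leading assms)
  moreover have "ge (0 + 1) (const_fun (leading a) * (b - const_fun (leading b)))"
    by (intro ge_mult leading assms ge_const)
  ultimately have "ge 1 ((a - const_fun (leading a)) * b + const_fun (leading a) * (b - const_fun (leading b)))"
    using ge_add by simp
  then show "ge 1 (a * b - const_fun (leading a * leading b))"
    by (simp add: const_fun_mult algebra_simps)
qed

lemma tail_add: assumes "ge 0 a" "ge 0 b" shows "tail (a + b) = tail a + tail b"
  by (simp add: tail_def leading_add assms const_fun_add diff_divide_distrib add_divide_distrib)

lemma tail_mult:
  assumes "ge 0 a" "ge 0 b" shows "tail (a * b) = tail a * b + const_fun (leading a) * tail b"
  by (simp add: tail_def leading_mult assms const_fun_mult field_simps)

definition expansion :: "'a alg_fun \<Rightarrow> 'a fps"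
  where "expansion h = Abs_fps (\<lambda>i. leading ((tail ^^ i) h))"

lemma expansion_nth_0: "expansion h $ 0 = leading h"
  and expansion_nth_Suc: "expansion h $ Suc i = expansion (tail h) $ i"
  by (simp_all add: expansion_def funpow_swap1)

lemma expansion_add: "ge 0 a \<Longrightarrow> ge 0 b \<Longrightarrow> expansion (a + b) = expansion a + expansion b"
proof (rule fps_ext)
  fix i show "ge 0 a \<Longrightarrow> ge 0 b \<Longrightarrow> expansion (a + b) $ i = (expansion a + expansion b) $ i"
    by (induction i arbitrary: a b)
      (simp_all add: expansion_nth_0 expansion_nth_Suc leading_add tail_add tail_ge)
qed

lemma expansion_const [simp]: "expansion (const_fun c) = fps_const c"
proof (rule fps_ext)
  have "tail (const_fun c) = 0" for c by (simp add: tail_def)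
  then have "(tail ^^ i) (const_fun c) = (if i = 0 then const_fun c else 0)" for i
    using \<open>\<And>c. tail (const_fun c) = 0\<close>[of 0] by (induction i) simp_all
  then show "expansion (const_fun c) $ i = fps_const c $ i" for i
    using leading_const[of 0] by (simp add: expansion_def del: leading_const[of 0])
qed

lemma ge_t: "ge 1 t" by (simp add: ge_def)

lemma expansion_t [simp]: "expansion t = fps_X"
proof (rule fps_ext)
  have "leading t = 0" by (rule leading_eqI) (simp add: ge_t)
  then have *: "tail t = const_fun 1" by (simp add: tail_def const_fun_1)
  show "expansion t $ i = fps_X $ i" for i
    using \<open>leading t = 0\<close> expansion_const[of 1]
    by (cases i) (simp_all only: expansion_nth_0 expansion_nth_Suc *, simp_all add: fps_X_def)
qed

text \<open>Induction on the index: by \<open>tail_mult\<close>, the shifted product is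
  \<open>tail a * b\<close> plus the correction \<open>leading a * tail b\<close>, which is the
  recursion of the Cauchy product.\<close>

lemma expansion_mult: "ge 0 a \<Longrightarrow> ge 0 b \<Longrightarrow> expansion (a * b) = expansion a * expansion b"
proof (rule fps_ext)
  fix i show "ge 0 a \<Longrightarrow> ge 0 b \<Longrightarrow> expansion (a * b) $ i = (expansion a * expansion b) $ i"
  proof (induction i arbitrary: a b)
    case 0
    then show ?case by (simp add: expansion_nth_0 leading_mult)
  next
    case (Suc i)
    have ex: "expansion h = fps_const (leading h) + fps_X * expansion (tail h)" for h
      by (rule fps_ext) (auto simp: expansion_nth_0 expansion_nth_Suc split: nat.split
          simp: nth_less_subdegree_zero neq0_conv gr0_conv_Suc)
    have gg: "ge 0 (tail a * b)" "ge 0 (const_fun (leading a) * tail b)"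
      using ge_mult[OF tail_ge Suc.prems(2), of a] ge_mult[OF ge_const tail_ge[OF Suc.prems(2)], of "leading a"]
        Suc.prems by simp_all
    have "expansion (a * b) $ Suc i =
        expansion (tail a * b) $ i + expansion (const_fun (leading a) * tail b) $ i"
      by (simp add: expansion_nth_Suc tail_mult Suc.prems expansion_add gg)
    also have "expansion (tail a * b) $ i = (expansion (tail a) * expansion b) $ i"
      by (intro Suc.IH tail_ge Suc.prems)
    also have "expansion (const_fun (leading a) * tail b) $ i = leading a * expansion b $ Suc i"
      using Suc.IH[of "const_fun (leading a)" "tail b"] by (simp add: tail_ge Suc.prems expansion_nth_Suc)
    also have "(expansion (tail a) * expansion b) $ i + leading a * expansion b $ Suc i =
        ((fps_const (leading a) + fps_X * expansion (tail a)) * expansion b) $ Suc i"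
      by (simp add: distrib_right mult.assoc)
    finally show ?case by (simp only: ex[symmetric])
  qed
qed

lemma expansion_power: "ge 0 a \<Longrightarrow> ge 0 (a ^ m) \<and> expansion (a ^ m) = expansion a ^ m"
proof (induction m)
  case 0
  then show ?case using expansion_const[of 1] ge_const[of 1] by (simp add: const_fun_1 del: expansion_const ge_const)
next
  case (Suc m)
  then show ?case using ge_mult[of 0 a 0 "a ^ m"] by (simp add: expansion_mult)
qed

text \<open>Any \<open>m\<close> not above the order of \<open>h\<close> gives the same series. This
  freedom allows functions of different orders to be added at a common \<open>m\<close>.\<close>

definition laurent_at :: "int \<Rightarrow> 'a alg_fun \<Rightarrow> 'a fls"
  where "laurent_at m h = fps_to_fls (expansion (h / t powi m)) * fls_X powi m"

definition laurent :: "'a alg_fun \<Rightarrow> 'a fls"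
  where "laurent h = laurent_at (P h) h"

lemma ge_divide_powi: "ge (m + l) h \<Longrightarrow> ge l (h / t powi m)"
  using ord_divide[of h "t powi m"] ord_powi[of t m] powi_mem[of t m]
  by (cases "h = 0") (auto simp: ge_def)

lemma fps_to_fls_X_eq: "fps_to_fls fps_X = fls_X" by (rule fls_eqI) (auto simp: fps_X_def)

lemma fls_X_powi_add: "(fls_X :: 'a fls) powi (i + j) = fls_X powi i * fls_X powi j"
  by (rule power_int_add) simp

lemma laurent_at_eq:
  assumes "ge m h" "m' \<le> m" shows "laurent_at m h = laurent_at m' h"
proof -
  have g: "ge 0 (h / t powi m)" using assms ge_divide_powi[of m 0 h] by simp
  define d where "d = nat (m - m')"
  have m': "m = m' + int d" using assms by (simp add: d_def)
  have "h / t powi m' = t ^ d * (h / t powi m)"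
    unfolding m' by (simp add: power_int_add power_int_minus)
  then have "expansion (h / t powi m') = fps_X ^ d * expansion (h / t powi m)"
    using g expansion_power[OF ge_mono[OF ge_t, of 0], of d]
    by (simp del: times_divide_eq_right add: expansion_mult)
  then have "laurent_at m' h = fps_to_fls (expansion (h / t powi m)) * (fls_X ^ d * fls_X powi m')"
    by (simp add: laurent_at_def fls_times_fps_to_fls fps_to_fls_power fps_to_fls_X_eq)
  also have "fls_X ^ d * fls_X powi m' = (fls_X powi m :: 'a fls)"
    unfolding m' fls_X_powi_add power_int_of_nat by (rule mult.commute)
  finally show ?thesis by (simp add: laurent_at_def)
qed

lemma laurent_eq: assumes "ge m h" shows "laurent h = laurent_at m h"
proof (cases "h = 0")
  case True
  have "expansion 0 = 0" using expansion_const[of 0] by (simp del: expansion_const)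
  then show ?thesis using True by (simp add: laurent_def laurent_at_def)
next
  case False
  then have "ge (P h) h" "m \<le> P h" using assms by (auto simp: ge_def)
  then show ?thesis unfolding laurent_def by (rule laurent_at_eq)
qed

lemma laurent_embedding: "laurent_embedding K laurent"
  unfolding laurent_embedding_def
proof (intro conjI ballI allI)
  fix a b assume ab: "a \<in> K" "b \<in> K"
  define m where "m = min (P a) (P b)"
  have g: "ge m a" "ge m b" using ab by (auto simp: ge_def m_def)
  have "ge 0 (a / t powi m)" "ge 0 (b / t powi m)" using g ge_divide_powi[of m 0] by auto
  then show "laurent (a + b) = laurent a + laurent b"
    using g ge_add[OF g]
    by (simp add: laurent_eq[of m] laurent_at_def add_divide_distrib expansion_add distrib_right)
  have gm: "ge (m + m) (a * b)" using g by (rule ge_mult)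
  have "a * b / t powi (m + m) = (a / t powi m) * (b / t powi m)"
    using power_int_add[of t m m] by simp
  then have "laurent (a * b) = fps_to_fls (expansion (a / t powi m) * expansion (b / t powi m)) * fls_X powi (m + m)"
    using \<open>ge 0 (a / t powi m)\<close> \<open>ge 0 (b / t powi m)\<close>
    unfolding laurent_eq[OF gm] laurent_at_def by (simp only: expansion_mult)
  then show "laurent (a * b) = laurent a * laurent b"
    using g unfolding fls_X_powi_add
    by (simp only: laurent_eq[of m] laurent_at_def fls_times_fps_to_fls mult_ac)
next
  fix c show "laurent (const_fun c) = fls_const c"
    by (simp add: laurent_def laurent_at_def)
qed

lemma laurent_subdegree:
  assumes "h \<in> K" "h \<noteq> 0" shows "laurent h \<noteq> 0 \<and> fls_subdegree (laurent h) = P h"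
proof -
  define u where "u = h / t powi (P h)"
  have u: "u \<in> K" "u \<noteq> 0" "P u = 0"
    using assms ord_divide[of h "t powi P h"] ord_powi[of t "P h"] powi_mem[of t "P h"]
    by (auto simp: u_def)
  then have "ge 0 u" by (simp add: ge_def)
  have "leading u \<noteq> 0"
  proof
    assume "leading u = 0"
    with leading[OF \<open>ge 0 u\<close>] show False using u by (simp add: ge_def)
  qed
  then have "expansion u $ 0 \<noteq> 0" by (simp add: expansion_nth_0)
  then have "subdegree (expansion u) = 0" "expansion u \<noteq> 0" by (auto intro: subdegree_eq_0)
  then show ?thesis by (simp add: laurent_def laurent_at_def fls_subdegree_fls_to_fps flip: u_def)
qed

lemma embedding_ord_laurent: "embedding_ord K laurent = P"
proof
  fix h
  have "laurent 0 = 0" using laurent_embedding by (metis const_fun_0 fls_const_0 laurent_embedding_def)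
  then show "embedding_ord K laurent h = P h"
    using laurent_subdegree[of h] ord_outside[of h] by (cases "h = 0") (auto simp: embedding_ord_def)
qed

end

subsection \<open>Evaluating polynomials\<close>

text \<open>Evaluation along a ring homomorphism, instantiated below for coefficients in
  \<open>k\<close> and in \<open>k[x]\<close>, with values in algebraic functions and in Laurent
  series.\<close>

locale poly_evaluation =
  fixes h :: "'a::comm_ring_1 \<Rightarrow> 'b::comm_ring_1"
  assumes hom_0: "h 0 = 0" and hom_1: "h 1 = 1"
    and hom_add: "h (a + b) = h a + h b" and hom_mult: "h (a * b) = h a * h b"
begin

definition ev :: "'b \<Rightarrow> 'a poly \<Rightarrow> 'b" where "ev x p = poly (map_poly h p) x"

lemma ev_0 [simp]: "ev x 0 = 0" by (simp add: ev_def)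

lemma ev_pCons [simp]: "ev x (pCons a p) = h a + x * ev x p"
  by (simp add: ev_def map_poly_pCons hom_0)

lemma ev_1 [simp]: "ev x 1 = 1"
  using ev_pCons[of x 1 0] by (simp add: hom_1 flip: one_pCons)

lemma ev_add [simp]: "ev x (p + q) = ev x p + ev x q"
proof (induction p arbitrary: q)
  case (pCons a p)
  then show ?case by (cases q) (simp add: hom_add algebra_simps)
qed simp

lemma ev_smult [simp]: "ev x (smult c p) = h c * ev x p"
  by (induction p) (simp_all add: hom_mult algebra_simps)

lemma ev_mult [simp]: "ev x (p * q) = ev x p * ev x q"
  by (induction p) (simp_all add: algebra_simps hom_0)

lemma ev_minus [simp]: "ev x (- p) = - ev x p"
  using ev_add[of x p "- p"] by (simp add: eq_neg_iff_add_eq_0 add.commute)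

lemma ev_diff [simp]: "ev x (p - q) = ev x p - ev x q"
  using ev_add[of x p "- q"] by simp

lemma ev_power [simp]: "ev x (p ^ m) = ev x p ^ m"
  by (induction m) simp_all

lemma ev_sum: "ev x (sum u I) = (\<Sum>i\<in>I. ev x (u i))"
  by (induction I rule: infinite_finite_induct) simp_all

lemma ev_monom: "ev x (monom a m) = h a * x ^ m"
  by (induction m) (simp_all add: monom_0 monom_Suc hom_0 mult_ac)

lemma ev_altdef: "degree p \<le> N \<Longrightarrow> ev x p = (\<Sum>j\<le>N. h (coeff p j) * x ^ j)"
  by (subst poly_as_sum_of_monoms'[of p N, symmetric]) (simp_all add: ev_sum ev_monom)

end

subsection \<open>Polynomials in a Laurent series\<close>

global_interpretation laurent_poly: poly_evaluation "fls_const :: 'k::comm_ring_1 \<Rightarrow> _"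
  defines fls_poly = laurent_poly.ev
  by unfold_locales (simp_all add: fls_plus_const)

lemma fls_poly_deriv:
  "fls_deriv (fls_poly Z p) = fls_poly Z (pderiv p) * fls_deriv Z"
  by (induction p) (simp_all add: pderiv_pCons algebra_simps)

lemma fls_poly_linear: "fls_poly Z [:- a, 1:] = Z - fls_const a"
  by simp

definition fls_ge :: "int \<Rightarrow> 'k::field fls \<Rightarrow> bool"
  where "fls_ge m F \<longleftrightarrow> (\<forall>i<m. fls_nth F i = 0)"

lemma fls_geI: "m \<le> fls_subdegree F \<Longrightarrow> fls_ge m F" by (simp add: fls_ge_def)

lemma fls_ge_iff: "fls_ge m F \<longleftrightarrow> F = 0 \<or> m \<le> fls_subdegree F"
  unfolding fls_ge_def using fls_subdegree_geI[of F m] by (cases "F = 0") auto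

lemma fls_ge_add: "fls_ge m F \<Longrightarrow> fls_ge m G \<Longrightarrow> fls_ge m (F + G)" by (simp add: fls_ge_def)

lemma fls_ge_sum: "(\<And>i. i \<in> I \<Longrightarrow> fls_ge m (u i)) \<Longrightarrow> fls_ge m (sum u I)"
  by (induction I rule: infinite_finite_induct) (auto intro: fls_ge_add simp: fls_ge_def)

lemma fls_ge_mult: "fls_ge m F \<Longrightarrow> fls_ge m' G \<Longrightarrow> fls_ge (m + m') (F * G)"
  by (cases "F = 0"; cases "G = 0") (auto simp: fls_ge_iff)

lemma fls_ge_const [simp]: "fls_ge 0 (fls_const c)" by (simp add: fls_ge_iff)

lemma fls_ge_poly: "fls_ge 0 Z \<Longrightarrow> fls_ge 0 (fls_poly Z p)"
proof (induction p)
  case (pCons a p)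
  then show ?case using fls_ge_mult[of 0 Z 0 "fls_poly Z p"] by (auto intro: fls_ge_add)
qed (simp add: fls_ge_def)

text \<open>Modulo series of positive order, \<open>p(Z)\<close> is the constant
  \<open>p(a)\<close>.\<close>

lemma fls_subdegree_poly_unit:
  assumes "fls_ge 1 (Z - fls_const a)" "poly p a \<noteq> 0"
  shows "fls_poly Z p \<noteq> 0 \<and> fls_subdegree (fls_poly Z p) = 0"
proof -
  have Z: "fls_ge 0 Z"
    using fls_ge_add[of 0 "Z - fls_const a" "fls_const a"] assms(1) by (auto simp: fls_ge_iff)
  have "[:- a, 1:] dvd p - [:poly p a:]" by (simp add: poly_eq_0_iff_dvd[symmetric])
  then obtain r where "p - [:poly p a:] = [:- a, 1:] * r" by (rule dvdE)
  then have "fls_poly Z (p - [:poly p a:]) = fls_poly Z ([:- a, 1:] * r)" by (rule arg_cong)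
  then have r: "fls_poly Z p = fls_const (poly p a) + (Z - fls_const a) * fls_poly Z r"
    by (simp only: laurent_poly.ev_diff laurent_poly.ev_mult fls_poly_linear diff_eq_eq)
      (simp add: add.commute)
  have "fls_ge (1 + 0) ((Z - fls_const a) * fls_poly Z r)"
    by (intro fls_ge_mult assms fls_ge_poly Z)
  then have 0: "fls_nth (fls_poly Z p) i = fls_nth (fls_const (poly p a)) i" if "i \<le> 0" for i
    using that unfolding r by (simp add: fls_ge_def del: fls_const_nth)
  from 0[of 0] assms(2) have "fls_poly Z p \<noteq> 0" by auto
  moreover have "fls_subdegree (fls_poly Z p) = 0"
    by (rule fls_subdegree_eqI) (use 0 assms(2) in auto)
  ultimately show ?thesis by blast
qed

lemma fls_subdegree_poly_order:
  fixes Z :: "'k::field fls"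
  assumes "Z \<noteq> fls_const a" "0 < fls_subdegree (Z - fls_const a)" "p \<noteq> 0"
  shows "fls_poly Z p \<noteq> 0 \<and>
    fls_subdegree (fls_poly Z p) = int (order a p) * fls_subdegree (Z - fls_const a)"
proof -
  obtain q where q: "p = [:- a, 1:] ^ order a p * q" "\<not> [:- a, 1:] dvd q"
    using order_decomp[OF assms(3), of a] by auto
  have "fls_ge 1 (Z - fls_const a)" using assms by (simp add: fls_ge_iff)
  then have u: "fls_poly Z q \<noteq> 0" "fls_subdegree (fls_poly Z q) = 0"
    using fls_subdegree_poly_unit[of Z a q] q(2) by (auto simp: poly_eq_0_iff_dvd)
  have "fls_poly Z p = (Z - fls_const a) ^ order a p * fls_poly Z q"
    by (subst q(1)) (simp only: laurent_poly.ev_mult laurent_poly.ev_power fls_poly_linear)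
  then show ?thesis using u assms(1) by (simp add: fls_subdegree_pow)
qed

text \<open>At a pole the leading term dominates: each Horner step adds a constant to a series of
  negative order.\<close>

lemma fls_subdegree_poly_degree:
  fixes Z :: "'k::field fls"
  assumes "fls_subdegree Z < 0" "p \<noteq> 0"
  shows "fls_poly Z p \<noteq> 0 \<and> fls_subdegree (fls_poly Z p) = int (degree p) * fls_subdegree Z"
  using assms(2)
proof (induction p)
  case (pCons a p)
  show ?case
  proof (cases "p = 0")
    case False
    have "Z \<noteq> 0" using assms(1) by auto
    with False pCons.IH have nz: "Z * fls_poly Z p \<noteq> 0"
      and d: "fls_subdegree (Z * fls_poly Z p) = fls_subdegree Z + int (degree p) * fls_subdegree Z"
      by auto
    have "int (degree p) * fls_subdegree Z \<le> 0" using assms(1) by (simp add: mult_nonneg_nonpos)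
    then have neg: "fls_subdegree (Z * fls_poly Z p) < 0" using d assms(1) by simp
    then have "fls_subdegree (fls_const a + Z * fls_poly Z p) = fls_subdegree (Z * fls_poly Z p)"
      using nz by (intro fls_subdegree_add_eq2) auto
    moreover from this neg have "fls_const a + Z * fls_poly Z p \<noteq> 0" by auto
    ultimately show ?thesis using False d by (simp add: algebra_simps)
  qed (use pCons in simp)
qed simp

text \<open>A nonconstant series is transcendental over an algebraically closed \<open>k\<close>,
  because a polynomial splits there and no factor \<open>Z - c\<close> vanishes.\<close>

lemma fls_poly_nonzero:
  fixes Z :: "'k::alg_closed_field fls"
  assumes "Z \<notin> range fls_const" "p \<noteq> 0" shows "fls_poly Z p \<noteq> 0"
proof -
  obtain A where "p = smult (lead_coeff p) (\<Prod>x\<in>#A. [:-x, 1:])"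
    using alg_closed_imp_factorization[OF assms(2)] by blast
  moreover have "fls_poly Z (\<Prod>x\<in>#A. [:-x, 1:]) \<noteq> 0"
  proof (induction A)
    case (add a A)
    have "Z - fls_const a \<noteq> 0" using assms(1) by auto
    then show ?case using add by (simp only: image_mset_add_mset prod_mset.add_mset
      laurent_poly.ev_mult fls_poly_linear) simp
  qed simp
  ultimately show ?thesis using assms(2)
    by (metis laurent_poly.ev_smult fls_const_eq_0_iff leading_coeff_0_iff mult_eq_0_iff)
qed

lemma fls_sum_distinct_nonzero:
  fixes u :: "'i \<Rightarrow> 'k::field fls"
  assumes "finite I" "I \<noteq> {}" "\<And>i. i \<in> I \<Longrightarrow> u i \<noteq> 0" "inj_on (\<lambda>i. fls_subdegree (u i)) I"
  shows "sum u I \<noteq> 0"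
proof -
  let ?v = "\<lambda>i. fls_subdegree (u i)"
  have "Min (?v ` I) \<in> ?v ` I" using assms by (intro Min_in) auto
  then obtain i where i: "i \<in> I" "Min (?v ` I) = ?v i" by auto
  have less: "?v i < ?v j" if "j \<in> I - {i}" for j
  proof -
    have "?v i \<le> ?v j" using i that assms(1) by (metis Diff_iff Min_le finite_imageI image_eqI)
    moreover have "?v i \<noteq> ?v j" using assms(4) i that by (auto dest: inj_onD)
    ultimately show ?thesis by simp
  qed
  have "fls_ge (?v i + 1) (sum u (I - {i}))"
    using less by (intro fls_ge_sum fls_geI) fastforce
  then have "fls_nth (u i + sum u (I - {i})) (?v i) \<noteq> 0"
    using assms(3) i by (simp add: fls_ge_def)
  then have "u i + sum u (I - {i}) \<noteq> 0" by (metis fls_zero_nth)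
  then show ?thesis using i assms(1) by (simp add: sum.remove)
qed

subsection \<open>Roots of Laurent series\<close>

text \<open>If \<open>G\<close> is the compositional inverse of \<open>(1 + X)^n - 1\<close>, whose
  linear coefficient is the unit \<open>n\<close>, then \<open>1 + G\<close> is an
  \<open>n\<close>-th root of \<open>1 + X\<close>, and substituting \<open>u - 1\<close> for
  \<open>X\<close> gives a root of \<open>u\<close>. This works in any characteristic not dividing
  \<open>n\<close>.\<close>

lemma fps_nth_root_exists:
  fixes u :: "'k::field fps"
  assumes "of_nat n \<noteq> (0 :: 'k)" "u $ 0 = 1"
  shows "\<exists>v. v ^ n = u"
proof -
  define g :: "'k fps" where "g = (1 + fps_X) ^ n - 1"
  have g0: "g $ 0 = 0" by (simp add: g_def fps_power_zeroth)
  have "fps_deriv ((1 + fps_X :: 'k fps) ^ n) $ 0 = of_nat n"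
    by (simp add: fps_deriv_power fps_power_zeroth)
  then have g1: "g $ 1 \<noteq> 0" using assms(1) by (simp add: g_def)
  have i0: "fps_inv g $ 0 = 0" by (simp add: fps_inv_def)
  have "1 + fps_inv g = (1 + fps_X) oo fps_inv g"
    by (simp add: fps_compose_add_distrib i0)
  then have "(1 + fps_inv g) ^ n = (1 + fps_X) ^ n oo fps_inv g"
    by (simp only: fps_compose_power[OF i0])
  also have "(1 + fps_X) ^ n = g + 1" by (simp add: g_def)
  also have "(g + 1) oo fps_inv g = fps_X + 1"
    using fps_inv_right[OF g0 g1] by (simp add: fps_compose_add_distrib)
  finally have "(1 + fps_inv g) ^ n = fps_X + 1" .
  moreover have u0: "(u - 1) $ 0 = 0" using assms(2) by simp
  ultimately have "((1 + fps_inv g) oo (u - 1)) ^ n = (fps_X + 1) oo (u - 1)"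
    by (simp add: fps_compose_power)
  also have "\<dots> = u" using u0 by (simp add: fps_compose_add_distrib)
  finally show ?thesis by blast
qed

text \<open>The leading coefficient has a root in \<open>k\<close>, the power of \<open>s\<close>
  has one by divisibility of its exponent, and the remaining series has constant term 1.\<close>

lemma fls_nth_root_exists:
  fixes F :: "'k::alg_closed_field fls"
  assumes "of_nat n \<noteq> (0 :: 'k)" "int n dvd fls_subdegree F"
  shows "\<exists>Y. Y ^ n = F"
proof (cases "F = 0")
  case True
  have "n > 0" using assms(1) by (cases n) auto
  then show ?thesis using True by (intro exI[of _ 0]) simp
next
  case False
  define U where "U = fls_base_factor_to_fps F"
  have FU: "F = fps_to_fls U * fls_X_intpow (fls_subdegree F)"
    unfolding U_def using fls_conv_base_factor_to_fps_shift_subdegree[of F]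
    by (simp add: fls_shifted_times_simps)
  define c where "c = U $ 0"
  have c: "c \<noteq> 0" using False by (simp add: c_def U_def)
  have n: "n > 0" using assms(1) by (cases n) auto
  obtain r where r: "r ^ n = c" using nth_root_exists[OF n, of c] by blast
  have "(fps_const (inverse c) * U) $ 0 = 1" using c by (simp add: c_def)
  then obtain v where v: "v ^ n = fps_const (inverse c) * U"
    using fps_nth_root_exists[OF assms(1)] by blast
  obtain s where s: "fls_subdegree F = int n * s" using assms(2) by (rule dvdE)
  have "(fps_const r * v) ^ n = fps_const c * (fps_const (inverse c) * U)"
    by (simp add: power_mult_distrib v r fps_const_power)
  also have "\<dots> = U" using c by (simp flip: mult.assoc)
  finally have "(fps_const r * v) ^ n = U" .
  then have "(fps_to_fls (fps_const r * v) * fls_X powi s) ^ n = fps_to_fls U * fls_X powi (int n * s)"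
    by (metis fps_to_fls_power mult.commute power_int_mult power_int_of_nat power_mult_distrib)
  also have "\<dots> = F" using FU s by simp
  finally show ?thesis by blast
qed

subsection \<open>Residue fields\<close>

global_interpretation const_poly: poly_evaluation "const_fun :: 'k::field \<Rightarrow> _"
  defines poly_at = const_poly.ev
  by unfold_locales (simp_all add: const_fun_1 const_fun_add const_fun_mult)

global_interpretation bivariate: poly_evaluation "of_poly :: 'k::field poly \<Rightarrow> _"
  defines bipoly_at = bivariate.ev
  by unfold_locales simp_all

lemma of_poly_ev: "of_poly p = poly_at coord_x p"
  by (induction p) (simp_all add: of_poly_pCons)

lemma of_poly_taylor: "of_poly g = poly_at (coord_x - const_fun a) (pcompose g [:a, 1:])"
proof (induction g)
  case (pCons c g)
  have "poly_at (coord_x - const_fun a) [:a, 1:] = coord_x" by (simp add: const_fun_1)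
  then show ?case using pCons
    by (simp only: pcompose_pCons of_poly_pCons const_poly.ev_add const_poly.ev_mult) simp
qed simp

locale curve_point_x = curve_point K P
  for K :: "'k::alg_closed_field alg_fun set" and P +
  assumes coord_x_mem [simp]: "coord_x \<in> K"
begin

lemma of_poly_mem [simp]: "of_poly p \<in> K"
proof (induction p)
  case (pCons a p)
  then have "const_fun a + coord_x * of_poly p \<in> K" by (intro add_mem mult_mem) auto
  then show ?case by (simp only: of_poly_pCons)
qed simp

text \<open>Over an algebraically closed \<open>k\<close> the polynomial splits, so its value is a
  product of factors \<open>h - c\<close> of order 0 and a constant.\<close>

lemma ord_ev_eq_0:
  assumes "h \<in> K" "\<And>c. h \<noteq> const_fun c" "\<And>c. P (h - const_fun c) = 0" "q \<noteq> 0"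
  shows "poly_at h q \<noteq> 0 \<and> poly_at h q \<in> K \<and> P (poly_at h q) = 0"
proof -
  obtain A where A: "q = smult (lead_coeff q) (\<Prod>x\<in>#A. [:-x, 1:])"
    using alg_closed_imp_factorization[OF assms(4)] by blast
  have lin: "poly_at h [:- a, 1:] = h - const_fun a" for a
    by (simp add: const_fun_minus const_fun_1)
  let ?g = "\<lambda>A. poly_at h (\<Prod>x\<in>#A. [:-x, 1:])"
  have g: "?g A \<noteq> 0 \<and> ?g A \<in> K \<and> P (?g A) = 0"
  proof (induction A)
    case (add a A)
    have "h - const_fun a \<noteq> 0" "h - const_fun a \<in> K" using assms(1,2) by auto
    moreover have "?g (add_mset a A) = (h - const_fun a) * ?g A"
      by (simp only: image_mset_add_mset prod_mset.add_mset const_poly.ev_mult lin)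
    ultimately show ?case using add assms(3)[of a] by (auto simp: ord_mult)
  qed simp
  have "lead_coeff q \<noteq> 0" using assms(4) by simp
  then have "const_fun (lead_coeff q) \<noteq> 0" by (simp add: const_fun_eq_0_iff)
  moreover have "poly_at h q = const_fun (lead_coeff q) * ?g A"
    by (subst A) (rule const_poly.ev_smult)
  ultimately show ?thesis using g by (auto simp: ord_mult)
qed

text \<open>If all of \<open>k[x]\<close> had order 0, an algebraic relation over
  \<open>k[x]\<close> for a uniformizer \<open>t\<close> would have terms of distinct orders. The
  sign is left open: at a pole of \<open>x\<close> the order is negative.\<close>

lemma base_place: "\<exists>a. P (coord_x - const_fun a) \<noteq> 0"
proof (rule ccontr)
  assume "\<nexists>a. P (coord_x - const_fun a) \<noteq> 0"
  then have unit: "P (of_poly q) = 0" if "q \<noteq> 0" for q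
    using ord_ev_eq_0[of coord_x q] that coord_x_neq_const by (auto simp: of_poly_ev)
  obtain t where t: "t \<in> K" "t \<noteq> 0" "P t = 1" by (rule uniformizer)
  obtain p :: "'k poly poly" where p: "p \<noteq> 0" "poly (map_poly of_poly p) t = 0"
    by (rule alg_fun_algebraic)
  let ?u = "\<lambda>j. of_poly (coeff p j) * t ^ j" and ?I = "{j. j \<le> degree p \<and> coeff p j \<noteq> 0}"
  have ord: "P (?u j) = int j" if "j \<in> ?I" for j
    using that t by (simp add: ord_mult power_mem ord_power unit)
  have "sum ?u ?I \<noteq> 0 \<and> P (sum ?u ?I) = Min ((\<lambda>i. P (?u i)) ` ?I)"
  proof (rule ord_sum_distinct)
    show "?I \<noteq> {}" using p(1) leading_coeff_0_iff[of p] by blast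
    show "inj_on (\<lambda>i. P (?u i)) ?I"
    proof (rule inj_onI)
      fix i j assume "i \<in> ?I" "j \<in> ?I" "P (?u i) = P (?u j)"
      with ord[of i] ord[of j] show "i = j" by linarith
    qed
  qed (use t in auto)
  moreover have "poly (map_poly of_poly p) t = (\<Sum>j\<le>degree p. of_poly (coeff p j) * t ^ j)"
    using bivariate.ev_altdef[of p "degree p" t] by (simp add: bivariate.ev_def)
  moreover have "\<dots> = sum ?u ?I" by (rule sum.mono_neutral_right) auto
  ultimately show False using p(2) by simp
qed

text \<open>Otherwise every nonzero element of \<open>k[h]\<close> has order \<open>0\<close>, and an algebraic relation between
  \<open>h\<close> and \<open>z = x - a\<close>, written as a polynomial in \<open>z\<close> over \<open>k[h]\<close>, has terms of distinct orders.\<close>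

lemma residue_field:
  assumes h: "h \<in> K" "h \<noteq> 0" "P h = 0"
  shows "\<exists>c. h = const_fun c \<or> 0 < P (h - const_fun c)"
proof (rule ccontr)
  assume *: "\<nexists>c. h = const_fun c \<or> 0 < P (h - const_fun c)"
  have "ge 0 (h - const_fun c)" for c using h by (intro ge_diff) (auto simp: ge_def)
  then have "P (h - const_fun c) = 0" for c
    using * by (metis ge_def eq_iff_diff_eq_0 linorder_not_less order_antisym)
  with * h(1) have unit: "poly_at h q \<noteq> 0 \<and> poly_at h q \<in> K \<and> P (poly_at h q) = 0"
    if "q \<noteq> 0" for q
    using that by (intro ord_ev_eq_0) auto
  obtain a where a: "P (coord_x - const_fun a) \<noteq> 0" using base_place by blast
  define z where "z = coord_x - const_fun a"
  have z: "z \<in> K" "z \<noteq> 0" "P z \<noteq> 0" using a coord_x_neq_const[of a] by (auto simp: z_def)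
  obtain p :: "'k poly poly" where p: "p \<noteq> 0" "poly (map_poly of_poly p) h = 0"
    by (rule alg_fun_algebraic)
  define r where "r j = pcompose (coeff p j) [:a, 1:]" for j
  define N where "N = Max ((\<lambda>j. degree (r j)) ` {..degree p})"
  have N: "degree (r j) \<le> N" if "j \<le> degree p" for j
    unfolding N_def using that by (intro Max_ge) auto
  define q where "q i = (\<Sum>j\<le>degree p. monom (coeff (r j) i) j)" for i
  have shift: "of_poly g = poly_at z (pcompose g [:a, 1:])" for g
    unfolding z_def by (rule of_poly_taylor)
  have "0 = (\<Sum>j\<le>degree p. of_poly (coeff p j) * h ^ j)"
    unfolding p(2)[symmetric]
    using bivariate.ev_altdef[of p "degree p" h] by (simp add: bivariate.ev_def)
  also have "\<dots> = (\<Sum>j\<le>degree p. \<Sum>i\<le>N. const_fun (coeff (r j) i) * z ^ i * h ^ j)"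
    by (intro sum.cong refl)
      (simp add: shift const_poly.ev_altdef[OF N] sum_distrib_right flip: r_def)
  also have "\<dots> = (\<Sum>i\<le>N. \<Sum>j\<le>degree p. const_fun (coeff (r j) i) * z ^ i * h ^ j)"
    by (rule sum.swap)
  also have "\<dots> = (\<Sum>i\<le>N. z ^ i * poly_at h (q i))"
    by (simp add: q_def const_poly.ev_sum const_poly.ev_monom sum_distrib_left mult_ac)
  also have "\<dots> = (\<Sum>i\<in>{i. i \<le> N \<and> q i \<noteq> 0}. z ^ i * poly_at h (q i))"
    by (rule sum.mono_neutral_right) auto
  finally have eq0: "(\<Sum>i\<in>{i. i \<le> N \<and> q i \<noteq> 0}. z ^ i * poly_at h (q i)) = 0" ..
  have ord: "P (z ^ i * poly_at h (q i)) = int i * P z" if "q i \<noteq> 0" for i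
    using unit[OF that] z by (simp add: ord_mult power_mem ord_power)
  define J where "J = degree p"
  have "coeff p J \<noteq> 0" using p(1) by (simp add: J_def)
  then have "r J \<noteq> 0" unfolding r_def by (subst pcompose_eq_0_iff) auto
  \<comment> \<open>Some \<open>q i\<close> must be nonzero. For \<open>i = degree (r J)\<close> the
    coefficient of \<open>q i\<close> at \<open>J\<close> is the leading coefficient of
    \<open>r J\<close>.\<close>
  have cq: "coeff (q i) J = coeff (r J) i" for i by (simp add: q_def coeff_sum J_def)
  have "q (degree (r J)) \<noteq> 0"
    using cq[of "degree (r J)"] \<open>r J \<noteq> 0\<close> by (metis coeff_0 leading_coeff_0_iff)
  then have ne: "{i. i \<le> N \<and> q i \<noteq> 0} \<noteq> {}" using N[of J] by (auto simp: J_def)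
  have "inj_on (\<lambda>i. P (z ^ i * poly_at h (q i))) {i. i \<le> N \<and> q i \<noteq> 0}"
  proof (rule inj_onI)
    fix i j assume "i \<in> {i. i \<le> N \<and> q i \<noteq> 0}" "j \<in> {i. i \<le> N \<and> q i \<noteq> 0}"
      "P (z ^ i * poly_at h (q i)) = P (z ^ j * poly_at h (q j))"
    then have "int i * P z = int j * P z" using ord[of i] ord[of j] by simp
    then show "i = j" using z(3) by simp
  qed
  then show False using ord_sum_distinct[OF _ ne, of "\<lambda>i. z ^ i * poly_at h (q i)"] eq0 unit z
    by (auto simp: power_mem)
qed

lemma laurent_embedding_exists:
  obtains \<Phi> where "laurent_embedding K \<Phi>" "embedding_ord K \<Phi> = P"
proof -
  obtain t where t: "t \<in> K" "t \<noteq> 0" "P t = 1" by (rule uniformizer)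
  interpret local_coordinate K P t
    by unfold_locales (use t residue_field in auto)
  show ?thesis using that laurent_embedding embedding_ord_laurent by blast
qed

end

subsection \<open>The function field\<close>

lemma is_subfield_function_field: "is_subfield (function_field y)"
  unfolding function_field_def is_subfield_def by blast

lemma const_mem_function_field: "const_fun c \<in> function_field y"
  and coord_x_mem_function_field: "coord_x \<in> function_field y"
  and generator_mem_function_field: "y \<in> function_field y"
  by (auto simp: function_field_def)

lemma function_field_least:
  "is_subfield F \<Longrightarrow> range const_fun \<subseteq> F \<Longrightarrow> coord_x \<in> F \<Longrightarrow> y \<in> F \<Longrightarrow> function_field y \<subseteq> F"
  by (auto simp: function_field_def)

lemma function_field_induct [consumes 1, case_names const coord generator add mult inverse]:
  assumes "h \<in> function_field y"
    and const: "\<And>c. Q (const_fun c)" and "Q coord_x" "Q y"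
    and add: "\<And>a b. a \<in> function_field y \<Longrightarrow> b \<in> function_field y \<Longrightarrow> Q a \<Longrightarrow> Q b \<Longrightarrow> Q (a + b)"
    and mult: "\<And>a b. a \<in> function_field y \<Longrightarrow> b \<in> function_field y \<Longrightarrow> Q a \<Longrightarrow> Q b \<Longrightarrow> Q (a * b)"
    and inv: "\<And>a. a \<in> function_field y \<Longrightarrow> a \<noteq> 0 \<Longrightarrow> Q a \<Longrightarrow> Q (inverse a)"
  shows "Q h"
proof -
  interpret function_subfield "function_field y"
    by unfold_locales (simp_all add: is_subfield_function_field const_mem_function_field)
  let ?F = "{h \<in> function_field y. Q h}"
  have 0: "Q 0" and 1: "Q 1" using const[of 0] const[of 1] by (simp_all add: const_fun_1)
  have "Q (- a)" if "a \<in> function_field y" "Q a" for a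
  proof -
    have "Q (const_fun (- 1) * a)" using that const by (intro mult) auto
    then show ?thesis by (simp add: const_fun_minus const_fun_1)
  qed
  moreover have "Q (inverse a)" if "a \<in> function_field y" "Q a" for a
    using inv[OF that(1) _ that(2)] 0 by (cases "a = 0") auto
  ultimately have "is_subfield ?F"
    unfolding is_subfield_def using 0 1 add mult by auto
  then have "function_field y \<subseteq> ?F"
    by (rule function_field_least)
      (use assms in \<open>auto simp: coord_x_mem_function_field generator_mem_function_field\<close>)
  then show ?thesis using assms(1) by auto
qed

lemma bipoly_at_compose: "bipoly_at (bipoly_at y p) q = bipoly_at y (pcompose q p)"
  by (induction q) (simp_all add: pcompose_pCons)

text \<open>Once the powers of \<open>T\<close> are removed from a relation for \<open>z\<close>
  over \<open>k[x]\<close>, its constant term \<open>b\<close> is nonzero and the relation reads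
  \<open>b = - z q'(z)\<close>. Thus denominators can always be taken in
  \<open>k[x]\<close>.\<close>

lemma alg_fun_inverse:
  fixes z :: "'k::field alg_fun"
  assumes "z \<noteq> 0"
  obtains q :: "'k poly poly" and b where "b \<noteq> 0" "inverse z = bipoly_at z q / of_poly b"
proof -
  obtain p :: "'k poly poly" where p: "p \<noteq> 0" "bipoly_at z p = 0"
    using alg_fun_algebraic[of z] by (metis bivariate.ev_def)
  obtain q where q: "p = [:- 0, 1:] ^ order 0 p * q" "\<not> [:- 0, 1:] dvd q"
    using order_decomp[OF p(1)] by blast
  have "bipoly_at z p = bipoly_at z [:- 0, 1:] ^ order 0 p * bipoly_at z q"
    by (subst q(1)) (simp only: bivariate.ev_mult bivariate.ev_power)
  then have z: "bipoly_at z q = 0" using p(2) assms by simp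
  obtain b q' where q': "q = pCons b q'" by (cases q)
  have "b \<noteq> 0"
  proof
    assume "b = 0"
    then have "q = [:- 0, 1:] * q'" by (simp add: q')
    then show False using q(2) by (metis dvd_triv_left)
  qed
  moreover have "inverse z = bipoly_at z (- q') / of_poly b"
  proof -
    have "of_poly b = z * bipoly_at z (- q')" using z by (simp add: q' add_eq_0_iff2)
    then show ?thesis using \<open>b \<noteq> 0\<close> assms
      by (metis (no_types) divide_inverse mult.commute mult.left_commute nonzero_mult_div_cancel_left
          of_poly_eq_0_iff right_inverse mult_1_right)
  qed
  ultimately show ?thesis by (rule that)
qed

lemma function_field_fraction:
  assumes "h \<in> function_field y"
  shows "\<exists>p b. b \<noteq> 0 \<and> h = bipoly_at y p / of_poly b"
  using assms
proof (induction rule: function_field_induct)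
  case (const c)
  show ?case by (rule exI[of _ "[:[:c:]:]"], rule exI[of _ 1]) simp
next
  case coord
  show ?case by (rule exI[of _ "[:[:0, 1:]:]"], rule exI[of _ 1]) (simp add: coord_x_def)
next
  case generator
  show ?case by (rule exI[of _ "[:0, 1:]"], rule exI[of _ 1]) simp
next
  case (add h h')
  then obtain p b p' b' where "b \<noteq> 0" "h = bipoly_at y p / of_poly b"
    "b' \<noteq> 0" "h' = bipoly_at y p' / of_poly b'" by blast
  then show ?case
    by (intro exI[of _ "smult b' p + smult b p'"] exI[of _ "b * b'"]) (simp add: field_simps)
next
  case (mult h h')
  then obtain p b p' b' where "b \<noteq> 0" "h = bipoly_at y p / of_poly b"
    "b' \<noteq> 0" "h' = bipoly_at y p' / of_poly b'" by blast
  then show ?case by (intro exI[of _ "p * p'"] exI[of _ "b * b'"]) simp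
next
  case (inverse h)
  then obtain p b where h: "b \<noteq> 0" "h = bipoly_at y p / of_poly b" by blast
  then have "bipoly_at y p \<noteq> 0" using inverse.hyps by auto
  then obtain q c where "c \<noteq> 0" "inverse (bipoly_at y p) = bipoly_at (bipoly_at y p) q / of_poly c"
    by (rule alg_fun_inverse)
  then show ?case using h
    by (intro exI[of _ "smult b (pcompose q p)"] exI[of _ c])
      (simp add: bipoly_at_compose divide_inverse mult_ac)
qed

subsection \<open>Roots of unity\<close>

lemma degree_monom_diff_const:
  assumes "0 < n" shows "degree (monom (1 :: 'a::comm_ring_1) n - [:c:]) = n"
proof -
  have "degree (monom 1 n + - [:c:]) = degree (monom (1 :: 'a) n)"
    using assms by (intro degree_add_eq_left) (simp add: degree_monom_eq)
  then show ?thesis unfolding diff_conv_add_uminus by (simp add: degree_monom_eq)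
qed

text \<open>The polynomial \<open>T^n - 1\<close> splits, and a double root would be a zero of the
  derivative \<open>n T^(n-1)\<close>, hence 0, which is not a root.\<close>

lemma card_roots_of_unity:
  assumes "of_nat n \<noteq> (0 :: 'k::alg_closed_field)"
  shows "card {\<zeta>::'k. \<zeta> ^ n = 1} = n" "finite {\<zeta>::'k. \<zeta> ^ n = 1}"
proof -
  define p where "p = monom (1::'k) n - 1"
  have n: "n > 0" using assms by (cases n) auto
  have "degree p = n"
    using degree_monom_diff_const[OF n, of 1] by (simp add: p_def one_pCons)
  have "p \<noteq> 0" using \<open>degree p = n\<close> n by auto
  obtain A where A: "size A = degree p" "p = smult (lead_coeff p) (\<Prod>x\<in>#A. [:-x, 1:])"
    using alg_closed_imp_factorization[OF \<open>p \<noteq> 0\<close>] by blast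
  have root: "poly p x = 0 \<longleftrightarrow> x ^ n = 1" for x by (simp add: p_def poly_monom)
  have "poly p x = 0 \<longleftrightarrow> x \<in># A" for x
    using \<open>p \<noteq> 0\<close> by (subst A(2)) (auto simp: poly_prod_mset image_iff)
  then have U: "{\<zeta>. \<zeta> ^ n = 1} = set_mset A" using root by auto
  have "count A x = 1" if "x \<in># A" for x
  proof (rule ccontr)
    assume "count A x \<noteq> 1"
    with that have "2 \<le> count A x" using count_greater_zero_iff[of A x] by linarith
    then have "replicate_mset 2 x \<subseteq># A" by (simp add: count_le_replicate_mset_subset_eq)
    then obtain B where "A = {#x, x#} + B"
      by (metis mset_subset_eq_exists_conv numeral_2_eq_2 replicate_mset_0 replicate_mset_Suc)
    then have "\<exists>r. p = [:-x, 1:] * ([:-x, 1:] * r)"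
      using A(2) by (intro exI[of _ "smult (lead_coeff p) (\<Prod>x\<in>#B. [:-x, 1:])"])
        (simp add: mult_ac)
    then obtain r where "p = [:-x, 1:] * ([:-x, 1:] * r)" by blast
    then have "pderiv p = [:-x, 1:] * pderiv ([:-x, 1:] * r) + ([:-x, 1:] * r) * pderiv [:-x, 1:]"
      by (simp only: pderiv_mult)
    then have "poly (pderiv p) x = 0" by simp
    moreover have "poly (pderiv p) x = of_nat n * x ^ (n - 1)"
      by (simp add: p_def pderiv_diff pderiv_monom poly_monom)
    moreover have "x ^ n = 1" using that U by auto
    ultimately show False using assms n by (auto simp: power_0_left)
  qed
  then have "size A = card (set_mset A)" by (simp add: size_multiset_overloaded_eq)
  then show "card {\<zeta>::'k. \<zeta> ^ n = 1} = n" "finite {\<zeta>::'k. \<zeta> ^ n = 1}"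
    using A(1) U \<open>degree p = n\<close> by auto
qed

text \<open>As \<open>T^m - 1\<close> has at most \<open>m < n\<close> roots, some
  \<open>\<eta>\<close> has \<open>\<eta>^m \<noteq> 1\<close>; multiplication by
  \<open>\<eta>\<close> permutes the roots of unity and multiplies the sum by
  \<open>\<eta>^m\<close>.\<close>

lemma sum_roots_of_unity_power:
  assumes n: "of_nat n \<noteq> (0 :: 'k::alg_closed_field)" and m: "0 < m" "m < n"
  shows "(\<Sum>\<zeta> | \<zeta> ^ n = 1. \<zeta> ^ m) = (0 :: 'k)"
proof -
  let ?U = "{\<zeta>::'k. \<zeta> ^ n = 1}"
  have "\<exists>\<eta>\<in>?U. \<eta> ^ m \<noteq> 1"
  proof (rule ccontr)
    assume "\<not> ?thesis"
    then have sub: "?U \<subseteq> {x. poly (monom 1 m - 1) x = 0}" by (auto simp: poly_monom)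
    have d: "degree (monom (1::'k) m - 1) = m"
      using degree_monom_diff_const[OF m(1), of 1] by (simp add: one_pCons)
    then have "monom (1::'k) m - 1 \<noteq> 0" using m by auto
    then have "card {x. poly (monom (1::'k) m - 1) x = 0} \<le> m"
      using card_poly_roots_bound[of "monom (1::'k) m - 1"] d by simp
    moreover have "card ?U \<le> card {x. poly (monom (1::'k) m - 1) x = 0}"
      by (intro card_mono poly_roots_finite sub) fact
    ultimately show False using card_roots_of_unity[OF n] m by simp
  qed
  then obtain \<eta> :: 'k where \<eta>: "\<eta> ^ n = 1" "\<eta> ^ m \<noteq> 1" by blast
  have "\<eta> \<noteq> 0" using \<eta> m by (auto simp: power_0_left)
  have "(\<Sum>\<zeta>\<in>?U. \<zeta> ^ m) = (\<Sum>\<zeta>\<in>?U. (\<eta> * \<zeta>) ^ m)"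
    by (rule sum.reindex_bij_witness[of _ "\<lambda>\<zeta>. \<eta> * \<zeta>" "\<lambda>\<zeta>. inverse \<eta> * \<zeta>"])
      (use \<eta> \<open>\<eta> \<noteq> 0\<close> in \<open>auto simp: power_mult_distrib power_inverse field_simps\<close>)
  also have "\<dots> = \<eta> ^ m * (\<Sum>\<zeta>\<in>?U. \<zeta> ^ m)" by (simp add: power_mult_distrib sum_distrib_left)
  finally have "(1 - \<eta> ^ m) * (\<Sum>\<zeta>\<in>?U. \<zeta> ^ m) = 0" by (simp add: algebra_simps)
  then show ?thesis using \<eta>(2) by simp
qed

subsection \<open>Superelliptic curves\<close>

global_interpretation laurent_bipoly: poly_evaluation "fls_poly Z" for Z :: "'k::comm_ring_1 fls"
  by unfold_locales simp_all

abbreviation fls_bipoly :: "'k::comm_ring_1 fls \<Rightarrow> 'k fls \<Rightarrow> 'k poly poly \<Rightarrow> 'k fls"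
  where "fls_bipoly Z \<equiv> poly_evaluation.ev (fls_poly Z)"

locale superelliptic =
  fixes f :: "'k::alg_closed_field poly" and n :: nat and y :: "'k alg_fun"
  assumes n_ge: "2 \<le> n" and n_less: "n < degree f"
    and char: "\<not> CHAR('k) dvd n" and sqfree: "rsquarefree f" and curve: "y ^ n = of_poly f"
begin

abbreviation "K \<equiv> function_field y"

sublocale function_subfield K
  by unfold_locales (simp_all add: is_subfield_function_field const_mem_function_field)

lemma x_mem [simp]: "coord_x \<in> K" and y_mem [simp]: "y \<in> K"
  by (simp_all add: coord_x_mem_function_field generator_mem_function_field)

lemma n_nz [simp]: "of_nat n \<noteq> (0 :: 'k)"
  using char by (simp add: of_nat_eq_0_iff_char_dvd)

lemma n_nz_alg_fun [simp]: "of_nat n \<noteq> (0 :: 'k alg_fun)"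
  by (metis const_fun_of_nat const_fun_eq_0_iff n_nz)

lemma n_nz_fls [simp]: "of_nat n \<noteq> (0 :: 'k fls)"
  by (simp add: fls_of_nat)

lemma f_nz [simp]: "f \<noteq> 0" using n_less by auto

lemma y_nz [simp]: "y \<noteq> 0"
proof
  assume "y = 0"
  then have "of_poly f = 0" using curve n_ge by (simp add: power_0_left split: if_splits)
  then show False by simp
qed

lemma order_f: "poly f a = 0 \<Longrightarrow> order a f = 1"
  using rsquarefree_root_order[OF sqfree] by simp

lemma pderiv_f: assumes "poly f a = 0" shows "poly (pderiv f) a \<noteq> 0"
proof -
  obtain q where q: "f = [:- a, 1:] ^ order a f * q" "\<not> [:- a, 1:] dvd q"
    using order_decomp[OF f_nz] by blast
  then have f: "f = [:- a, 1:] * q" using order_f[OF assms] by simp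
  have "pderiv f = [:- a, 1:] * pderiv q + q * pderiv [:- a, 1:]"
    by (subst f) (rule pderiv_mult)
  then have "poly (pderiv f) a = poly q a" by (simp add: pderiv_pCons)
  then show ?thesis using q(2) by (simp add: poly_eq_0_iff_dvd)
qed

text \<open>The term with \<open>W^j\<close> has order congruent to \<open>j\<close> modulo
  \<open>n\<close>, and \<open>j < n\<close>, so no two terms have the same order.\<close>

lemma fls_bipoly_nonzero:
  fixes Z W :: "'k fls"
  assumes Z: "fls_subdegree (Z - fls_const a) = int n" and W: "fls_subdegree W = 1"
    and p: "p \<noteq> 0" "degree p < n"
  shows "fls_bipoly Z W p \<noteq> 0"
proof -
  have Z': "Z \<noteq> fls_const a" "0 < fls_subdegree (Z - fls_const a)" using Z n_ge by auto
  have W': "W \<noteq> 0" using W by auto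
  let ?u = "\<lambda>j. fls_poly Z (coeff p j) * W ^ j" and ?I = "{j. j \<le> degree p \<and> coeff p j \<noteq> 0}"
  have ord: "?u j \<noteq> 0 \<and> fls_subdegree (?u j) = int (order a (coeff p j) * n + j)" if "j \<in> ?I" for j
    using that fls_subdegree_poly_order[OF Z', of "coeff p j"] W W' Z by (simp add: fls_subdegree_pow)
  have "sum ?u ?I \<noteq> 0"
  proof (rule fls_sum_distinct_nonzero)
    show "?I \<noteq> {}" using p(1) leading_coeff_0_iff[of p] by blast
    show "inj_on (\<lambda>j. fls_subdegree (?u j)) ?I"
    proof (rule inj_onI)
      fix i j assume ij: "i \<in> ?I" "j \<in> ?I" "fls_subdegree (?u i) = fls_subdegree (?u j)"
      then have "order a (coeff p i) * n + i = order a (coeff p j) * n + j"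
        using ord[of i] ord[of j] by (simp only: of_nat_eq_iff)
      then have "(order a (coeff p i) * n + i) mod n = (order a (coeff p j) * n + j) mod n" by simp
      then show "i = j" using ij p(2) by simp
    qed
  qed (use ord in auto)
  moreover have "fls_bipoly Z W p = sum ?u ?I"
    unfolding laurent_bipoly.ev_altdef[OF order_refl] by (rule sum.mono_neutral_right) auto
  ultimately show ?thesis by simp
qed

lemma branch_exists: "\<exists>a. poly f a = 0"
  using alg_closed_imp_poly_has_root[of f] n_less by auto

text \<open>A point above \<open>a\<close> is parametrised by \<open>x = a + s\<^sup>e\<close>, where \<open>e = n\<close> at a branch point and
  \<open>e = 1\<close> elsewhere.\<close>

lemma finite_parametrization:
  assumes "e = (if poly f a = 0 then n else 1)"
  obtains Y where "Y ^ n = fls_poly (fls_const a + fls_X ^ e) f" "Y \<noteq> 0"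
    "fls_subdegree Y = (if poly f a = 0 then 1 else 0)"
proof -
  let ?Z = "fls_const a + fls_X ^ e :: 'k fls"
  have Z: "?Z \<noteq> fls_const a" "0 < fls_subdegree (?Z - fls_const a)"
    using assms n_ge by auto
  have F: "fls_poly ?Z f \<noteq> 0" "fls_subdegree (fls_poly ?Z f) = int (order a f) * int e"
    using fls_subdegree_poly_order[OF Z f_nz] by auto
  have sub: "fls_subdegree (fls_poly ?Z f) = int n * (if poly f a = 0 then 1 else 0)"
    using F(2) order_f[of a] assms by (auto simp: order_root)
  then have "int n dvd fls_subdegree (fls_poly ?Z f)" by simp
  then obtain Y where Y: "Y ^ n = fls_poly ?Z f" using fls_nth_root_exists[OF n_nz] by blast
  have "Y \<noteq> 0" using Y F(1) n_ge by (auto simp: power_0_left)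
  moreover have "fls_subdegree Y = (if poly f a = 0 then 1 else 0)"
    using sub fls_subdegree_pow[of Y n] Y n_ge by (auto split: if_splits)
  ultimately show ?thesis using that Y by blast
qed

text \<open>At infinity \<open>x = s^(-e)\<close>. The divisibility makes the order of
  \<open>f(x)\<close> a multiple of \<open>n\<close>; the smallest such \<open>e\<close> is
  \<open>n / gcd n (degree f)\<close>.\<close>

lemma infinite_parametrization:
  assumes "n dvd e * degree f" "e > 0"
  obtains Y where "Y ^ n = fls_poly (fls_X_inv ^ e) f" "Y \<noteq> 0"
    "int n * fls_subdegree Y = - int (e * degree f)"
proof -
  let ?Z = "fls_X_inv ^ e :: 'k fls"
  have Z: "fls_subdegree ?Z = - int e" by simp
  then have F: "fls_poly ?Z f \<noteq> 0" "fls_subdegree (fls_poly ?Z f) = - int (e * degree f)"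
    using fls_subdegree_poly_degree[of ?Z f] assms by auto
  then have "int n dvd fls_subdegree (fls_poly ?Z f)" using assms by (simp del: of_nat_mult)
  then obtain Y where Y: "Y ^ n = fls_poly ?Z f" using fls_nth_root_exists[OF n_nz] by blast
  have "Y \<noteq> 0" using Y F(1) n_ge by (auto simp: power_0_left)
  moreover have "int n * fls_subdegree Y = - int (e * degree f)"
    using F(2) fls_subdegree_pow[of Y n] Y by simp
  ultimately show ?thesis using that Y by blast
qed

lemma bipoly_curve: "bipoly_at y (monom 1 n - [:f:]) = 0"
  by (simp add: bivariate.ev_monom curve)

lemma fls_bipoly_curve: "Y ^ n = fls_poly Z f \<Longrightarrow> fls_bipoly Z Y (monom 1 n - [:f:]) = 0"
  by (simp add: laurent_bipoly.ev_monom)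

lemma degree_curve: "degree (monom 1 n - [:f:]) = n"
  using n_ge by (intro degree_monom_diff_const) simp

lemma curve_nz: "monom 1 n - [:f:] \<noteq> 0"
  using degree_curve n_ge by auto

text \<open>This is the irreducibility of \<open>T\<^sup>n - f\<close> over \<open>k(x)\<close>. In the Laurent series at a branch
  point this polynomial has the \<open>n\<close> roots \<open>\<zeta> Y\<close>, so a proper factor would vanish at
  one of them, although its terms have distinct orders there.\<close>

lemma bipoly_nonzero:
  assumes "p \<noteq> 0" "degree p < n" shows "bipoly_at y p \<noteq> 0"
proof
  assume "bipoly_at y p = 0"
  with assms(1) have "\<exists>m. (m \<noteq> 0 \<and> bipoly_at y m = 0) \<and>
      (\<forall>p. p \<noteq> 0 \<and> bipoly_at y p = 0 \<longrightarrow> degree m \<le> degree p)"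
    by (intro ex_has_least_nat) auto
  then obtain m where m: "m \<noteq> 0" "bipoly_at y m = 0"
    and min: "\<And>p. p \<noteq> 0 \<Longrightarrow> bipoly_at y p = 0 \<Longrightarrow> degree m \<le> degree p" by blast
  have deg: "degree m < n" using min[OF assms(1) \<open>bipoly_at y p = 0\<close>] assms(2) by simp
  \<comment> \<open>Coefficients lie in \<open>k[x]\<close>, so only pseudo-division is available;
    the remainder vanishes by minimality of \<open>degree m\<close>.\<close>
  let ?G = "monom 1 n - [:f:]" and ?r = "pseudo_mod (monom 1 n - [:f:]) m"
  obtain c q where cq: "c \<noteq> 0" "smult c ?G = m * q + ?r" using pseudo_mod(1)[OF m(1)] by blast
  have "bipoly_at y (smult c ?G) = bipoly_at y (m * q + ?r)" using cq(2) by (rule arg_cong)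
  then have "bipoly_at y ?r = 0"
    by (simp only: bivariate.ev_smult bipoly_curve bivariate.ev_add bivariate.ev_mult m(2)) simp
  then have "?r = 0" using pseudo_mod(2)[OF m(1), of ?G] min[of ?r] by linarith
  then have fac: "smult c ?G = m * q" using cq(2) by simp
  have "q \<noteq> 0" using fac cq(1) curve_nz by auto
  have degs: "degree m + degree q = n"
    using arg_cong[OF fac, of degree] cq(1) m(1) \<open>q \<noteq> 0\<close> by (simp add: degree_mult_eq degree_curve)
  obtain a where a: "poly f a = 0" using branch_exists by blast
  define Z where "Z = fls_const a + (fls_X :: 'k fls) ^ n"
  have Z: "fls_subdegree (Z - fls_const a) = int n" by (simp add: Z_def)
  obtain Y where Y: "Y ^ n = fls_poly Z f" "Y \<noteq> 0" "fls_subdegree Y = 1"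
    using finite_parametrization[of n a] a by (auto simp: Z_def)
  let ?U = "{\<zeta>::'k. \<zeta> ^ n = 1}"
  have root: "fls_bipoly Z (fls_const \<zeta> * Y) q = 0" if "\<zeta> \<in> ?U" for \<zeta>
  proof -
    have "\<zeta> \<noteq> 0" using that n_ge by (auto simp: power_0_left)
    then have sub: "fls_subdegree (fls_const \<zeta> * Y) = 1" using Y by (subst fls_subdegree_mult) auto
    have "(fls_const \<zeta> * Y) ^ n = fls_poly Z f"
      using that Y by (simp add: power_mult_distrib flip: fls_const_power)
    then have "fls_bipoly Z (fls_const \<zeta> * Y) (smult c ?G) = 0"
      by (simp only: laurent_bipoly.ev_smult fls_bipoly_curve) simp
    then have "fls_bipoly Z (fls_const \<zeta> * Y) m * fls_bipoly Z (fls_const \<zeta> * Y) q = 0"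
      by (simp only: fac laurent_bipoly.ev_mult)
    then show ?thesis using fls_bipoly_nonzero[OF Z sub m(1) deg] by simp
  qed
  have Zc: "Z \<notin> range fls_const"
  proof
    assume "Z \<in> range fls_const"
    then obtain c where "Z - fls_const a = fls_const (c - a)" by (auto simp: fls_minus_const)
    then show False using Z n_ge by simp
  qed
  have inj0: "fls_poly Z b = 0 \<longleftrightarrow> b = 0" for b using fls_poly_nonzero[OF Zc, of b] by auto
  let ?q = "map_poly (fls_poly Z) q"
  have "degree ?q = degree q" by (rule degree_map_poly) (simp add: inj0)
  have "?q \<noteq> 0" using \<open>q \<noteq> 0\<close> by (simp add: map_poly_eq_0_iff inj0)
  have "(\<lambda>\<zeta>. fls_const \<zeta> * Y) ` ?U \<subseteq> {W. poly ?q W = 0}"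
    using root by (auto simp: laurent_bipoly.ev_def)
  moreover have "inj_on (\<lambda>\<zeta>. fls_const \<zeta> * Y) ?U"
    using Y(2) by (intro inj_onI) (simp add: fls_eq_iff, metis)
  ultimately have "card ?U \<le> card {W. poly ?q W = 0}"
    using \<open>?q \<noteq> 0\<close> by (metis card_image card_mono poly_roots_finite)
  also have "\<dots> \<le> degree q" using card_poly_roots_bound[OF \<open>?q \<noteq> 0\<close>] \<open>degree ?q = degree q\<close> by simp
  finally have "degree m = 0" using degs card_roots_of_unity(1)[OF n_nz] by simp
  then obtain b where "m = [:b:]" by (rule degree_eq_zeroE)
  then show False using m by simp
qed

lemma bipoly_reduce:
  obtains c q r where "c \<noteq> 0" "smult c p = (monom 1 n - [:f:]) * q + r" "r = 0 \<or> degree r < n"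
  using pseudo_mod[OF curve_nz, of p] degree_curve by metis

text \<open>By irreducibility every relation of \<open>y\<close> is, up to a factor in
  \<open>k[x]\<close>, a multiple of \<open>T^n - f\<close>, which \<open>Y\<close> satisfies. This
  makes the substitution in \<open>embedding_exists\<close> well defined.\<close>

lemma fls_bipoly_eq_0:
  assumes Z: "Z \<notin> range fls_const" and Y: "Y ^ n = fls_poly Z f" and p: "bipoly_at y p = 0"
  shows "fls_bipoly Z Y p = 0"
proof -
  obtain c q r where c: "c \<noteq> 0" and eq: "smult c p = (monom 1 n - [:f:]) * q + r"
    and r: "r = 0 \<or> degree r < n" by (rule bipoly_reduce)
  have "bipoly_at y (smult c p) = bipoly_at y r"
    unfolding eq bivariate.ev_add bivariate.ev_mult bipoly_curve by simp
  then have "r = 0" using p r bipoly_nonzero[of r] by auto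
  then have "fls_bipoly Z Y (smult c p) = 0"
    unfolding eq laurent_bipoly.ev_add laurent_bipoly.ev_mult fls_bipoly_curve[OF Y] by simp
  then show ?thesis using fls_poly_nonzero[OF Z c] by simp
qed

lemma reduced_fraction:
  assumes "h \<in> K"
  shows "\<exists>p b. b \<noteq> 0 \<and> degree p < n \<and> h = bipoly_at y p / of_poly b"
proof -
  obtain p b where h: "b \<noteq> 0" "h = bipoly_at y p / of_poly b"
    using function_field_fraction[OF assms] by blast
  obtain c q r where c: "c \<noteq> 0" and eq: "smult c p = (monom 1 n - [:f:]) * q + r"
    and r: "r = 0 \<or> degree r < n" by (rule bipoly_reduce)
  have "bipoly_at y (smult c p) = bipoly_at y r"
    unfolding eq bivariate.ev_add bivariate.ev_mult bipoly_curve by simp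
  then have "bipoly_at y r = of_poly c * bipoly_at y p" by simp
  then have "h = bipoly_at y r / of_poly (c * b)" using h c by simp
  then show ?thesis using h c r n_ge by (intro exI[of _ r] exI[of _ "c * b"]) auto
qed

text \<open>Every solution of the curve equation with nonconstant \<open>Z\<close> gives an
  embedding. The formula on fractions is part of the conclusion because the Fourier argument
  compares it for all \<open>\<zeta> Y\<close>.\<close>

lemma embedding_exists:
  assumes Z: "Z \<notin> range fls_const" and Y: "Y ^ n = fls_poly Z f"
  obtains \<Phi> where "laurent_embedding K \<Phi>"
    "\<And>p b. b \<noteq> 0 \<Longrightarrow> \<Phi> (bipoly_at y p / of_poly b) = fls_bipoly Z Y p / fls_poly Z b"
    "\<Phi> coord_x = Z" "\<Phi> y = Y"
proof -
  define rel where "rel h F \<longleftrightarrow>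
    (\<exists>p b. b \<noteq> 0 \<and> h = bipoly_at y p / of_poly b \<and> F = fls_bipoly Z Y p / fls_poly Z b)" for h F
  define \<Phi> where "\<Phi> h = (SOME F. rel h F)" for h
  have unique: "F = F'" if "rel h F" "rel h F'" for h F F'
  proof -
    obtain p b p' b' where 1: "b \<noteq> 0" "h = bipoly_at y p / of_poly b" "F = fls_bipoly Z Y p / fls_poly Z b"
      and 2: "b' \<noteq> 0" "h = bipoly_at y p' / of_poly b'" "F' = fls_bipoly Z Y p' / fls_poly Z b'"
      using \<open>rel h F\<close> \<open>rel h F'\<close> unfolding rel_def by blast
    have "bipoly_at y (smult b' p - smult b p') = 0" using 1 2 by (simp add: field_simps)
    then have "fls_bipoly Z Y (smult b' p - smult b p') = 0" by (rule fls_bipoly_eq_0[OF Z Y])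
    then have "fls_poly Z b' * fls_bipoly Z Y p = fls_poly Z b * fls_bipoly Z Y p'" by simp
    then show ?thesis using 1(3) 2(3) fls_poly_nonzero[OF Z 1(1)] fls_poly_nonzero[OF Z 2(1)]
      by (simp add: frac_eq_eq mult.commute)
  qed
  have frac: "\<Phi> (bipoly_at y p / of_poly b) = fls_bipoly Z Y p / fls_poly Z b" if "b \<noteq> 0" for p b
  proof -
    have "rel (bipoly_at y p / of_poly b) (fls_bipoly Z Y p / fls_poly Z b)"
      using that unfolding rel_def by blast
    then show ?thesis unfolding \<Phi>_def by (intro unique[OF someI])
  qed
  have const: "\<Phi> (const_fun c) = fls_const c" for c
    using frac[of 1 "[:[:c:]:]"] by simp
  have hom: "\<Phi> (a + b) = \<Phi> a + \<Phi> b \<and> \<Phi> (a * b) = \<Phi> a * \<Phi> b" if ab: "a \<in> K" "b \<in> K" for a b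
  proof -
    obtain p c where 1: "c \<noteq> 0" "a = bipoly_at y p / of_poly c"
      using function_field_fraction[OF ab(1)] by blast
    obtain q d where 2: "d \<noteq> 0" "b = bipoly_at y q / of_poly d"
      using function_field_fraction[OF ab(2)] by blast
    have cd: "c * d \<noteq> 0" using 1 2 by simp
    note nz = fls_poly_nonzero[OF Z 1(1)] fls_poly_nonzero[OF Z 2(1)]
    have "a + b = bipoly_at y (smult d p + smult c q) / of_poly (c * d)"
      using 1 2 by (simp add: field_simps)
    then have "\<Phi> (a + b) = fls_bipoly Z Y (smult d p + smult c q) / fls_poly Z (c * d)"
      by (simp only: frac[OF cd])
    also have "\<dots> = \<Phi> a + \<Phi> b"
      unfolding 1(2) 2(2) frac[OF 1(1)] frac[OF 2(1)] using nz by (simp add: field_simps)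
    finally have add: "\<Phi> (a + b) = \<Phi> a + \<Phi> b" .
    have "a * b = bipoly_at y (p * q) / of_poly (c * d)" using 1 2 by simp
    then have "\<Phi> (a * b) = fls_bipoly Z Y (p * q) / fls_poly Z (c * d)"
      by (simp only: frac[OF cd])
    also have "\<dots> = \<Phi> a * \<Phi> b"
      unfolding 1(2) 2(2) frac[OF 1(1)] frac[OF 2(1)] by simp
    finally show ?thesis using add by blast
  qed
  have "laurent_embedding K \<Phi>" unfolding laurent_embedding_def using hom const by blast
  moreover have "\<Phi> coord_x = Z" using frac[of 1 "[:[:0, 1:]:]"] by (simp add: coord_x_def)
  moreover have "\<Phi> y = Y" using frac[of 1 "[:0, 1:]"] by simp
  ultimately show ?thesis using that frac by blast
qed

end

section \<open>Points from embeddings into Laurent series\<close>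

locale laurent_point = function_subfield +
  fixes \<Phi>
  assumes embedding: "laurent_embedding K \<Phi>"
begin

lemma emb_add [simp]: "a \<in> K \<Longrightarrow> b \<in> K \<Longrightarrow> \<Phi> (a + b) = \<Phi> a + \<Phi> b"
  and emb_mult [simp]: "a \<in> K \<Longrightarrow> b \<in> K \<Longrightarrow> \<Phi> (a * b) = \<Phi> a * \<Phi> b"
  and emb_const [simp]: "\<Phi> (const_fun c) = fls_const c"
  using embedding by (auto simp: laurent_embedding_def)

lemma emb_0 [simp]: "\<Phi> 0 = 0" and emb_1 [simp]: "\<Phi> 1 = 1"
  using emb_const[of 0] emb_const[of 1] by (simp_all add: const_fun_1 del: emb_const)

lemma emb_minus [simp]: "a \<in> K \<Longrightarrow> \<Phi> (- a) = - \<Phi> a"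
  using emb_add[of a "- a"] minus_mem[of a] by (simp add: eq_neg_iff_add_eq_0 add.commute)

lemma emb_diff [simp]: "a \<in> K \<Longrightarrow> b \<in> K \<Longrightarrow> \<Phi> (a - b) = \<Phi> a - \<Phi> b"
  using emb_add[of a "- b"] minus_mem[of b] by simp

lemma emb_power [simp]: "a \<in> K \<Longrightarrow> \<Phi> (a ^ m) = \<Phi> a ^ m"
  by (induction m) (simp_all add: power_mem)

lemma emb_of_nat [simp]: "\<Phi> (of_nat m) = of_nat m"
  using emb_const[of "of_nat m"] by (simp add: const_fun_of_nat fls_of_nat del: emb_const)

lemma emb_inverse: "a \<in> K \<Longrightarrow> a \<noteq> 0 \<Longrightarrow> \<Phi> a * \<Phi> (inverse a) = 1"
  using emb_mult[of a "inverse a"] by (simp add: inverse_mem)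

lemma emb_nonzero: "a \<in> K \<Longrightarrow> a \<noteq> 0 \<Longrightarrow> \<Phi> a \<noteq> 0"
  using emb_inverse[of a] by auto

lemma emb_eq_0_iff: "a \<in> K \<Longrightarrow> \<Phi> a = 0 \<longleftrightarrow> a = 0"
  using emb_nonzero by auto

lemma emb_eq_iff: "a \<in> K \<Longrightarrow> b \<in> K \<Longrightarrow> \<Phi> a = \<Phi> b \<longleftrightarrow> a = b"
  using emb_eq_0_iff[of "a - b"] by (simp add: diff_mem)

lemma emb_inverse' [simp]: "a \<in> K \<Longrightarrow> \<Phi> (inverse a) = inverse (\<Phi> a)"
  using emb_inverse[of a] by (cases "a = 0") (auto simp: inverse_unique)

lemma emb_divide [simp]: "a \<in> K \<Longrightarrow> b \<in> K \<Longrightarrow> \<Phi> (a / b) = \<Phi> a / \<Phi> b"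
  by (simp add: divide_inverse inverse_mem)

lemma emb_powi [simp]: "a \<in> K \<Longrightarrow> \<Phi> (a powi m) = \<Phi> a powi m"
  by (simp add: power_int_def power_mem inverse_mem)

lemma embedding_ord_eq: "a \<in> K \<Longrightarrow> embedding_ord K \<Phi> a = fls_subdegree (\<Phi> a)"
  by (simp add: embedding_ord_def)

lemma emb_of_poly: "coord_x \<in> K \<Longrightarrow> \<Phi> (of_poly p) = fls_poly (\<Phi> coord_x) p \<and> of_poly p \<in> K"
proof (induction p)
  case (pCons a p)
  then have "\<Phi> (const_fun a + coord_x * of_poly p) = fls_poly (\<Phi> coord_x) (pCons a p)"
    "const_fun a + coord_x * of_poly p \<in> K"
    using const_mem mult_mem[of coord_x "of_poly p"] by auto
  then show ?case by (simp only: of_poly_pCons)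
qed simp

text \<open>The element \<open>t\<close> makes the valuation normalised: its powers attain every
  integer.\<close>

lemma embedding_ord_point:
  assumes t: "t \<in> K" "fls_subdegree (\<Phi> t) = 1"
  shows "embedding_ord K \<Phi> \<in> points K"
  unfolding points_def
proof (intro CollectI conjI ballI allI impI)
  fix a b assume "a \<in> K - {0}" "b \<in> K - {0}"
  then show "embedding_ord K \<Phi> (a * b) = embedding_ord K \<Phi> a + embedding_ord K \<Phi> b"
    using emb_nonzero by (simp add: embedding_ord_eq mult_mem)
next
  fix a b assume ab: "a \<in> K - {0}" "b \<in> K - {0}" and "a + b \<noteq> 0"
  then have "\<Phi> a + \<Phi> b \<noteq> 0" using emb_nonzero[of "a + b"] by (simp add: add_mem)
  then show "min (embedding_ord K \<Phi> a) (embedding_ord K \<Phi> b) \<le> embedding_ord K \<Phi> (a + b)"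
    using ab fls_plus_subdegree[of "\<Phi> a" "\<Phi> b"] by (simp add: embedding_ord_eq add_mem)
next
  fix c show "embedding_ord K \<Phi> (const_fun c) = 0" by (simp add: embedding_ord_eq)
next
  have "t \<noteq> 0" using t by auto
  have "m \<in> embedding_ord K \<Phi> ` (K - {0})" for m
    using t \<open>t \<noteq> 0\<close> by (intro image_eqI[of _ _ "t powi m"]) (auto simp: embedding_ord_eq powi_mem)
  then show "embedding_ord K \<Phi> ` (K - {0}) = UNIV" by auto
next
  fix a assume "a \<notin> K - {0}"
  then show "embedding_ord K \<Phi> a = 0" by (auto simp: embedding_ord_def)
qed

end

subsection \<open>Derivations\<close>

locale derivation = function_subfield +
  fixes D
  assumes derivation: "D \<in> derivations K"
begin

lemma der_mem: "a \<in> K \<Longrightarrow> D a \<in> K"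
  and der_add: "a \<in> K \<Longrightarrow> b \<in> K \<Longrightarrow> D (a + b) = D a + D b"
  and der_mult: "a \<in> K \<Longrightarrow> b \<in> K \<Longrightarrow> D (a * b) = a * D b + b * D a"
  and der_const [simp]: "D (const_fun c) = 0"
  using derivation by (auto simp: derivations_def)

lemma der_1 [simp]: "D 1 = 0" using der_const[of 1] by (simp add: const_fun_1 del: der_const)

lemma der_inverse: assumes "a \<in> K" "a \<noteq> 0" shows "D (inverse a) = - D a / a ^ 2"
proof -
  have "D (a * inverse a) = a * D (inverse a) + inverse a * D a"
    using assms by (intro der_mult) auto
  then have "a * D (inverse a) = - (inverse a * D a)"
    using assms by (simp add: eq_neg_iff_add_eq_0)
  then have "D (inverse a) = - (inverse a * D a) / a"
    using assms(2) by (metis nonzero_mult_div_cancel_left)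
  then show ?thesis by (simp add: divide_inverse power2_eq_square mult_ac)
qed

lemma der_power: "a \<in> K \<Longrightarrow> D (a ^ m) = of_nat m * a ^ (m - 1) * D a"
proof (induction m)
  case (Suc m)
  have "D (a * a ^ m) = a * D (a ^ m) + a ^ m * D a" using Suc by (intro der_mult) auto
  then show ?case using Suc by (cases m) (simp_all add: algebra_simps)
qed simp

lemma der_of_poly: "coord_x \<in> K \<Longrightarrow> D (of_poly p) = of_poly (pderiv p) * D coord_x \<and> of_poly p \<in> K"
proof (induction p)
  case (pCons a p)
  then have "D (const_fun a + coord_x * of_poly p) = of_poly (pderiv (pCons a p)) * D coord_x"
    using mult_mem[of coord_x "of_poly p"]
    by (simp add: pderiv_pCons of_poly_pCons der_add der_mult algebra_simps)
  moreover have "const_fun a + coord_x * of_poly p \<in> K" using pCons mult_mem[of coord_x "of_poly p"] by auto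
  ultimately show ?case by (simp only: of_poly_pCons)
qed (use der_const[of 0] in simp)

end

context superelliptic
begin

lemma laurent_pointI: "laurent_embedding K \<Phi> \<Longrightarrow> laurent_point K \<Phi>"
  by unfold_locales

lemma embedding_curve:
  assumes "laurent_embedding K \<Phi>"
  shows "\<Phi> y ^ n = fls_poly (\<Phi> coord_x) f"
proof -
  interpret laurent_point K \<Phi> by (rule laurent_pointI) fact
  have "\<Phi> (y ^ n) = fls_poly (\<Phi> coord_x) f" unfolding curve using emb_of_poly by simp
  then show ?thesis by simp
qed

lemma embedding_deriv_curve:
  assumes "laurent_embedding K \<Phi>"
  shows "of_nat n * \<Phi> y ^ (n - 1) * fls_deriv (\<Phi> y) =
    fls_poly (\<Phi> coord_x) (pderiv f) * fls_deriv (\<Phi> coord_x)"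
  using arg_cong[OF embedding_curve[OF assms], of fls_deriv]
  by (simp only: fls_deriv_power fls_poly_deriv)

lemma derivation_curve:
  assumes "D \<in> derivations K"
  shows "of_nat n * y ^ (n - 1) * D y = of_poly (pderiv f) * D coord_x"
proof -
  interpret derivation K D by unfold_locales fact
  have "D (y ^ n) = of_poly (pderiv f) * D coord_x" unfolding curve using der_of_poly by simp
  then show ?thesis by (simp add: der_power)
qed

text \<open>Both sides are derivations and agree at \<open>x\<close>. They agree at \<open>y\<close>
  because the differentiated curve equation determines \<open>D y\<close>, as
  \<open>n y^(n-1)\<close> is nonzero.\<close>

lemma derivations_one_dimensional:
  assumes "D \<in> derivations K" "D coord_x = 1" "E \<in> derivations K" "h \<in> K"
  shows "E h = E coord_x * D h"
  using assms(4)
proof (induction rule: function_field_induct)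
  interpret D: derivation K D by unfold_locales fact
  interpret E: derivation K E by unfold_locales fact
  {
    case const
    show ?case by simp
  next
    case coord
    show ?case using assms by simp
  next
    case generator
    have "of_nat n * y ^ (n - 1) * E y = of_nat n * y ^ (n - 1) * (E coord_x * D y)"
      using derivation_curve[OF assms(1)] derivation_curve[OF assms(3)] assms(2)
      by (simp add: mult_ac)
    then show ?case by simp
  next
    case (add a b)
    then show ?case by (simp add: D.der_add E.der_add algebra_simps)
  next
    case (mult a b)
    then show ?case by (simp add: D.der_mult E.der_mult algebra_simps)
  next
    case (inverse a)
    then show ?case by (simp add: D.der_inverse E.der_inverse)
  }
qed

text \<open>The chain rule, where \<open>D\<close> is \<open>d/dx\<close>: it is checked on the
  generators and carried along the field operations. For \<open>y\<close> it follows by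
  differentiating the curve equation in both fields.\<close>

lemma embedding_derivation:
  assumes "D \<in> derivations K" "D coord_x = 1" and \<Phi>: "laurent_embedding K \<Phi>" and "h \<in> K"
  shows "\<Phi> (D h) * fls_deriv (\<Phi> coord_x) = fls_deriv (\<Phi> h)"
  using assms(4)
proof (induction rule: function_field_induct)
  interpret derivation K D by unfold_locales fact
  interpret laurent_point K \<Phi> by (rule laurent_pointI) fact
  {
    case const
    show ?case by simp
  next
    case coord
    show ?case using assms by simp
  next
    case generator
    have "\<Phi> (of_nat n * y ^ (n - 1) * D y) = fls_poly (\<Phi> coord_x) (pderiv f)"
      using derivation_curve[OF assms(1)] assms(2) emb_of_poly by simp
    moreover have "of_nat n \<in> K" using const_mem[of "of_nat n"] by (simp add: const_fun_of_nat)
    ultimately have *: "of_nat n * \<Phi> y ^ (n - 1) * \<Phi> (D y) = fls_poly (\<Phi> coord_x) (pderiv f)"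
      by (simp add: mult_mem power_mem der_mem)
    have "of_nat n * \<Phi> y ^ (n - 1) * (\<Phi> (D y) * fls_deriv (\<Phi> coord_x)) =
        of_nat n * \<Phi> y ^ (n - 1) * fls_deriv (\<Phi> y)"
      unfolding embedding_deriv_curve[OF \<Phi>] *[symmetric] by (simp only: mult_ac)
    moreover have "\<Phi> y \<noteq> 0" by (intro emb_nonzero) auto
    ultimately show ?case by simp
  next
    case (add a b)
    then show ?case by (simp add: der_add der_mem distrib_right)
  next
    case (mult a b)
    have "\<Phi> (D (a * b)) * fls_deriv (\<Phi> coord_x) =
        \<Phi> a * (\<Phi> (D b) * fls_deriv (\<Phi> coord_x)) + \<Phi> b * (\<Phi> (D a) * fls_deriv (\<Phi> coord_x))"
      using mult.hyps by (simp add: der_mult der_mem mult_mem algebra_simps)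
    then show ?case using mult by (simp add: mult_ac)
  next
    case (inverse a)
    have "\<Phi> (D (inverse a)) * fls_deriv (\<Phi> coord_x) =
        - (\<Phi> (D a) * fls_deriv (\<Phi> coord_x)) / \<Phi> a ^ 2"
      using inverse.hyps by (simp add: der_inverse der_mem divide_mem power_mem)
    then show ?case using inverse by (simp add: fls_inverse_deriv')
  }
qed

text \<open>The image of the function field in \<open>k((s))\<close> is closed under \<open>(dZ/ds)\<^sup>-\<^sup>1 d/ds\<close>, as this is
  a derivation and maps the generators into it.\<close>

lemma derivation_exists: "\<exists>D\<in>derivations K. D coord_x = 1"
proof -
  obtain a where a: "poly f a = 0" using branch_exists by blast
  define Z where "Z = fls_const a + (fls_X :: 'k fls) ^ n"
  obtain Y where Y: "Y ^ n = fls_poly Z f" "Y \<noteq> 0"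
    using finite_parametrization[of n a] a by (auto simp: Z_def)
  \<comment> \<open>The derivative is \<open>n s^(n-1)\<close>, nonzero because the characteristic
    does not divide \<open>n\<close>.\<close>
  have dZ: "fls_deriv Z \<noteq> 0" by (simp add: Z_def fls_deriv_power)
  then have "Z \<notin> range fls_const" by auto
  then obtain \<Phi> where \<Phi>: "laurent_embedding K \<Phi>" and x: "\<Phi> coord_x = Z" and y: "\<Phi> y = Y"
    using embedding_exists[OF _ Y(1)] by metis
  interpret laurent_point K \<Phi> by (rule laurent_pointI) fact
  have ex: "\<exists>g\<in>K. \<Phi> g * fls_deriv Z = fls_deriv (\<Phi> h)" if "h \<in> K" for h
    using that
  proof (induction rule: function_field_induct)
    case const
    show ?case by (intro bexI[of _ 0]) auto
  next
    case coord
    show ?case by (intro bexI[of _ 1]) (auto simp: x)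
  next
    case generator
    \<comment> \<open>The value of \<open>dy/dx\<close> that is forced by
      \<open>n y^(n-1) dy = f'(x) dx\<close>.\<close>
    let ?g = "of_poly (pderiv f) / (of_nat n * y ^ (n - 1))"
    have n: "of_nat n \<in> K" using const_mem[of "of_nat n"] by (simp add: const_fun_of_nat)
    have "\<Phi> ?g = fls_poly Z (pderiv f) / (of_nat n * Y ^ (n - 1))"
      using emb_of_poly[of "pderiv f"] n by (simp add: x y mult_mem power_mem)
    moreover have c: "of_nat n * Y ^ (n - 1) \<noteq> 0" using Y(2) by simp
    ultimately have "of_nat n * Y ^ (n - 1) * \<Phi> ?g = fls_poly Z (pderiv f)"
      by (metis nonzero_mult_div_cancel_left times_divide_eq_right)
    then have "of_nat n * Y ^ (n - 1) * (\<Phi> ?g * fls_deriv Z) = of_nat n * Y ^ (n - 1) * fls_deriv (\<Phi> y)"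
      using embedding_deriv_curve[OF \<Phi>] unfolding x y by (simp only: flip: mult.assoc)
    then have "\<Phi> ?g * fls_deriv Z = fls_deriv (\<Phi> y)" using c mult_cancel_left by blast
    moreover have "?g \<in> K" using emb_of_poly[of "pderiv f"] n by (intro divide_mem mult_mem power_mem) auto
    ultimately show ?case by blast
  next
    case (add a b)
    then obtain g h where "g \<in> K" "\<Phi> g * fls_deriv Z = fls_deriv (\<Phi> a)"
      "h \<in> K" "\<Phi> h * fls_deriv Z = fls_deriv (\<Phi> b)" by blast
    then show ?case using add.hyps by (intro bexI[of _ "g + h"]) (auto simp: distrib_right)
  next
    case (mult a b)
    then obtain g h where gh: "g \<in> K" "h \<in> K" and
      eqs: "\<Phi> g * fls_deriv Z = fls_deriv (\<Phi> a)" "\<Phi> h * fls_deriv Z = fls_deriv (\<Phi> b)" by blast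
    show ?case
    proof
      show "\<Phi> (a * h + b * g) * fls_deriv Z = fls_deriv (\<Phi> (a * b))"
        using mult.hyps gh by (simp add: mult_mem eqs[symmetric] algebra_simps)
    qed (use mult.hyps gh in auto)
  next
    case (inverse a)
    then obtain g where "g \<in> K" "\<Phi> g * fls_deriv Z = fls_deriv (\<Phi> a)" by blast
    then show ?case using inverse.hyps
      by (intro bexI[of _ "- g / a ^ 2"])
        (auto simp: fls_inverse_deriv' minus_mem power_mem divide_mem)
  qed
  \<comment> \<open>The chosen \<open>g\<close> is unique, as \<open>\<Phi>\<close> is injective and
    \<open>dZ/ds\<close> is nonzero; hence the choice respects sums and products.\<close>
  define D where "D h = (if h \<in> K then SOME g. g \<in> K \<and> \<Phi> g * fls_deriv Z = fls_deriv (\<Phi> h) else 0)" for h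
  have D: "D h \<in> K \<and> \<Phi> (D h) * fls_deriv Z = fls_deriv (\<Phi> h)" if "h \<in> K" for h
    using someI_ex[of "\<lambda>g. g \<in> K \<and> \<Phi> g * fls_deriv Z = fls_deriv (\<Phi> h)"] ex[OF that] that
    by (auto simp: D_def)
  have D_eqI: "D h = g" if "h \<in> K" "g \<in> K" "\<Phi> g * fls_deriv Z = fls_deriv (\<Phi> h)" for h g
    using D[OF that(1)] that dZ emb_eq_iff[of "D h" g] by (metis mult_right_cancel)
  have "D \<in> derivations K"
    unfolding derivations_def
  proof (intro CollectI conjI ballI allI impI)
    fix a b assume ab: "a \<in> K" "b \<in> K"
    show "D (a + b) = D a + D b"
      using ab D by (intro D_eqI) (auto simp: distrib_right)
    show "D (a * b) = a * D b + b * D a"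
    proof (rule D_eqI)
      show "\<Phi> (a * D b + b * D a) * fls_deriv Z = fls_deriv (\<Phi> (a * b))"
        using ab D[OF ab(1)] D[OF ab(2)]
        by (simp add: mult_mem D[THEN conjunct2, symmetric] algebra_simps)
    qed (use ab D in auto)
  next
    fix c show "D (const_fun c) = 0" by (intro D_eqI) auto
  next
    fix a assume "a \<in> K"
    then show "D a \<in> K" using D by blast
  qed (simp add: D_def)
  moreover have "D coord_x = 1" by (intro D_eqI) (auto simp: x)
  ultimately show ?thesis by blast
qed

subsection \<open>Differentials\<close>

definition Dx :: "'k alg_fun \<Rightarrow> 'k alg_fun"
  where "Dx = (SOME D. D \<in> derivations K \<and> D coord_x = 1)"

lemma Dx: "Dx \<in> derivations K" "Dx coord_x = 1"
  using someI_ex[of "\<lambda>D. D \<in> derivations K \<and> D coord_x = 1"] derivation_exists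
  by (auto simp: Dx_def)

sublocale Dx: derivation K Dx by unfold_locales (rule Dx)

text \<open>Every \<open>q\<close>-fold differential is \<open>g (dx)^q\<close> for exactly one
  \<open>g\<close>, which evaluation at \<open>Dx\<close> recovers.\<close>

definition form :: "nat \<Rightarrow> 'k alg_fun \<Rightarrow> 'k differential"
  where "form q g = diff_form K q g coord_x"

lemma form_Dx: "form q g Dx = g" by (simp add: form_def diff_form_def Dx)

lemma form_eq_iff [simp]: "form q g = form q h \<longleftrightarrow> g = h"
  by (metis form_Dx)

lemma form_add: "form q (g + h) = form q g + form q h"
  by (auto simp: form_def diff_form_def algebra_simps)

lemma form_0 [simp]: "form q 0 = 0" by (auto simp: form_def diff_form_def)

lemma form_eq_0_iff [simp]: "form q g = 0 \<longleftrightarrow> g = 0"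
  using form_eq_iff[of q g 0] by (simp del: form_eq_iff)

lemma form_scale: "diff_scale c (form q g) = form q (const_fun c * g)"
  by (auto simp: diff_scale_def form_def diff_form_def)

lemma form_sum: "form q (sum u I) = (\<Sum>i\<in>I. form q (u i))"
  by (induction I rule: infinite_finite_induct) (simp_all add: form_add)

lemma diff_form_eq: "t \<in> K \<Longrightarrow> diff_form K q h t = form q (h * Dx t ^ q)"
proof
  fix E assume t: "t \<in> K"
  show "diff_form K q h t E = form q (h * Dx t ^ q) E"
  proof (cases "E \<in> derivations K")
    case True
    then show ?thesis
      unfolding form_def diff_form_def derivations_one_dimensional[OF Dx True t]
      by (simp add: power_mult_distrib)
  qed (simp add: form_def diff_form_def)
qed

lemma differentials_eq: "differentials K q = form q ` K"
proof -
  have "form q (h * Dx t ^ q) \<in> form q ` K" if "h \<in> K" "t \<in> K" for h t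
    using that by (auto intro: Dx.der_mem)
  then have "differentials K q \<subseteq> form q ` K"
    unfolding differentials_def by (auto simp only: diff_form_eq)
  moreover have "form q ` K \<subseteq> differentials K q"
    unfolding differentials_def form_def using x_mem by blast
  ultimately show ?thesis by blast
qed

text \<open>A series of order 1 has a derivative of order 0 in every characteristic. Hence
  \<open>dt/dx\<close> has the order of the inverse of \<open>dx/ds\<close>, for every uniformizer
  \<open>t\<close>.\<close>

lemma fls_deriv_coordinate:
  assumes \<Phi>: "laurent_embedding K \<Phi>" and P: "embedding_ord K \<Phi> \<in> points K"
  shows "fls_deriv (\<Phi> coord_x) \<noteq> 0"
    and "t \<in> K \<Longrightarrow> embedding_ord K \<Phi> t = 1 \<Longrightarrow> Dx t \<noteq> 0 \<and>
      embedding_ord K \<Phi> (Dx t) = - fls_subdegree (fls_deriv (\<Phi> coord_x))"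
proof -
  interpret laurent_point K \<Phi> by (rule laurent_pointI) fact
  interpret curve_point K "embedding_ord K \<Phi>" by unfold_locales fact
  have *: "fls_deriv (\<Phi> t) \<noteq> 0 \<and> fls_subdegree (fls_deriv (\<Phi> t)) = 0" 
    if "t \<in> K" "embedding_ord K \<Phi> t = 1" for t
  proof -
    have 1: "fls_subdegree (\<Phi> t) = 1" using that by (simp add: embedding_ord_eq)
    then have nz: "\<Phi> t \<noteq> 0" by auto
    have "fls_subdegree (fls_deriv (\<Phi> t)) = 0" using fls_subdegree_deriv'[of "\<Phi> t"] 1 by simp
    moreover have "fls_nth (fls_deriv (\<Phi> t)) 0 \<noteq> 0"
      using nth_fls_subdegree_nonzero[OF nz] 1 by simp
    then have "fls_deriv (\<Phi> t) \<noteq> 0" by (metis fls_zero_nth)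
    ultimately show ?thesis by blast
  qed
  obtain s where "s \<in> K" "embedding_ord K \<Phi> s = 1" by (rule uniformizer)
  with * embedding_derivation[OF Dx \<Phi>, of s] show nz: "fls_deriv (\<Phi> coord_x) \<noteq> 0" by force
  assume t: "t \<in> K" "embedding_ord K \<Phi> t = 1"
  have eq: "\<Phi> (Dx t) * fls_deriv (\<Phi> coord_x) = fls_deriv (\<Phi> t)"
    using embedding_derivation[OF Dx \<Phi>] t by simp
  then have "\<Phi> (Dx t) \<noteq> 0" using *[OF t] by auto
  then have "fls_subdegree (\<Phi> (Dx t)) + fls_subdegree (fls_deriv (\<Phi> coord_x)) = 0"
    using arg_cong[OF eq, of fls_subdegree] *[OF t] nz by simp
  then show "Dx t \<noteq> 0 \<and> embedding_ord K \<Phi> (Dx t) = - fls_subdegree (fls_deriv (\<Phi> coord_x))"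
    using \<open>\<Phi> (Dx t) \<noteq> 0\<close> t by (auto simp: embedding_ord_eq Dx.der_mem)
qed

text \<open>Rewriting \<open>g (dx)^q\<close> as \<open>(g / (dt/dx)^q) (dt)^q\<close> shifts the
  order by the same amount for every uniformizer \<open>t\<close>, so the description in
  \<open>diff_ord\<close> has a unique solution.\<close>

lemma diff_ord_form:
  assumes \<Phi>: "laurent_embedding K \<Phi>" and P: "embedding_ord K \<Phi> \<in> points K"
    and g: "g \<in> K" "g \<noteq> 0"
  shows "diff_ord K q (embedding_ord K \<Phi>) (form q g) =
    embedding_ord K \<Phi> g + int q * fls_subdegree (fls_deriv (\<Phi> coord_x))"
proof -
  interpret curve_point K "embedding_ord K \<Phi>" by unfold_locales fact
  let ?P = "embedding_ord K \<Phi>" and ?\<delta> = "fls_subdegree (fls_deriv (\<Phi> coord_x))"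
  note Dt = fls_deriv_coordinate(2)[OF \<Phi> P]
  show ?thesis unfolding diff_ord_def
  proof (rule the_equality)
    obtain t where t: "t \<in> K" "?P t = 1" by (rule uniformizer)
    let ?h = "g / Dx t ^ q"
    have "?h \<in> K - {0}" using g t Dt[OF t] by (auto intro: Dx.der_mem)
    moreover have "form q g = diff_form K q ?h t" using t Dt[OF t] by (simp add: diff_form_eq)
    moreover have "?P g + int q * ?\<delta> = ?P ?h"
      using g t Dt[OF t] by (simp add: ord_divide ord_power power_mem Dx.der_mem)
    ultimately show "\<exists>h\<in>K - {0}. \<exists>t\<in>K. ?P t = 1 \<and> form q g = diff_form K q h t \<and>
        ?P g + int q * ?\<delta> = ?P h" using t by blast
  next
    fix m assume "\<exists>h\<in>K - {0}. \<exists>t\<in>K. ?P t = 1 \<and> form q g = diff_form K q h t \<and> m = ?P h"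
    then obtain h t where h: "h \<in> K" "h \<noteq> 0" "m = ?P h" and t: "t \<in> K" "?P t = 1"
      and eq: "form q g = diff_form K q h t" by blast
    have "g = h * Dx t ^ q" using eq t by (simp add: diff_form_eq)
    then show "m = ?P g + int q * ?\<delta>"
      using h t Dt[OF t] by (simp add: ord_mult ord_power power_mem Dx.der_mem)
  qed
qed

lemma point_embedding:
  assumes "P \<in> points K"
  obtains \<Phi> where "laurent_embedding K \<Phi>" "embedding_ord K \<Phi> = P"
proof -
  interpret curve_point_x K P by unfold_locales (use assms in auto)
  show ?thesis using laurent_embedding_exists that by blast
qed

lemma form_holomorphic_iff:
  assumes g: "g \<in> K" "g \<noteq> 0"
  shows "form q g \<in> holomorphic_differentials K q \<longleftrightarrow>
    (\<forall>\<Phi>. laurent_embedding K \<Phi> \<and> embedding_ord K \<Phi> \<in> points K \<longrightarrow>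
      0 \<le> embedding_ord K \<Phi> g + int q * fls_subdegree (fls_deriv (\<Phi> coord_x)))"
proof -
  have "form q g \<in> holomorphic_differentials K q \<longleftrightarrow>
      (\<forall>P\<in>points K. 0 \<le> diff_ord K q P (form q g))"
    using g by (auto simp: holomorphic_differentials_def differentials_eq)
  also have "\<dots> \<longleftrightarrow> (\<forall>\<Phi>. laurent_embedding K \<Phi> \<and> embedding_ord K \<Phi> \<in> points K \<longrightarrow>
      0 \<le> diff_ord K q (embedding_ord K \<Phi>) (form q g))"
    using point_embedding by metis
  finally show ?thesis using diff_ord_form[OF _ _ g] by auto
qed

end

section \<open>A monomial basis of the holomorphic \<open>q\<close>-differentials\<close>

lemma fls_ge_deriv: "fls_ge m F \<Longrightarrow> fls_ge (m - 1) (fls_deriv F)"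
  by (simp add: fls_ge_def)

text \<open>One better than \<open>fls_ge_deriv\<close>, because the constant term differentiates to
  0.\<close>

lemma fls_ge_0_deriv: assumes "fls_ge 0 F" shows "fls_ge 0 (fls_deriv F)"
  unfolding fls_ge_def
proof (intro allI impI)
  fix i :: int assume "i < 0"
  then show "fls_nth (fls_deriv F) i = 0" using assms by (cases "i = - 1") (auto simp: fls_ge_def)
qed

lemma fls_const_sum: "fls_const (sum u I) = (\<Sum>i\<in>I. fls_const (u i))"
  by (induction I rule: infinite_finite_induct) (simp_all flip: fls_plus_const)

lemma sum_roots_of_unity:
  assumes n: "of_nat n \<noteq> (0 :: 'k::alg_closed_field)"
  shows "(\<Sum>\<zeta> | \<zeta> ^ n = 1. \<zeta> ^ m) = (if n dvd m then of_nat n else 0 :: 'k)"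
proof -
  have n0: "n > 0" using n by (cases n) auto
  have "\<zeta> ^ m = \<zeta> ^ (m mod n)" if "\<zeta> ^ n = 1" for \<zeta> :: 'k
  proof -
    have "\<zeta> ^ m = \<zeta> ^ (n * (m div n) + m mod n)" by simp
    also have "\<dots> = \<zeta> ^ (m mod n)" unfolding power_add power_mult that by simp
    finally show ?thesis .
  qed
  then have "(\<Sum>\<zeta> | \<zeta> ^ n = 1. \<zeta> ^ m) = (\<Sum>\<zeta> | \<zeta> ^ n = 1. \<zeta> ^ (m mod n) :: 'k)" by simp
  also have "\<dots> = (if n dvd m then of_nat n else 0)"
  proof (cases "n dvd m")
    case True
    then show ?thesis using card_roots_of_unity[OF n] by simp
  next
    case False
    then have "0 < m mod n" by (simp add: mod_greater_zero_iff_not_dvd)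
    then show ?thesis using sum_roots_of_unity_power[OF n, of "m mod n"] n0 False by simp
  qed
  finally show ?thesis .
qed

context superelliptic
begin

text \<open>\<open>deg_bound q\<close> is \<open>q (2 g - 2)\<close>, by Riemann--Hurwitz: there are
  \<open>gcd n (degree f)\<close> points at infinity.\<close>

definition deg_bound :: "nat \<Rightarrow> int"
  where "deg_bound q = int q * (int (degree f) * int n - int (degree f) - int n - int (gcd n (degree f)))"

text \<open>Up to the constant \<open>n\<close>, \<open>dx / y\<^sup>n\<^sup>-\<^sup>1 = dy / f'(x)\<close>, and \<open>y\<close> and \<open>f'(x)\<close>
  have no common zero.\<close>

lemma differential_order_finite:
  assumes \<Phi>: "laurent_embedding K \<Phi>" and P: "embedding_ord K \<Phi> \<in> points K"
    and x: "fls_ge 0 (\<Phi> coord_x)"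
  shows "0 \<le> fls_subdegree (\<Phi> y)"
    and "int (n - 1) * fls_subdegree (\<Phi> y) \<le> fls_subdegree (fls_deriv (\<Phi> coord_x))"
proof -
  interpret laurent_point K \<Phi> by (rule laurent_pointI) fact
  let ?z = "\<Phi> coord_x" and ?w = "\<Phi> y"
  have z': "fls_deriv ?z \<noteq> 0" using fls_deriv_coordinate(1)[OF \<Phi> P] .
  have w: "?w \<noteq> 0" by (intro emb_nonzero) auto
  have "fls_poly ?z f \<noteq> 0" using embedding_curve[OF \<Phi>] w by (metis power_not_zero)
  then have "0 \<le> fls_subdegree (?w ^ n)"
    using fls_ge_poly[OF x, of f] embedding_curve[OF \<Phi>] by (simp add: fls_ge_iff)
  then show w0: "0 \<le> fls_subdegree ?w" using n_ge by (simp add: fls_subdegree_pow zero_le_mult_iff)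
  define c where "c = fls_nth ?z 0"
  have c: "fls_ge 1 (?z - fls_const c)"
    unfolding fls_ge_def
  proof (intro allI impI)
    fix i :: int assume "i < 1"
    then show "fls_nth (?z - fls_const c) i = 0"
      using x by (cases "i = 0") (auto simp: fls_ge_def c_def)
  qed
  show "int (n - 1) * fls_subdegree ?w \<le> fls_subdegree (fls_deriv ?z)"
  proof (cases "poly f c = 0")
    case False
    then have "fls_subdegree (?w ^ n) = 0"
      using fls_subdegree_poly_unit[OF c False] embedding_curve[OF \<Phi>] by simp
    then have "fls_subdegree ?w = 0" using n_ge by (simp add: fls_subdegree_pow)
    then show ?thesis using fls_ge_0_deriv[OF x] z' by (simp add: fls_ge_iff)
  next
    case True
    have u: "fls_poly ?z (pderiv f) \<noteq> 0" "fls_subdegree (fls_poly ?z (pderiv f)) = 0"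
      using fls_subdegree_poly_unit[OF c pderiv_f[OF True]] by auto
    note eq = embedding_deriv_curve[OF \<Phi>]
    have w': "fls_deriv ?w \<noteq> 0" using eq u z' by auto
    have "int (n - 1) * fls_subdegree ?w + fls_subdegree (fls_deriv ?w) = fls_subdegree (fls_deriv ?z)"
      using arg_cong[OF eq, of fls_subdegree] u z' w w' by (simp add: fls_subdegree_pow)
    moreover have "fls_ge 0 (fls_deriv ?w)" by (intro fls_ge_0_deriv fls_geI w0)
    ultimately show ?thesis using w' by (simp add: fls_ge_iff)
  qed
qed

text \<open>The coefficient of \<open>(dx)^q\<close> in
  \<open>(x - a)^i y^j (dx / y^(n-1))^q\<close>. It is a quotient because \<open>j - (n-1) q\<close>
  may be negative.\<close>

definition monomial :: "'k \<Rightarrow> nat \<Rightarrow> nat \<Rightarrow> nat \<Rightarrow> 'k alg_fun"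
  where "monomial a q i j = (coord_x - const_fun a) ^ i * y ^ j / y ^ ((n - 1) * q)"

lemma monomial_mem: "monomial a q i j \<in> K"
  unfolding monomial_def by (intro divide_mem mult_mem power_mem diff_mem) auto

lemma x_diff_mem [simp]: "coord_x - const_fun a \<in> K" by (intro diff_mem) auto

lemma x_diff_nz [simp]: "coord_x - const_fun a \<noteq> 0" using coord_x_neq_const[of a] by simp

lemma monomial_nz: "monomial a q i j \<noteq> 0"
  unfolding monomial_def by (simp add: coord_x_neq_const)

lemma ord_monomial:
  assumes "P \<in> points K"
  shows "P (monomial a q i j) =
    int i * P (coord_x - const_fun a) + int j * P y - int q * (int (n - 1) * P y)"
proof -
  interpret curve_point K P by unfold_locales fact
  show ?thesis
    by (simp add: monomial_def ord_divide ord_mult ord_power power_mem mult_mem coord_x_neq_const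
        mult_ac)
qed

text \<open>Where \<open>x\<close> is finite every factor is regular. At a pole of \<open>x\<close>
  the point is still arbitrary, and its orders are only estimated, from
  \<open>n ord y = d ord x\<close> and \<open>ord (dx/ds) \<ge> ord x - 1\<close>.\<close>

lemma monomial_holomorphic:
  assumes ij: "int (i * n + j * degree f) \<le> deg_bound q"
  shows "form q (monomial a q i j) \<in> holomorphic_differentials K q"
  unfolding form_holomorphic_iff[OF monomial_mem monomial_nz]
proof (intro allI impI, elim conjE)
  fix \<Phi> assume \<Phi>: "laurent_embedding K \<Phi>" and P: "embedding_ord K \<Phi> \<in> points K"
  interpret laurent_point K \<Phi> by (rule laurent_pointI) fact
  interpret curve_point K "embedding_ord K \<Phi>" by unfold_locales fact
  let ?P = "embedding_ord K \<Phi>" and ?z = "\<Phi> coord_x" and ?w = "\<Phi> y"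
  let ?\<delta> = "fls_subdegree (fls_deriv ?z)"
  have Pg: "?P (monomial a q i j) + int q * ?\<delta> =
      int i * fls_subdegree (?z - fls_const a) + int j * fls_subdegree ?w +
      int q * (?\<delta> - int (n - 1) * fls_subdegree ?w)"
    by (simp add: ord_monomial[OF P] embedding_ord_eq algebra_simps)
  have z': "fls_deriv ?z \<noteq> 0" using fls_deriv_coordinate(1)[OF \<Phi> P] .
  show "0 \<le> ?P (monomial a q i j) + int q * ?\<delta>"
  proof (cases "fls_subdegree ?z < 0")
    case False
    then have z: "fls_ge 0 ?z" by (intro fls_geI) simp
    have "?z - fls_const a \<noteq> 0" using emb_nonzero[OF x_diff_mem x_diff_nz, of a] by simp
    moreover have "fls_ge 0 (?z + fls_const (- a))" by (intro fls_ge_add z fls_ge_const)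
    ultimately have "0 \<le> fls_subdegree (?z - fls_const a)" by (simp add: fls_ge_iff)
    then show ?thesis unfolding Pg using differential_order_finite[OF \<Phi> P z] by simp
  next
    case True
    define \<mu> where "\<mu> = - fls_subdegree ?z"
    define p where "p = fls_subdegree ?w"
    define G where "G = int (gcd n (degree f))"
    have \<mu>: "\<mu> > 0" using True by (simp add: \<mu>_def)
    have "?z \<noteq> 0" using True by auto
    then have za: "fls_subdegree (?z - fls_const a) = - \<mu>"
      using True by (subst fls_subdegree_diff_eq1) (simp_all add: \<mu>_def)
    have np: "int n * p = - (int (degree f) * \<mu>)"
      using arg_cong[OF embedding_curve[OF \<Phi>], of fls_subdegree] fls_subdegree_poly_degree[OF True f_nz]
      by (simp add: fls_subdegree_pow p_def \<mu>_def)
    have "fls_ge (- \<mu> - 1) (fls_deriv ?z)" by (intro fls_ge_deriv fls_geI) (simp add: \<mu>_def)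
    then have \<delta>: "- \<mu> - 1 \<le> ?\<delta>" using z' by (simp add: fls_ge_iff)
    \<comment> \<open>This leads to a pole of \<open>x\<close> of order at least
      \<open>n / G\<close>, which compensates the 1 lost in the estimate of
      \<open>\<delta>\<close>.\<close>
    have "int n dvd int (degree f) * \<mu>" using np by (metis dvd_minus_iff dvd_triv_left)
    then have "int n dvd gcd (int n * \<mu>) (int (degree f) * \<mu>)" by simp
    also have "gcd (int n * \<mu>) (int (degree f) * \<mu>) = G * \<mu>"
      using \<mu> by (simp add: gcd_mult_right G_def gcd_int_int_eq gcd.commute flip: gcd_mult_distrib_int)
    finally have G: "int n \<le> G * \<mu>" using \<mu> n_ge by (intro zdvd_imp_le) (simp_all add: G_def)
    define T where "T = int i * - \<mu> + int j * p + int q * (?\<delta> - int (n - 1) * p)"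
    have n1: "int (n - 1) = int n - 1" using n_ge by simp
    \<comment> \<open>Only the multiple \<open>n p\<close> is known, so \<open>T\<close> is scaled
      by \<open>n\<close>. The estimates below then leave the nonnegative remainder
      \<open>q (G \<mu> - n)\<close>.\<close>
    have "int n * T = - (int i * int n * \<mu>) + int j * (int n * p) + int n * int q * ?\<delta>
        - int q * ((int n - 1) * (int n * p))"
      unfolding T_def n1 by (simp add: algebra_simps)
    also have "\<dots> = - \<mu> * int (i * n + j * degree f) + int n * int q * ?\<delta> +
        int q * ((int n - 1) * int (degree f) * \<mu>)"
      unfolding np by (simp add: algebra_simps)
    finally have nT: "int n * T = - \<mu> * int (i * n + j * degree f) + int n * int q * ?\<delta> +
        int q * ((int n - 1) * int (degree f) * \<mu>)" .
    have 1: "\<mu> * int (i * n + j * degree f) \<le> \<mu> * deg_bound q"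
      using ij \<mu> by (intro mult_left_mono) auto
    have 2: "int n * int q * (- \<mu> - 1) \<le> int n * int q * ?\<delta>"
      using \<delta> by (intro mult_left_mono) auto
    have 3: "0 \<le> int q * (G * \<mu> - int n)" using G by simp
    have "int q * (G * \<mu> - int n) = - (\<mu> * deg_bound q) + int n * int q * (- \<mu> - 1) +
        int q * ((int n - 1) * int (degree f) * \<mu>)"
      by (simp add: deg_bound_def G_def[symmetric] algebra_simps)
    then have "0 \<le> int n * T" unfolding nT using 1 2 3 by linarith
    then have "0 \<le> T" using n_ge by (simp add: zero_le_mult_iff)
    then show ?thesis unfolding Pg za by (simp add: T_def p_def)
  qed
qed

text \<open>The Laurent expansions with \<open>y \<mapsto> \<zeta> Y\<close>, \<open>\<zeta>\<^sup>n = 1\<close>, cover all points above a given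
  \<open>x\<close>; a discrete Fourier transform over the \<open>\<zeta>\<close> isolates the terms of \<open>\<Sum>\<^sub>j a\<^sub>j y\<^sup>j\<close>.\<close>

lemma coefficient_order:
  assumes Z: "Z \<notin> range fls_const" and Y: "Y ^ n = fls_poly Z f"
    and b: "b \<noteq> 0" and p: "degree p < n"
    and bound: "\<And>\<Phi> \<zeta>. laurent_embedding K \<Phi> \<Longrightarrow> \<Phi> coord_x = Z \<Longrightarrow> \<zeta> ^ n = 1 \<Longrightarrow>
      \<Phi> y = fls_const \<zeta> * Y \<Longrightarrow> fls_ge B (\<Phi> (bipoly_at y p / of_poly b))"
    and j: "j < n"
  shows "fls_ge B (fls_poly Z (coeff p j) / fls_poly Z b * Y ^ j)"
proof -
  let ?U = "{\<zeta>::'k. \<zeta> ^ n = 1}"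
  define T where "T i = fls_poly Z (coeff p i) / fls_poly Z b * Y ^ i" for i
  define V where "V \<zeta> = fls_bipoly Z (fls_const \<zeta> * Y) p / fls_poly Z b" for \<zeta>
  have V: "fls_ge B (V \<zeta>)" if "\<zeta> \<in> ?U" for \<zeta>
  proof -
    have \<zeta>: "\<zeta> ^ n = 1" using that by simp
    then have "(fls_const \<zeta> * Y) ^ n = fls_poly Z f"
      using Y by (simp add: power_mult_distrib flip: fls_const_power)
    then obtain \<Phi> where \<Phi>: "laurent_embedding K \<Phi>" "\<Phi> coord_x = Z" "\<Phi> y = fls_const \<zeta> * Y"
      and frac: "\<And>p b. b \<noteq> 0 \<Longrightarrow> \<Phi> (bipoly_at y p / of_poly b) =
        fls_bipoly Z (fls_const \<zeta> * Y) p / fls_poly Z b"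
      using embedding_exists[OF Z] by blast
    show ?thesis using bound[OF \<Phi>(1,2) \<zeta> \<Phi>(3)] unfolding frac[OF b] V_def .
  qed
  have V_eq: "V \<zeta> = (\<Sum>i<n. fls_const (\<zeta> ^ i) * T i)" for \<zeta>
  proof -
    have "fls_bipoly Z (fls_const \<zeta> * Y) p =
        (\<Sum>i\<le>n - 1. fls_poly Z (coeff p i) * (fls_const \<zeta> * Y) ^ i)"
      using p by (intro laurent_bipoly.ev_altdef) simp
    also have "{..n - 1} = {..<n}" using n_ge by auto
    finally show ?thesis
      by (simp add: V_def T_def sum_divide_distrib power_mult_distrib fls_const_power mult_ac)
  qed
  \<comment> \<open>The exponent \<open>n - j\<close> stands for \<open>- j\<close>, which is not a
    natural number.\<close>
  have "(\<Sum>\<zeta>\<in>?U. fls_const (\<zeta> ^ (n - j)) * V \<zeta>) =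
      (\<Sum>\<zeta>\<in>?U. \<Sum>i<n. fls_const (\<zeta> ^ (n - j + i)) * T i)"
    by (simp add: V_eq sum_distrib_left power_add flip: mult.assoc)
  also have "\<dots> = (\<Sum>i<n. \<Sum>\<zeta>\<in>?U. fls_const (\<zeta> ^ (n - j + i)) * T i)" by (rule sum.swap)
  also have "\<dots> = (\<Sum>i<n. fls_const (\<Sum>\<zeta>\<in>?U. \<zeta> ^ (n - j + i)) * T i)"
    by (simp add: fls_const_sum sum_distrib_right)
  also have "\<dots> = (\<Sum>i<n. if i = j then fls_const (of_nat n) * T j else 0)"
  proof (intro sum.cong refl)
    fix i assume i: "i \<in> {..<n}"
    have "n dvd n - j + i \<longleftrightarrow> i = j"
    proof
      assume "n dvd n - j + i"
      then obtain k where k: "n - j + i = n * k" by (rule dvdE)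
      have "k = 1"
      proof (rule ccontr)
        assume "k \<noteq> 1"
        then consider "k = 0" | "k \<ge> 2" by linarith
        then show False
        proof cases
          case 2
          then have "n * 2 \<le> n * k" by simp
          moreover have "i < n" using i by simp
          ultimately show ?thesis using k j by linarith
        qed (use k j in simp)
      qed
      then show "i = j" using k j by simp
    qed (use j in simp)
    then show "fls_const (\<Sum>\<zeta>\<in>?U. \<zeta> ^ (n - j + i)) * T i =
        (if i = j then fls_const (of_nat n) * T j else 0)"
      by (simp add: sum_roots_of_unity)
  qed
  also have "\<dots> = fls_const (of_nat n) * T j" using j by (simp add: sum.delta)
  finally have eq: "T j = fls_const (inverse (of_nat n)) * (\<Sum>\<zeta>\<in>?U. fls_const (\<zeta> ^ (n - j)) * V \<zeta>)"
    by (simp flip: mult.assoc)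
  have "fls_ge (0 + (0 + B)) (T j)"
    unfolding eq by (intro fls_ge_mult fls_ge_sum fls_ge_const V)
  then show ?thesis by (simp add: T_def)
qed

text \<open>All conjugates \<open>\<zeta> Y\<close> have the order of \<open>Y\<close>, so
  holomorphy bounds the order of \<open>g y^((n-1) q)\<close> by the same constant in each of these
  expansions, as the Fourier argument requires. The hypothesis \<open>point\<close> ensures that
  each expansion is normalised and therefore a point.\<close>

lemma holomorphic_coefficient_order:
  assumes g: "g \<in> K" "form q g \<in> holomorphic_differentials K q"
    and h: "g * y ^ ((n - 1) * q) = bipoly_at y p / of_poly b" "b \<noteq> 0" "degree p < n"
    and Z: "Z \<notin> range fls_const" and Y: "Y ^ n = fls_poly Z f" "Y \<noteq> 0"
    and point: "\<And>\<Phi> \<zeta>. laurent_embedding K \<Phi> \<Longrightarrow> \<Phi> coord_x = Z \<Longrightarrow> \<zeta> \<noteq> 0 \<Longrightarrow>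
      \<Phi> y = fls_const \<zeta> * Y \<Longrightarrow> \<exists>t\<in>K. fls_subdegree (\<Phi> t) = 1"
    and j: "j < n"
  shows "fls_ge (int q * (int (n - 1) * fls_subdegree Y - fls_subdegree (fls_deriv Z)))
    (fls_poly Z (coeff p j) / fls_poly Z b * Y ^ j)"
proof (rule coefficient_order[OF Z Y(1) h(2,3) _ j])
  fix \<Phi> \<zeta> assume \<Phi>: "laurent_embedding K \<Phi>" and x: "\<Phi> coord_x = Z"
    and \<zeta>: "\<zeta> ^ n = 1" and y: "\<Phi> y = fls_const \<zeta> * Y"
  interpret laurent_point K \<Phi> by (rule laurent_pointI) fact
  have "\<zeta> \<noteq> 0" using \<zeta> n_ge by (auto simp: power_0_left)
  then have P: "embedding_ord K \<Phi> \<in> points K"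
    using point[OF \<Phi> x _ y] embedding_ord_point by blast
  have Y': "fls_subdegree (\<Phi> y) = fls_subdegree Y" using \<open>\<zeta> \<noteq> 0\<close> Y(2) by (simp add: y)
  show "fls_ge (int q * (int (n - 1) * fls_subdegree Y - fls_subdegree (fls_deriv Z)))
      (\<Phi> (bipoly_at y p / of_poly b))"
  proof (cases "g = 0")
    case True
    then have "bipoly_at y p / of_poly b = 0" using h(1) by simp
    then show ?thesis by (simp only: emb_0) (simp add: fls_ge_iff)
  next
    case False
    then have "0 \<le> embedding_ord K \<Phi> g + int q * fls_subdegree (fls_deriv Z)"
      using g \<Phi> P x form_holomorphic_iff[OF g(1) False] by metis
    moreover have "fls_subdegree (\<Phi> (g * y ^ ((n - 1) * q))) =
        embedding_ord K \<Phi> g + int q * (int (n - 1) * fls_subdegree Y)"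
      using False g emb_nonzero[of g] emb_nonzero[of y]
      by (simp add: power_mem embedding_ord_eq fls_subdegree_pow Y')
    ultimately show ?thesis
      unfolding h(1)[symmetric] by (intro fls_geI) (simp add: algebra_simps)
  qed
qed

text \<open>In the parametrisations with finite \<open>x\<close>, the order of \<open>dx/ds\<close>
  is \<open>n - 1\<close> times that of \<open>y\<close>, so the bound is 0. If \<open>b\<close>
  vanished at \<open>a\<close> but \<open>coeff p j\<close> did not, the \<open>j\<close>-th term
  would have order at most \<open>j - n\<close> at a branch point and at most \<open>- 1\<close>
  elsewhere, both negative.\<close>

lemma finite_coefficients:
  assumes g: "g \<in> K" "form q g \<in> holomorphic_differentials K q"
    and h: "g * y ^ ((n - 1) * q) = bipoly_at y p / of_poly b" "b \<noteq> 0" "degree p < n"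
    and a: "poly b a = 0"
  shows "[:- a, 1:] dvd coeff p j"
proof (cases "j < n")
  case False
  then show ?thesis using h(3) by (simp add: coeff_eq_0)
next
  case True
  define e where "e = (if poly f a = 0 then n else 1)"
  have e: "e > 0" "of_nat e \<noteq> (0 :: 'k)" using n_ge by (auto simp: e_def)
  define Z where "Z = fls_const a + (fls_X :: 'k fls) ^ e"
  obtain Y where Y: "Y ^ n = fls_poly Z f" "Y \<noteq> 0"
    and Y': "fls_subdegree Y = (if poly f a = 0 then 1 else 0)"
    using finite_parametrization[of e a] by (auto simp: Z_def e_def)
  have Za: "Z - fls_const a = fls_X ^ e" by (simp add: Z_def)
  have "fls_deriv Z = of_nat e * fls_X ^ (e - 1)" by (simp add: Z_def fls_deriv_power)
  then have dZ: "fls_deriv Z \<noteq> 0" "fls_subdegree (fls_deriv Z) = int (e - 1)"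
    using e by (auto simp: fls_of_nat)
  have Zc: "Z \<notin> range fls_const" using dZ(1) by auto
  have point: "\<exists>t\<in>K. fls_subdegree (\<Phi> t) = 1"
    if "laurent_embedding K \<Phi>" "\<Phi> coord_x = Z" "\<zeta> \<noteq> 0" "\<Phi> y = fls_const \<zeta> * Y" for \<Phi> \<zeta>
  proof -
    interpret laurent_point K \<Phi> by (rule laurent_pointI) fact
    show ?thesis
    proof (cases "poly f a = 0")
      case True
      then show ?thesis using that Y Y' by (intro bexI[of _ y]) auto
    next
      case False
      have "\<Phi> (coord_x - const_fun a) = fls_X ^ e" using that Za by simp
      then show ?thesis using False by (intro bexI[of _ "coord_x - const_fun a"]) (simp_all add: e_def)
    qed
  qed
  have "fls_ge (int q * (int (n - 1) * fls_subdegree Y - fls_subdegree (fls_deriv Z)))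
      (fls_poly Z (coeff p j) / fls_poly Z b * Y ^ j)"
    using holomorphic_coefficient_order[OF g h Zc Y point True] .
  then have T: "fls_ge 0 (fls_poly Z (coeff p j) / fls_poly Z b * Y ^ j)"
    unfolding dZ Y' by (auto simp: e_def split: if_splits)
  show ?thesis
  proof (rule ccontr)
    assume "\<not> ?thesis"
    then have "poly (coeff p j) a \<noteq> 0" by (simp add: poly_eq_0_iff_dvd)
    moreover have "fls_ge 1 (Z - fls_const a)" using e by (intro fls_geI) (simp add: Za)
    ultimately have num: "fls_poly Z (coeff p j) \<noteq> 0" "fls_subdegree (fls_poly Z (coeff p j)) = 0"
      using fls_subdegree_poly_unit by auto
    have "Z \<noteq> fls_const a" using Zc by auto
    then have den: "fls_poly Z b \<noteq> 0" "fls_subdegree (fls_poly Z b) = int (order a b) * int e"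
      using fls_subdegree_poly_order[OF _ _ h(2), of Z a] e by (auto simp: Za)
    have "order a b \<ge> 1" using a h(2) by (simp add: order_root Suc_le_eq)
    then have "int e \<le> int (order a b) * int e" using e by simp
    moreover have "int j * fls_subdegree Y < int e" using True Y' e by (auto simp: e_def)
    ultimately have "fls_subdegree (fls_poly Z (coeff p j) / fls_poly Z b * Y ^ j) < 0"
      using num den Y(2) by (simp add: fls_divide_subdegree fls_subdegree_pow)
    then show False using T num den Y(2) by (auto simp: fls_ge_iff)
  qed
qed

text \<open>With \<open>x = s^(-e)\<close>, \<open>e = n / G\<close>, the function \<open>y\<close>
  has order \<open>- degree f / G\<close>. The bound on the single \<open>j\<close>-th term,
  multiplied by \<open>G\<close>, is the asserted inequality.\<close>

lemma infinite_coefficients: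
  assumes g: "g \<in> K" "form q g \<in> holomorphic_differentials K q"
    and h: "g * y ^ ((n - 1) * q) = bipoly_at y p" "degree p < n"
    and j: "j < n" "coeff p j \<noteq> 0"
  shows "int (n * degree (coeff p j) + j * degree f) \<le> deg_bound q"
proof -
  define G e d' where "G = gcd n (degree f)" "e = n div G" "d' = degree f div G"
  have G: "G > 0" "n = e * G" "degree f = d' * G" "coprime e d'"
    using n_ge by (auto simp: G_e_d'_def div_gcd_coprime)
  have e: "e > 0" using G n_ge by (cases e) auto
  have ek: "of_nat e \<noteq> (0 :: 'k)"
  proof
    assume "of_nat e = (0 :: 'k)"
    then have "of_nat (e * G) = (0 :: 'k)" by simp
    then show False using n_nz G(2) by metis
  qed
  have "n dvd e * degree f" unfolding G(2,3) by (simp add: ac_simps)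
  then obtain Y where Y: "Y ^ n = fls_poly (fls_X_inv ^ e) f" "Y \<noteq> 0"
    and nY: "int n * fls_subdegree Y = - int (e * degree f)"
    using infinite_parametrization[OF _ e] by metis
  define Z where "Z = (fls_X_inv :: 'k fls) ^ e"
  have YZ: "Y ^ n = fls_poly Z f" using Y(1) by (simp add: Z_def)
  have Z: "fls_subdegree Z = - int e" by (simp add: Z_def)
  have "int n * fls_subdegree Y = int n * - int d'" unfolding nY by (simp add: G(2,3))
  moreover have "int n \<noteq> 0" using n_ge by simp
  ultimately have Y': "fls_subdegree Y = - int d'" using mult_cancel_left by blast
  \<comment> \<open>As \<open>e\<close> divides \<open>n\<close>, it is nonzero in \<open>k\<close>,
    and differentiation lowers the order by exactly 1.\<close>
  have "of_int (fls_subdegree Z) \<noteq> (0 :: 'k)" using ek by (simp add: Z)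
  then have dZ: "fls_subdegree (fls_deriv Z) = - int e - 1" using fls_subdegree_deriv'[of Z] Z by simp
  have Zc: "Z \<notin> range fls_const" using Z e by auto
  have point: "\<exists>t\<in>K. fls_subdegree (\<Phi> t) = 1"
    if \<Phi>: "laurent_embedding K \<Phi>" "\<Phi> coord_x = Z" "\<zeta> \<noteq> 0" "\<Phi> y = fls_const \<zeta> * Y" for \<Phi> \<zeta>
  proof -
    interpret laurent_point K \<Phi> by (rule laurent_pointI) fact
    \<comment> \<open>The orders of \<open>x\<close> and \<open>y\<close> are the coprime numbers
      \<open>- e\<close> and \<open>- d'\<close>, so a Bezout relation gives a uniformizer as a
      product of their powers.\<close>
    obtain u v where uv: "u * int e + v * int d' = 1"
      using bezout_int[of "int e" "int d'"] G(4) by auto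
    have "\<Phi> (coord_x powi (- u) * y powi (- v)) = Z powi (- u) * (fls_const \<zeta> * Y) powi (- v)"
      using \<Phi> by (simp add: powi_mem)
    moreover have "fls_subdegree (fls_const \<zeta> * Y) = - int d'" using \<Phi>(3) Y Y' by simp
    moreover have "Z powi (- u) \<noteq> 0" "(fls_const \<zeta> * Y) powi (- v) \<noteq> 0"
      using Z e Y \<Phi>(3) by auto
    ultimately have "fls_subdegree (\<Phi> (coord_x powi (- u) * y powi (- v))) = 1"
      using uv Z by simp
    then show ?thesis by (intro bexI[of _ "coord_x powi (- u) * y powi (- v)"] mult_mem powi_mem) auto
  qed
  have h': "g * y ^ ((n - 1) * q) = bipoly_at y p / of_poly 1" using h by simp
  have "fls_ge (int q * (int (n - 1) * fls_subdegree Y - fls_subdegree (fls_deriv Z)))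
      (fls_poly Z (coeff p j) / fls_poly Z 1 * Y ^ j)"
    using holomorphic_coefficient_order[OF g h' one_neq_zero h(2) Zc YZ Y(2) point j(1)] .
  moreover have num: "fls_poly Z (coeff p j) \<noteq> 0"
    "fls_subdegree (fls_poly Z (coeff p j)) = int (degree (coeff p j)) * - int e"
    using fls_subdegree_poly_degree[of Z "coeff p j"] Z e j(2) by auto
  ultimately have "int q * (int (n - 1) * - int d' + int e + 1) \<le>
      int (degree (coeff p j)) * - int e + int j * - int d'"
    using Y(2) unfolding dZ Y' by (simp add: fls_ge_iff fls_subdegree_pow Y' algebra_simps)
  then have "int G * (int q * (int (n - 1) * - int d' + int e + 1)) \<le>
      int G * (int (degree (coeff p j)) * - int e + int j * - int d')"
    by (intro mult_left_mono) auto
  moreover have "int n = int e * int G" "int (degree f) = int d' * int G"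
    using G(2,3) by (metis of_nat_mult)+
  moreover have "int (n - 1) = int n - 1" using n_ge by simp
  ultimately show ?thesis
    unfolding deg_bound_def G_e_d'_def(1)[symmetric] by (simp add: algebra_simps)
qed

text \<open>Take a denominator \<open>b\<close> of least degree. At a root of \<open>b\<close> all
  coefficients of the numerator vanish as well, so a linear factor would cancel; hence
  \<open>b\<close> is constant.\<close>

lemma holomorphic_expansion:
  assumes g: "g \<in> K" "form q g \<in> holomorphic_differentials K q"
  obtains p where "degree p < n" "g * y ^ ((n - 1) * q) = bipoly_at y p"
    "\<And>j. coeff p j \<noteq> 0 \<Longrightarrow> int (n * degree (coeff p j) + j * degree f) \<le> deg_bound q"
proof -
  let ?h = "g * y ^ ((n - 1) * q)"
  let ?R = "\<lambda>(p, b). b \<noteq> 0 \<and> degree p < n \<and> ?h = bipoly_at y p / of_poly b"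
  have "?h \<in> K" using g(1) by (intro mult_mem power_mem) auto
  then obtain p0 b0 where "?R (p0, b0)" using reduced_fraction[of ?h] by auto
  then have "\<exists>pb. ?R pb \<and> (\<forall>pb'. ?R pb' \<longrightarrow> degree (snd pb) \<le> degree (snd pb'))"
    by (rule ex_has_least_nat)
  then obtain p b where pb: "b \<noteq> 0" "degree p < n" "?h = bipoly_at y p / of_poly b"
    and min: "\<And>p' b'. ?R (p', b') \<Longrightarrow> degree b \<le> degree b'" by fastforce
  have "degree b = 0"
  proof (rule ccontr)
    assume "degree b \<noteq> 0"
    then obtain a where a: "poly b a = 0" using alg_closed_imp_poly_has_root[of b] by auto
    let ?p' = "map_poly (\<lambda>c. c div [:- a, 1:]) p"
    obtain b' where b': "b = [:- a, 1:] * b'" using a by (auto simp: poly_eq_0_iff_dvd)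
    have "b' \<noteq> 0" using b' pb(1) by auto
    have p': "p = smult [:- a, 1:] ?p'"
    proof (rule poly_eqI)
      fix j
      have "[:- a, 1:] * (coeff p j div [:- a, 1:]) = coeff p j"
        by (rule dvd_mult_div_cancel[OF finite_coefficients[OF g pb(3,1,2) a]])
      then show "coeff p j = coeff (smult [:- a, 1:] ?p') j" by (simp only: coeff_smult coeff_map_poly div_0)
    qed
    have "degree ?p' < n" using pb(2) map_poly_degree_leq[of "\<lambda>c. c div [:- a, 1:]" p] by simp
    moreover have "of_poly [:- a, 1:] \<noteq> (0 :: 'k alg_fun)" unfolding of_poly_eq_0_iff by simp
    then have "?h = bipoly_at y ?p' / of_poly b'"
      unfolding pb(3) b' by (subst p') (simp only: bivariate.ev_smult of_poly_mult, simp)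
    ultimately have "degree b \<le> degree b'" using min[of ?p' b'] \<open>b' \<noteq> 0\<close> by simp
    moreover have "degree b = Suc (degree b')"
      unfolding b' using \<open>b' \<noteq> 0\<close> by (subst degree_mult_eq) auto
    ultimately show False by simp
  qed
  then obtain c where c: "b = [:c:]" by (rule degree_eq_zeroE)
  let ?p = "smult [:inverse c:] p"
  have "c \<noteq> 0" using c pb(1) by auto
  then have "?h = bipoly_at y ?p"
    unfolding pb(3) c by (simp add: const_fun_inverse divide_inverse mult.commute)
  moreover have "degree ?p < n" using pb(2) \<open>c \<noteq> 0\<close> by simp
  ultimately show ?thesis
    using that infinite_coefficients[OF g, of ?p] by (metis coeff_eq_0 not_le order_le_less_trans leI)
qed

end

context superelliptic
begin

subsection \<open>Branch points\<close>

lemma branch_point_exists: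
  assumes a: "poly f a = 0"
  obtains \<Phi> where "laurent_embedding K \<Phi>" "embedding_ord K \<Phi> \<in> points K"
    "embedding_ord K \<Phi> (coord_x - const_fun a) = int n" "embedding_ord K \<Phi> y = 1"
    "fls_subdegree (fls_deriv (\<Phi> coord_x)) = int (n - 1)"
proof -
  define Z where "Z = fls_const a + (fls_X :: 'k fls) ^ n"
  obtain Y where Y: "Y ^ n = fls_poly Z f" "Y \<noteq> 0" "fls_subdegree Y = 1"
    using finite_parametrization[of n a] a by (auto simp: Z_def)
  have "fls_deriv Z = of_nat n * fls_X ^ (n - 1)" by (simp add: Z_def fls_deriv_power)
  then have dZ: "fls_deriv Z \<noteq> 0" "fls_subdegree (fls_deriv Z) = int (n - 1)" by simp_all
  have Zc: "Z \<notin> range fls_const" using dZ(1) by auto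
  obtain \<Phi> where \<Phi>: "laurent_embedding K \<Phi>" "\<Phi> coord_x = Z" "\<Phi> y = Y"
    using embedding_exists[OF Zc Y(1)] by metis
  interpret laurent_point K \<Phi> by (rule laurent_pointI) fact
  show ?thesis
  proof (rule that[OF \<Phi>(1)])
    show "embedding_ord K \<Phi> \<in> points K"
      by (rule embedding_ord_point[of y]) (use \<Phi> Y in auto)
    show "embedding_ord K \<Phi> (coord_x - const_fun a) = int n"
      by (simp add: embedding_ord_eq \<Phi>) (simp add: Z_def)
    show "embedding_ord K \<Phi> y = 1" using Y(3) by (simp add: embedding_ord_eq \<Phi>)
  qed (use \<Phi> dZ in simp)
qed

text \<open>Here \<open>P\<close> is any point above \<open>a\<close>, with \<open>P y\<close> still
  unknown. As \<open>a\<close> is a simple root of \<open>f\<close>, all orders turn out to be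
  \<open>P y\<close> times numbers that do not depend on \<open>P\<close>; this is the input for
  uniqueness.\<close>

lemma ord_above_branch_point:
  assumes a: "poly f a = 0" and P: "P \<in> points K" "0 < P (coord_x - const_fun a)"
  shows "P (coord_x - const_fun a) = int n * P y"
    and "p \<noteq> 0 \<Longrightarrow> degree p < n \<Longrightarrow> bipoly_at y p \<noteq> 0 \<and> P (bipoly_at y p) =
      P y * Min ((\<lambda>j. int (order a (coeff p j) * n + j)) ` {j. j \<le> degree p \<and> coeff p j \<noteq> 0})"
proof -
  interpret curve_point_x K P by unfold_locales (use P in auto)
  obtain \<Phi> where \<Phi>: "laurent_embedding K \<Phi>" "embedding_ord K \<Phi> = P" by (rule point_embedding[OF P(1)])
  interpret laurent_point K \<Phi> by (rule laurent_pointI) fact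
  have ord: "P h = fls_subdegree (\<Phi> h)" if "h \<in> K" for h
    using embedding_ord_eq[OF that] \<Phi>(2) by simp
  have poly: "P (of_poly c) = int (order a c) * P (coord_x - const_fun a)" if "c \<noteq> 0" for c
  proof -
    have "0 < fls_subdegree (\<Phi> coord_x - fls_const a)" "\<Phi> coord_x \<noteq> fls_const a"
      using P(2) by (auto simp: ord)
    then show ?thesis using fls_subdegree_poly_order[of "\<Phi> coord_x" a c] that
      by (simp add: ord emb_of_poly)
  qed
  have "int n * P y = P (of_poly f)"
    using ord_power[OF y_mem y_nz, of n] by (simp add: curve)
  then show x: "P (coord_x - const_fun a) = int n * P y"
    using poly[OF f_nz] order_f[OF a] by simp
  then have y: "P y > 0" using P(2) by (simp add: zero_less_mult_iff)
  assume p: "p \<noteq> 0" "degree p < n"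
  let ?I = "{j. j \<le> degree p \<and> coeff p j \<noteq> 0}" and ?v = "\<lambda>j. int (order a (coeff p j) * n + j)"
  let ?u = "\<lambda>j. of_poly (coeff p j) * y ^ j"
  have u: "P (?u j) = P y * ?v j" if "j \<in> ?I" for j
    using that by (simp add: ord_mult ord_power power_mem poly x algebra_simps)
  have I: "?I \<noteq> {}" using p(1) leading_coeff_0_iff[of p] by blast
  have inj: "inj_on ?v ?I"
  proof (rule inj_onI)
    fix i j assume ij: "i \<in> ?I" "j \<in> ?I" "?v i = ?v j"
    then have "(order a (coeff p i) * n + i) mod n = (order a (coeff p j) * n + j) mod n"
      by (simp only: of_nat_eq_iff)
    then show "i = j" using ij p(2) by simp
  qed
  have "sum ?u ?I \<noteq> 0 \<and> P (sum ?u ?I) = Min ((\<lambda>j. P (?u j)) ` ?I)"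
  proof (rule ord_sum_distinct)
    show "inj_on (\<lambda>j. P (?u j)) ?I"
    proof (rule inj_onI)
      fix i j assume ij: "i \<in> ?I" "j \<in> ?I" "P (?u i) = P (?u j)"
      have "P y * ?v i = P y * ?v j" using ij(3) unfolding u[OF ij(1)] u[OF ij(2)] .
      then have "?v i = ?v j" using y mult_cancel_left by force
      then show "i = j" using inj ij by (auto dest: inj_onD)
    qed
  qed (use I in \<open>auto intro!: mult_mem power_mem\<close>)
  moreover have "(\<lambda>j. P (?u j)) ` ?I = (*) (P y) ` ?v ` ?I"
    unfolding image_image by (rule image_cong) (use u in auto)
  moreover have "Min ((*) (P y) ` ?v ` ?I) = P y * Min (?v ` ?I)"
    by (rule mono_Min_commute[symmetric]) (use y I in \<open>auto simp: mono_def\<close>)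
  moreover have "bipoly_at y p = sum ?u ?I"
    unfolding bivariate.ev_altdef[OF order_refl] by (rule sum.mono_neutral_right) auto
  ultimately show "bipoly_at y p \<noteq> 0 \<and> P (bipoly_at y p) = P y * Min (?v ` ?I)" by simp
qed

text \<open>By \<open>ord_above_branch_point\<close> the two valuations are proportional with factor
  \<open>P y\<close>, and since \<open>P\<close> attains 1 this positive integer is 1.\<close>

lemma branch_point_unique:
  assumes a: "poly f a = 0"
    and P: "P \<in> points K" "0 < P (coord_x - const_fun a)"
    and Q: "Q \<in> points K" "Q (coord_x - const_fun a) = int n" "Q y = 1"
  shows "P = Q"
proof -
  interpret P: curve_point_x K P by unfold_locales (use P in auto)
  interpret Q: curve_point_x K Q by unfold_locales (use Q in auto)
  have Q0: "0 < Q (coord_x - const_fun a)" using Q n_ge by simp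
  have bi: "P (bipoly_at y p) = P y * Q (bipoly_at y p)" if "p \<noteq> 0" "degree p < n" for p
    using ord_above_branch_point(2)[OF a P that] ord_above_branch_point(2)[OF a Q(1) Q0 that] Q(3)
    by simp
  have bi_mem: "bipoly_at y p \<in> K" for p
    unfolding bivariate.ev_altdef[OF order_refl] by (intro sum_mem mult_mem power_mem P.of_poly_mem) auto
  have eq: "P h = P y * Q h" if h: "h \<in> K" "h \<noteq> 0" for h
  proof -
    obtain p b where pb: "b \<noteq> 0" "degree p < n" "h = bipoly_at y p / of_poly b"
      using reduced_fraction[OF h(1)] by blast
    then have p: "p \<noteq> 0" "bipoly_at y p \<noteq> 0" using h(2) by auto
    have "P (of_poly b) = P y * Q (of_poly b)" using bi[of "[:b:]"] pb(1) n_ge by simp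
    then show ?thesis using bi[OF p(1) pb(2)] pb p bi_mem
      by (simp add: P.ord_divide Q.ord_divide right_diff_distrib)
  qed
  obtain t where t: "t \<in> K" "t \<noteq> 0" "P t = 1" by (rule P.uniformizer)
  then have "P y * Q t = 1" using eq[of t] by simp
  moreover have "P y > 0"
    using P(2) ord_above_branch_point(1)[OF a P] by (simp add: zero_less_mult_iff)
  ultimately have "P y = 1" using zmult_eq_1_iff by force
  then have "P h = Q h" if "h \<in> K" "h \<noteq> 0" for h using eq[OF that] by simp
  show ?thesis
  proof
    fix h show "P h = Q h"
      using \<open>\<And>h. h \<in> K \<Longrightarrow> h \<noteq> 0 \<Longrightarrow> P h = Q h\<close> P.ord_outside[of h] Q.ord_outside[of h] by (cases "h \<in> K"; cases "h = 0") auto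
  qed
qed

lemma affine_branch_point:
  assumes a: "poly f a = 0"
    and Q: "Q \<in> points K" "Q (coord_x - const_fun a) = int n" "Q y = 1"
  shows "affine_point y a 0 = Q"
  unfolding affine_point_def
proof (rule the_equality)
  show "Q \<in> points K \<and> has_value Q coord_x a \<and> has_value Q y 0"
    using Q n_ge by (simp add: has_value_def)
next
  fix P assume "P \<in> points K \<and> has_value P coord_x a \<and> has_value P y 0"
  then show "P = Q" using branch_point_unique[OF a _ _ Q] coord_x_neq_const by (auto simp: has_value_def)
qed

subsection \<open>The gap sequence at a branch point\<close>

text \<open>The number \<open>m = i n + j\<close> with \<open>j < n\<close> encodes the exponents
  \<open>(i, j)\<close> and is at the same time the order of the corresponding differential at a
  branch point.\<close>

definition order_set :: "nat \<Rightarrow> nat set"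
  where "order_set q = {m. int (m div n * n + m mod n * degree f) \<le> deg_bound q}"

definition basis_form :: "'k \<Rightarrow> nat \<Rightarrow> nat \<Rightarrow> 'k differential"
  where "basis_form a q m = form q (monomial a q (m div n) (m mod n))"

lemma order_set_le: assumes "m \<in> order_set q" shows "int m \<le> deg_bound q"
proof -
  have "m mod n * 1 \<le> m mod n * degree f" using n_less by (intro mult_left_mono) auto
  then have "m \<le> m div n * n + m mod n * degree f"
    using div_mult_mod_eq[of m n] by linarith
  then have "int m \<le> int (m div n * n + m mod n * degree f)" by (simp only: of_nat_le_iff)
  also have "\<dots> \<le> deg_bound q" using assms unfolding order_set_def by simp
  finally show ?thesis .
qed

lemma finite_order_set: "finite (order_set q)"
  by (rule finite_subset[of _ "{..nat (deg_bound q)}"]) (use order_set_le in fastforce)+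

lemma basis_form_holomorphic:
  "m \<in> order_set q \<Longrightarrow> basis_form a q m \<in> holomorphic_differentials K q"
  unfolding basis_form_def by (rule monomial_holomorphic) (simp add: order_set_def)

lemma holomorphicE:
  assumes "\<omega> \<in> holomorphic_differentials K q"
  obtains g where "g \<in> K" "\<omega> = form q g"
  using assms that by (auto simp: holomorphic_differentials_def differentials_eq)

text \<open>Zero is treated separately throughout, as \<open>diff_ord\<close> is meaningful only for
  nonzero differentials.\<close>

lemma subspace_holomorphic: "diff.subspace (holomorphic_differentials K q)"
proof (rule diff.subspaceI)
  let ?H = "holomorphic_differentials K q"
  show 0: "0 \<in> ?H"
    unfolding holomorphic_differentials_def differentials_eq using form_0[of q] zero_mem by (auto intro!: image_eqI[of _ _ 0])
  show "\<omega> + \<eta> \<in> ?H" if \<omega>: "\<omega> \<in> ?H" "\<eta> \<in> ?H" for \<omega> \<eta>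
  proof -
    obtain g h where gh: "g \<in> K" "h \<in> K" and eq: "\<omega> = form q g" "\<eta> = form q h"
      using \<omega> by (metis holomorphicE)
    have sum: "\<omega> + \<eta> = form q (g + h)" by (simp add: eq form_add)
    show ?thesis
    proof (cases "g = 0 \<or> h = 0 \<or> g + h = 0")
      case True
      then have "form q (g + h) \<in> ?H" using \<omega> 0 unfolding eq by auto
      then show ?thesis by (simp only: sum)
    next
      case False
      have "form q (g + h) \<in> ?H"
      proof (subst form_holomorphic_iff; (intro allI impI, elim conjE)?)
        fix \<Phi> assume \<Phi>: "laurent_embedding K \<Phi>" "embedding_ord K \<Phi> \<in> points K"
        interpret curve_point K "embedding_ord K \<Phi>" by unfold_locales fact
        have "min (embedding_ord K \<Phi> g) (embedding_ord K \<Phi> h) \<le> embedding_ord K \<Phi> (g + h)"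
          using gh False by (intro ord_add) auto
        moreover have "0 \<le> embedding_ord K \<Phi> g + int q * fls_subdegree (fls_deriv (\<Phi> coord_x))"
          using \<omega>(1) False gh \<Phi> unfolding eq by (subst (asm) form_holomorphic_iff) auto
        moreover have "0 \<le> embedding_ord K \<Phi> h + int q * fls_subdegree (fls_deriv (\<Phi> coord_x))"
          using \<omega>(2) False gh \<Phi> unfolding eq by (subst (asm) form_holomorphic_iff) auto
        ultimately show "0 \<le> embedding_ord K \<Phi> (g + h) + int q * fls_subdegree (fls_deriv (\<Phi> coord_x))"
          by linarith
      qed (use gh False in auto)
      then show ?thesis by (simp add: sum)
    qed
  qed
  show "diff_scale c \<omega> \<in> ?H" if \<omega>: "\<omega> \<in> ?H" for c \<omega>
  proof -
    obtain g where g: "g \<in> K" and eq: "\<omega> = form q g"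
      using \<omega> by (rule holomorphicE)
    show ?thesis
    proof (cases "c = 0 \<or> g = 0")
      case True
      then show ?thesis using 0 by (auto simp: eq form_scale)
    next
      case False
      have "form q (const_fun c * g) \<in> ?H"
      proof (subst form_holomorphic_iff; (intro allI impI, elim conjE)?)
        fix \<Phi> assume \<Phi>: "laurent_embedding K \<Phi>" "embedding_ord K \<Phi> \<in> points K"
        interpret curve_point K "embedding_ord K \<Phi>" by unfold_locales fact
        show "0 \<le> embedding_ord K \<Phi> (const_fun c * g) + int q * fls_subdegree (fls_deriv (\<Phi> coord_x))"
          using \<omega> False g \<Phi> unfolding eq
          by (subst (asm) form_holomorphic_iff) (auto simp: ord_mult const_fun_eq_0_iff)
      qed (use g False in \<open>auto simp: const_fun_eq_0_iff\<close>)
      then show ?thesis by (simp add: eq form_scale)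
    qed
  qed
qed

text \<open>Expanding each coefficient in powers of \<open>x - a\<close> instead of \<open>x\<close>
  preserves its degree, so the bound on \<open>i n + j d\<close> carries over to the shifted
  monomials.\<close>

lemma holomorphic_subset_span:
  "holomorphic_differentials K q \<subseteq> diff.span (basis_form a q ` order_set q)"
proof
  fix \<omega> assume \<omega>: "\<omega> \<in> holomorphic_differentials K q"
  then obtain g where g: "g \<in> K" "\<omega> = form q g" by (rule holomorphicE)
  obtain p where p: "degree p < n" "g * y ^ ((n - 1) * q) = bipoly_at y p"
    and bound: "\<And>j. coeff p j \<noteq> 0 \<Longrightarrow> int (n * degree (coeff p j) + j * degree f) \<le> deg_bound q"
    using holomorphic_expansion[OF g(1)] \<omega> g(2) by metis
  define r where "r j = pcompose (coeff p j) [:a, 1:]" for j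
  have deg: "degree (r j) = degree (coeff p j)" for j by (simp add: r_def degree_pcompose)
  have "g = bipoly_at y p / y ^ ((n - 1) * q)" using p(2) by (simp add: field_simps)
  also have "bipoly_at y p = (\<Sum>j\<le>n - 1. of_poly (coeff p j) * y ^ j)"
    using p(1) by (intro bivariate.ev_altdef) simp
  also have "\<dots> = (\<Sum>j\<le>n - 1. \<Sum>i\<le>degree (r j).
      const_fun (coeff (r j) i) * (coord_x - const_fun a) ^ i * y ^ j)"
    unfolding of_poly_taylor[of _ a] r_def[symmetric]
    by (simp add: const_poly.ev_altdef[OF order_refl] sum_distrib_right)
  finally have "g = (\<Sum>j\<le>n - 1. \<Sum>i\<le>degree (r j). const_fun (coeff (r j) i) * monomial a q i j)"
    by (simp add: sum_divide_distrib monomial_def mult.assoc)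
  then have \<omega>_eq: "\<omega> = (\<Sum>j\<le>n - 1. \<Sum>i\<le>degree (r j). diff_scale (coeff (r j) i) (form q (monomial a q i j)))"
    by (simp add: g(2) form_sum form_scale)
  show "\<omega> \<in> diff.span (basis_form a q ` order_set q)"
    unfolding \<omega>_eq
  proof (intro diff.span_sum)
    fix j i assume ij: "j \<in> {..n - 1}" "i \<in> {..degree (r j)}"
    show "diff_scale (coeff (r j) i) (form q (monomial a q i j)) \<in> diff.span (basis_form a q ` order_set q)"
    proof (cases "coeff p j = 0")
      case True
      then have "diff_scale (coeff (r j) i) (form q (monomial a q i j)) = 0"
        by (simp add: r_def form_scale)
      then show ?thesis by (simp only: diff.span_zero)
    next
      case False
      let ?m = "i * n + j"
      have "j < n" using ij(1) n_ge by auto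
      then have m: "?m div n = i" "?m mod n = j" by simp_all
      have "i * n \<le> n * degree (coeff p j)" using ij(2) deg by simp
      then have "int (i * n + j * degree f) \<le> int (n * degree (coeff p j) + j * degree f)"
        by (simp only: of_nat_le_iff)
      also note bound[OF False]
      finally have "?m \<in> order_set q" by (simp only: order_set_def mem_Collect_eq m)
      moreover have "form q (monomial a q i j) = basis_form a q ?m" by (simp only: basis_form_def m)
      ultimately show ?thesis by (simp only: diff.span_scale diff.span_base imageI)
    qed
  qed
qed

lemma span_basis_form: "diff.span (basis_form a q ` order_set q) = holomorphic_differentials K q"
  by (intro equalityI holomorphic_subset_span diff.span_minimal subspace_holomorphic)
    (auto intro: basis_form_holomorphic)

lemma int_div_mod_eq: "int (m div k) * int k + int (m mod k) = int m"
  by (metis div_mult_mod_eq of_nat_add of_nat_mult)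

text \<open>The denominator contributes \<open>- q (n - 1)\<close> and \<open>(dx)^q\<close>
  contributes \<open>q (n - 1)\<close>; what remains is \<open>i n + j\<close>.\<close>

lemma diff_ord_basis_form:
  assumes a: "poly f a = 0"
  shows "diff_ord K q (affine_point y a 0) (basis_form a q m) = int m"
proof -
  obtain \<Phi> where \<Phi>: "laurent_embedding K \<Phi>" "embedding_ord K \<Phi> \<in> points K"
    and ord: "embedding_ord K \<Phi> (coord_x - const_fun a) = int n" "embedding_ord K \<Phi> y = 1"
    and d: "fls_subdegree (fls_deriv (\<Phi> coord_x)) = int (n - 1)"
    using branch_point_exists[OF a] by blast
  have "affine_point y a 0 = embedding_ord K \<Phi>" by (rule affine_branch_point[OF a \<Phi>(2) ord])
  then have "diff_ord K q (affine_point y a 0) (basis_form a q m) =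
      int (m div n) * int n + int (m mod n)"
    using diff_ord_form[OF \<Phi> monomial_mem monomial_nz]
    by (simp add: basis_form_def ord_monomial[OF \<Phi>(2)] ord d)
  then show ?thesis by (simp only: int_div_mod_eq)
qed

lemma inj_basis_form: assumes a: "poly f a = 0" shows "inj_on (basis_form a q) S"
  using diff_ord_basis_form[OF a, of q] by (intro inj_onI) (metis of_nat_eq_iff)

text \<open>The terms with nonzero coefficient have the distinct orders \<open>m - q (n - 1)\<close>
  as functions at the branch point, so their sum is nonzero.\<close>

lemma independent_basis_form:
  assumes a: "poly f a = 0" shows "diff.independent (basis_form a q ` order_set q)"
proof
  let ?mon = "\<lambda>m. monomial a q (m div n) (m mod n)"
  assume "diff.dependent (basis_form a q ` order_set q)"
  then obtain B u where B: "finite B" "B \<subseteq> basis_form a q ` order_set q"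
    and u: "(\<Sum>v\<in>B. diff_scale (u v) v) = 0" "\<exists>v\<in>B. u v \<noteq> 0"
    unfolding diff.dependent_explicit by blast
  obtain T where T: "T \<subseteq> order_set q" "finite T" "B = basis_form a q ` T"
    using finite_subset_image[OF B] by blast
  let ?c = "\<lambda>m. u (basis_form a q m)" and ?T = "{m \<in> T. u (basis_form a q m) \<noteq> 0}"
  have "0 = (\<Sum>m\<in>T. diff_scale (?c m) (basis_form a q m))"
    using u(1) unfolding T(3) sum.reindex[OF inj_basis_form[OF a]] by simp
  also have "\<dots> = (\<Sum>m\<in>T. form q (const_fun (?c m) * ?mon m))"
    by (simp add: basis_form_def form_scale)
  also have "\<dots> = form q (\<Sum>m\<in>T. const_fun (?c m) * ?mon m)" by (rule form_sum[symmetric])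
  also have "(\<Sum>m\<in>T. const_fun (?c m) * ?mon m) = (\<Sum>m\<in>?T. const_fun (?c m) * ?mon m)"
    by (rule sum.mono_neutral_right) (use T in auto)
  finally have "form q (\<Sum>m\<in>?T. const_fun (?c m) * ?mon m) = 0" by (rule sym)
  then have 0: "(\<Sum>m\<in>?T. const_fun (?c m) * ?mon m) = 0" by (simp only: form_eq_0_iff)
  obtain \<Phi> where "embedding_ord K \<Phi> \<in> points K"
    and ord: "embedding_ord K \<Phi> (coord_x - const_fun a) = int n" "embedding_ord K \<Phi> y = 1"
    using branch_point_exists[OF a] by blast
  then interpret curve_point K "embedding_ord K \<Phi>" by unfold_locales
  have val: "embedding_ord K \<Phi> (const_fun (?c m) * ?mon m) = int m - int q * int (n - 1)"
    if "m \<in> ?T" for m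
    using that int_div_mod_eq[of m n]
    by (simp add: ord_mult monomial_mem monomial_nz ord_monomial[OF point] ord const_fun_eq_0_iff)
  have "(\<Sum>m\<in>?T. const_fun (?c m) * ?mon m) \<noteq> 0"
  proof (rule conjunct1[OF ord_sum_distinct])
    show "inj_on (\<lambda>m. embedding_ord K \<Phi> (const_fun (?c m) * ?mon m)) ?T"
      using val by (intro inj_onI) simp
    show "?T \<noteq> {}" using u(2) T(3) by auto
  qed (use T in \<open>auto intro: monomial_mem simp: monomial_nz const_fun_eq_0_iff\<close>)
  then show False using 0 by simp
qed

lemma dim_holomorphic: "diff.dim (holomorphic_differentials K q) = card (order_set q)"
proof -
  obtain a where a: "poly f a = 0" using branch_exists by blast
  have "diff.dim (holomorphic_differentials K q) = card (basis_form a q ` order_set q)"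
    unfolding span_basis_form[symmetric, of q a] diff.dim_span
    by (rule diff.dim_eq_card_independent[OF independent_basis_form[OF a]])
  then show ?thesis by (simp add: card_image inj_basis_form[OF a])
qed

lemma gap_sequence_branch_point:
  assumes a: "poly f a = 0"
  shows "is_gap_sequence K q (affine_point y a 0) ((\<lambda>m. int m + 1) ` order_set q)"
proof -
  let ?c = "card (order_set q)"
  \<comment> \<open>Enumerating the orders increasingly sorts the basis as a gap sequence demands;
    \<open>h\<close> counts from 0 and \<open>\<psi>\<close> from 1.\<close>
  obtain h where h: "bij_betw h {..<?c} (order_set q)" "strict_mono_on {..<?c} h"
    using ex_bij_betw_strict_mono_card[OF finite_order_set[of q]] by blast
  have pred: "(\<lambda>i. i - 1) ` {1..?c} = {..<?c}"
    by (auto simp: image_iff intro!: bexI[of _ "Suc _"])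
  define \<psi> where "\<psi> = (\<lambda>i. basis_form a q (h (i - 1)))"
  have img: "(\<lambda>i. h (i - 1)) ` {1..?c} = order_set q"
    using pred h(1) by (metis bij_betw_imp_surj_on image_image)
  have ord: "diff_ord K q (affine_point y a 0) (\<psi> i) = int (h (i - 1))" for i
    by (simp add: \<psi>_def diff_ord_basis_form[OF a])
  have mono: "h (i - 1) < h (j - 1)" if "i \<in> {1..?c}" "j \<in> {1..?c}" "i < j" for i j
    using that by (intro strict_mono_onD[OF h(2)]) auto
  have \<psi>_img: "\<psi> ` {1..?c} = basis_form a q ` order_set q"
    using arg_cong[OF img, of "image (basis_form a q)"] by (simp only: image_image \<psi>_def)
  show ?thesis
    unfolding is_gap_sequence_def Let_def dim_holomorphic
  proof (intro exI[of _ \<psi>] conjI)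
    show "inj_on \<psi> {1..?c}"
      using ord mono by (intro linorder_inj_onI') (metis less_irrefl of_nat_eq_iff)
    show "strict_mono_on {1..?c} (\<lambda>i. diff_ord K q (affine_point y a 0) (\<psi> i))"
      unfolding ord using mono by (intro strict_mono_onI) simp
    show "(\<lambda>m. int m + 1) ` order_set q = (\<lambda>i. diff_ord K q (affine_point y a 0) (\<psi> i) + 1) ` {1..?c}"
      using arg_cong[OF img, of "image (\<lambda>m. int m + 1)"] by (simp only: image_image ord)
    show "diff.independent (\<psi> ` {1..?c})"
      unfolding \<psi>_img by (rule independent_basis_form[OF a])
    show "diff.span (\<psi> ` {1..?c}) = holomorphic_differentials K q"
      unfolding \<psi>_img by (rule span_basis_form)
  qed
qed

section \<open>The missing order\<close>

text \<open>The genus is the size of \<open>order_set 1\<close>, so the assumption on it becomes an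
  inequality between \<open>n\<close>, \<open>degree f\<close> and their gcd. For
  \<open>n \<ge> 3\<close> the estimate \<open>gcd \<le> degree f - n\<close> gives
  \<open>deg_bound 1 \<ge> degree f\<close>.\<close>

lemma deg_bound_ge:
  assumes genus: "2 \<le> genus K" and q: "q \<ge> 1"
  shows "int n \<le> deg_bound q" and "2 * n \<le> (n - 1) * degree f"
proof -
  let ?d = "degree f" and ?G = "gcd n (degree f)"
  have one: "deg_bound 1 = int ?d * int n - int ?d - int n - int ?G" by (simp add: deg_bound_def)
  \<comment> \<open>With a nonpositive bound only \<open>m = 0\<close> could occur, and the genus
    would be at most 1.\<close>
  have pos: "0 < deg_bound 1"
  proof (rule ccontr)
    assume "\<not> 0 < deg_bound 1"
    then have "order_set 1 \<subseteq> {0}" using order_set_le[of _ 1] by fastforce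
    then have "card (order_set 1) \<le> card {0::nat}" by (intro card_mono) auto
    then show False using genus by (simp add: genus_def dim_holomorphic)
  qed
  have "?G dvd ?d - n" by (simp add: dvd_diff_nat)
  then have G: "?G \<le> ?d - n" using n_less by (intro dvd_imp_le) auto
  have "int n \<le> deg_bound 1 \<and> 2 * n \<le> (n - 1) * ?d"
  proof (cases "n = 2")
    case True
    \<comment> \<open>For \<open>n = 2\<close> the bound is \<open>degree f - 2 - gcd\<close>. It
      vanishes for degrees 3 and 4, the elliptic cases, so \<open>pos\<close> leaves degree at least
      5.\<close>
    have "?G \<le> n" using n_ge by (intro gcd_le1_nat) simp
    moreover have "int ?d * int n = int ?d * 2" using True by simp
    then have "deg_bound 1 = int ?d - int n - int ?G" using one True by linarith
    moreover have gcds: "gcd 2 (3::nat) = 1" "gcd 2 (4::nat) = 2" "gcd 2 (5::nat) = 1"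
      by (simp_all add: gcd_non_0_nat)
    moreover have "?G = (if ?d = 4 then 2 else 1)" if "?d \<in> {3, 4, 5}"
      using that gcds True by auto
    ultimately have "2 \<le> deg_bound 1 \<and> 5 \<le> ?d"
      using pos n_less True
    proof (cases "?d \<in> {3, 4, 5}")
      case False
      then have "6 \<le> ?d" using n_less True by auto
      then show ?thesis
        using \<open>?G \<le> n\<close> \<open>deg_bound 1 = int ?d - int n - int ?G\<close> True by linarith
    qed (auto split: if_splits)
    then show ?thesis using True by simp
  next
    case False
    then have n: "3 \<le> n" using n_ge by simp
    have "int ?d * 3 \<le> int ?d * int n" using n by (intro mult_left_mono) auto
    moreover have "int ?G \<le> int ?d - int n" using G n_less by linarith
    ultimately have "int n \<le> deg_bound 1" unfolding one using n_less by linarith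
    moreover have "2 * ?d \<le> (n - 1) * ?d" using n by (intro mult_right_mono) auto
    ultimately show ?thesis using n_less by linarith
  qed
  moreover have "deg_bound q = int q * deg_bound 1" by (simp add: deg_bound_def)
  moreover have "1 * deg_bound 1 \<le> int q * deg_bound 1"
    using q pos by (intro mult_right_mono) auto
  ultimately show "int n \<le> deg_bound q" "2 * n \<le> (n - 1) * degree f" by auto
qed

lemma order_set_gap:
  assumes genus: "2 \<le> genus K" and q: "q \<ge> 1"
  shows "\<exists>m. m \<notin> order_set q \<and> Suc m \<in> order_set q"
proof -
  let ?d = "degree f"
  note b = deg_bound_ge[OF genus q]
  obtain N where N: "deg_bound q = int N" "n \<le> N"
    using b(1) nonneg_int_cases[of "deg_bound q"] by (metis of_nat_0_le_iff of_nat_le_iff order_trans)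
  define i where "i = N div n"
  have i: "i \<ge> 1" using N n_ge by (simp add: i_def div_greater_zero_iff Suc_le_eq)
  then obtain k where k: "i = Suc k" by (cases i) auto
  have i1: "i * n \<le> N" "N < i * n + n"
    using div_mult_mod_eq[of N n] mod_less_divisor[of n N] n_ge unfolding i_def by linarith+
  have "i * n \<in> order_set q"
    using i1(1) n_ge unfolding order_set_def mem_Collect_eq N(1) of_nat_le_iff by simp
  moreover have "k * n + (n - 1) \<notin> order_set q"
  proof -
    have "n - 1 < n" using n_ge by simp
    then have m: "(k * n + (n - 1)) div n = k" "(k * n + (n - 1)) mod n = n - 1"
      by (simp_all only: div_mult_self3 mod_mult_self3 div_less mod_less)
    \<comment> \<open>By maximality of \<open>i = k + 1\<close>, \<open>N < k n + 2 n\<close>, and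
      \<open>2 n \<le> (n - 1) d\<close> by the assumption on the genus.\<close>
    have "N < k * n + (n - 1) * ?d" using i1(2) b(2) by (simp add: k)
    then show ?thesis unfolding order_set_def mem_Collect_eq m N(1) of_nat_le_iff by simp
  qed
  moreover have "Suc (k * n + (n - 1)) = i * n" using n_ge by (simp add: k)
  ultimately show ?thesis by metis
qed

lemma branch_point_Weierstrass:
  assumes genus: "2 \<le> genus K" and q: "q \<ge> 1" and a: "poly f a = 0"
  shows "is_q_Weierstrass K q (affine_point y a 0)"
proof -
  let ?G = "(\<lambda>m. int m + 1) ` order_set q"
  obtain \<Phi> where \<Phi>: "embedding_ord K \<Phi> \<in> points K"
    "embedding_ord K \<Phi> (coord_x - const_fun a) = int n" "embedding_ord K \<Phi> y = 1"
    using branch_point_exists[OF a] by blast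
  then have "affine_point y a 0 \<in> points K" using affine_branch_point[OF a \<Phi>] by simp
  moreover have "?G \<noteq> {1..int c}" for c
  proof
    assume G: "?G = {1..int c}"
    obtain m where m: "m \<notin> order_set q" "Suc m \<in> order_set q"
      using order_set_gap[OF genus q] by blast
    \<comment> \<open>An interval that starts at 1 and contains \<open>m + 2\<close> also contains
      \<open>m + 1\<close>.\<close>
    have "int (Suc m) + 1 \<in> {1..int c}" using m(2) unfolding G[symmetric] by (rule imageI)
    then have "int m + 1 \<in> ?G" unfolding G by simp
    then show False using m(1) by auto
  qed
  ultimately show ?thesis
    unfolding is_q_Weierstrass_def
    by (intro conjI exI[of _ ?G] gap_sequence_branch_point[OF a])
qed

end

theorem proposition9:
  fixes f :: "'k::alg_closed_field poly" and n d :: nat and \<alpha> :: "nat \<Rightarrow> 'k"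
    and y :: "'k alg_fun"
  assumes "2 \<le> n" and "n < d"
    and "\<not> CHAR('k) dvd n"
    and "degree f = d" and "rsquarefree f"
    and "bij_betw \<alpha> {1..d} {a. poly f a = 0}"
    and "y ^ n = of_poly f"
    and "2 \<le> genus (function_field y)"
  shows "\<forall>i\<in>{1..d}. \<forall>q\<ge>1. is_q_Weierstrass (function_field y) q (affine_point y (\<alpha> i) 0)"
proof (intro ballI allI impI)
  interpret superelliptic f n y by unfold_locales (use assms in simp_all)
  fix i q :: nat assume "i \<in> {1..d}" "1 \<le> q"
  moreover from this have "poly f (\<alpha> i) = 0" using bij_betwE[OF assms(6)] by blast
  ultimately show "is_q_Weierstrass (function_field y) q (affine_point y (\<alpha> i) 0)"
    using branch_point_Weierstrass[OF assms(8)] by blast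
qed

end
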